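(* In $\mathsf{RCA}_0$, for a countable integral domain $R$, the following are equivalent: (1) $R$ is a UFD: every nonzero $r\in R$ can be written $r=uq_1\cdots q_n$ with $u$ a unit and $q_1,\ldots,q_n$ irreducible, and for any other such factorisation $r=u'q'_1\cdots q'_m$ we have $n=m$ and a bijection $h:\{1,\ldots,n\}\to\{1,\ldots,n\}$ with $q_i$ and $q'_{h(i)}$ associates for all $i$; (2) every nonzero element $r\in R$ factors as a unit times a product of prime elements.
   Context: $\mathsf{RCA}_0$: basic arithmetic, $\Sigma^0_1$-induction, $\Delta^0_1$-comprehension. An integral domain is a commutative ring with unity with no nonzero zero-divisors. $u$ is a unit if $uv=1$ for some $v$; $r$ is irreducible if $r\neq0$, not a unit, and $r=ab$ implies $a$ or $b$ is a unit; $r$ is prime if $r\neq0$, not a unit, and $r\mid ab$ implies $r\mid a$ or $r\mid b$; $r,s$ are associates if $r=su$ for a unit $u$. *)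

theory Defs
  imports Main
begin

section \<open>Structures for the language of second-order arithmetic\<close>

text \<open>
  Henkin structures: the number variables range over the whole type \<open>'a\<close> (possibly containing
  nonstandard numbers), the set variables range over the subsets of \<open>'a\<close> that belong to
  \<open>Sets M\<close>.
\<close>

record 'a l2_structure =
  Zero :: 'a                              (\<open>\<zero>\<index>\<close>)
  One :: 'a                               (\<open>\<one>\<index>\<close>)
  Plus :: "'a \<Rightarrow> 'a \<Rightarrow> 'a"               (infixl \<open>\<oplus>\<index>\<close> 65)
  Times :: "'a \<Rightarrow> 'a \<Rightarrow> 'a"              (infixl \<open>\<otimes>\<index>\<close> 70)
  Less :: "'a \<Rightarrow> 'a \<Rightarrow> bool"             (infix \<open>\<prec>\<index>\<close> 50)
  Sets :: "'a set set"

datatype l2_term =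
    TVar nat
  | TZero
  | TOne
  | TPlus l2_term l2_term
  | TTimes l2_term l2_term

text \<open>
  Arithmetical formulas: free set variables are allowed as parameters, but there are no set
  quantifiers, as none occur in the formulas to which the two axiom schemes of
  \<open>RCA\<^sub>0\<close> apply.  Number variables and set variables are two separate families of names.
\<close>

datatype l2_formula =
    FEq l2_term l2_term
  | FLess l2_term l2_term
  | FMem l2_term nat
  | FNot l2_formula
  | FAnd l2_formula l2_formula
  | FImp l2_formula l2_formula
  | FAll nat l2_formula
  | FEx nat l2_formula

primrec term_vars :: "l2_term \<Rightarrow> nat set" where
  "term_vars (TVar x) = {x}"
| "term_vars TZero = {}"
| "term_vars TOne = {}"
| "term_vars (TPlus s t) = term_vars s \<union> term_vars t"
| "term_vars (TTimes s t) = term_vars s \<union> term_vars t"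

primrec term_val :: "('a, 'm) l2_structure_scheme \<Rightarrow> (nat \<Rightarrow> 'a) \<Rightarrow> l2_term \<Rightarrow> 'a" where
  "term_val M e (TVar x) = e x"
| "term_val M e TZero = \<zero>\<^bsub>M\<^esub>"
| "term_val M e TOne = \<one>\<^bsub>M\<^esub>"
| "term_val M e (TPlus s t) = term_val M e s \<oplus>\<^bsub>M\<^esub> term_val M e t"
| "term_val M e (TTimes s t) = term_val M e s \<otimes>\<^bsub>M\<^esub> term_val M e t"

primrec sat :: "('a, 'm) l2_structure_scheme \<Rightarrow> (nat \<Rightarrow> 'a set) \<Rightarrow> (nat \<Rightarrow> 'a) \<Rightarrow> l2_formula \<Rightarrow> bool"
  where
  "sat M E e (FEq s t) \<longleftrightarrow> term_val M e s = term_val M e t"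
| "sat M E e (FLess s t) \<longleftrightarrow> term_val M e s \<prec>\<^bsub>M\<^esub> term_val M e t"
| "sat M E e (FMem t X) \<longleftrightarrow> term_val M e t \<in> E X"
| "sat M E e (FNot \<phi>) \<longleftrightarrow> \<not> sat M E e \<phi>"
| "sat M E e (FAnd \<phi> \<psi>) \<longleftrightarrow> sat M E e \<phi> \<and> sat M E e \<psi>"
| "sat M E e (FImp \<phi> \<psi>) \<longleftrightarrow> (sat M E e \<phi> \<longrightarrow> sat M E e \<psi>)"
| "sat M E e (FAll x \<phi>) \<longleftrightarrow> (\<forall>a. sat M E (e(x := a)) \<phi>)"
| "sat M E e (FEx x \<phi>) \<longleftrightarrow> (\<exists>a. sat M E (e(x := a)) \<phi>)"

inductive Sigma00 :: "l2_formula \<Rightarrow> bool" where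
  "Sigma00 (FEq s t)"
| "Sigma00 (FLess s t)"
| "Sigma00 (FMem t X)"
| "Sigma00 \<phi> \<Longrightarrow> Sigma00 (FNot \<phi>)"
| "Sigma00 \<phi> \<Longrightarrow> Sigma00 \<psi> \<Longrightarrow> Sigma00 (FAnd \<phi> \<psi>)"
| "Sigma00 \<phi> \<Longrightarrow> Sigma00 \<psi> \<Longrightarrow> Sigma00 (FImp \<phi> \<psi>)"
| "x \<notin> term_vars t \<Longrightarrow> Sigma00 \<phi> \<Longrightarrow> Sigma00 (FAll x (FImp (FLess (TVar x) t) \<phi>))"
| "x \<notin> term_vars t \<Longrightarrow> Sigma00 \<phi> \<Longrightarrow> Sigma00 (FEx x (FAnd (FLess (TVar x) t) \<phi>))"

definition Sigma01 :: "l2_formula \<Rightarrow> bool" where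
  "Sigma01 \<phi> \<longleftrightarrow> (\<exists>x \<theta>. Sigma00 \<theta> \<and> \<phi> = FEx x \<theta>)"

definition Pi01 :: "l2_formula \<Rightarrow> bool" where
  "Pi01 \<phi> \<longleftrightarrow> (\<exists>x \<theta>. Sigma00 \<theta> \<and> \<phi> = FAll x \<theta>)"


section \<open>Models of \<open>RCA\<^sub>0\<close>\<close>

definition basic_axioms :: "('a, 'm) l2_structure_scheme \<Rightarrow> bool" where
  "basic_axioms M \<longleftrightarrow>
     (\<forall>n. n \<oplus>\<^bsub>M\<^esub> \<one>\<^bsub>M\<^esub> \<noteq> \<zero>\<^bsub>M\<^esub>) \<and>
     (\<forall>m n. m \<oplus>\<^bsub>M\<^esub> \<one>\<^bsub>M\<^esub> = n \<oplus>\<^bsub>M\<^esub> \<one>\<^bsub>M\<^esub> \<longrightarrow> m = n) \<and>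
     (\<forall>m. m \<oplus>\<^bsub>M\<^esub> \<zero>\<^bsub>M\<^esub> = m) \<and>
     (\<forall>m n. m \<oplus>\<^bsub>M\<^esub> (n \<oplus>\<^bsub>M\<^esub> \<one>\<^bsub>M\<^esub>) = (m \<oplus>\<^bsub>M\<^esub> n) \<oplus>\<^bsub>M\<^esub> \<one>\<^bsub>M\<^esub>) \<and>
     (\<forall>m. m \<otimes>\<^bsub>M\<^esub> \<zero>\<^bsub>M\<^esub> = \<zero>\<^bsub>M\<^esub>) \<and>
     (\<forall>m n. m \<otimes>\<^bsub>M\<^esub> (n \<oplus>\<^bsub>M\<^esub> \<one>\<^bsub>M\<^esub>) = (m \<otimes>\<^bsub>M\<^esub> n) \<oplus>\<^bsub>M\<^esub> m) \<and>
     (\<forall>m. \<not> m \<prec>\<^bsub>M\<^esub> \<zero>\<^bsub>M\<^esub>) \<and>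
     (\<forall>m n. m \<prec>\<^bsub>M\<^esub> n \<oplus>\<^bsub>M\<^esub> \<one>\<^bsub>M\<^esub> \<longleftrightarrow> m \<prec>\<^bsub>M\<^esub> n \<or> m = n)"

definition Sigma01_induction :: "('a, 'm) l2_structure_scheme \<Rightarrow> bool" where
  "Sigma01_induction M \<longleftrightarrow>
     (\<forall>\<phi> x E e. Sigma01 \<phi> \<longrightarrow> range E \<subseteq> Sets M \<longrightarrow>
        sat M E (e(x := \<zero>\<^bsub>M\<^esub>)) \<phi> \<longrightarrow>
        (\<forall>n. sat M E (e(x := n)) \<phi> \<longrightarrow> sat M E (e(x := n \<oplus>\<^bsub>M\<^esub> \<one>\<^bsub>M\<^esub>)) \<phi>) \<longrightarrow>
        (\<forall>n. sat M E (e(x := n)) \<phi>))"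

definition Delta01_comprehension :: "('a, 'm) l2_structure_scheme \<Rightarrow> bool" where
  "Delta01_comprehension M \<longleftrightarrow>
     (\<forall>\<phi> \<psi> x E e. Sigma01 \<phi> \<longrightarrow> Pi01 \<psi> \<longrightarrow> range E \<subseteq> Sets M \<longrightarrow>
        (\<forall>n. sat M E (e(x := n)) \<phi> \<longleftrightarrow> sat M E (e(x := n)) \<psi>) \<longrightarrow>
        (\<exists>X\<in>Sets M. \<forall>n. n \<in> X \<longleftrightarrow> sat M E (e(x := n)) \<phi>))"

text \<open>
  The environment \<open>E\<close> takes values in \<open>Sets M\<close>, so a structure with \<open>Sets M = {}\<close>
  would satisfy both schemes vacuously; Henkin structures have nonempty sorts.
\<close>

definition RCA0_model :: "('a, 'm) l2_structure_scheme \<Rightarrow> bool" where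
  "RCA0_model M \<longleftrightarrow>
     Sets M \<noteq> {} \<and> basic_axioms M \<and> Sigma01_induction M \<and> Delta01_comprehension M"


section \<open>Coding pairs and finite sequences inside a model\<close>

definition pair :: "('a, 'm) l2_structure_scheme \<Rightarrow> 'a \<Rightarrow> 'a \<Rightarrow> 'a" where
  "pair M i j = (i \<oplus>\<^bsub>M\<^esub> j) \<otimes>\<^bsub>M\<^esub> (i \<oplus>\<^bsub>M\<^esub> j) \<oplus>\<^bsub>M\<^esub> i"

text \<open>
  Goedel's beta function: the code \<open>s = pair M c d\<close> has as its \<open>i\<close>-th entry the
  remainder of \<open>c\<close> on division by \<open>1 + (i + 1) d\<close>.  A finite sequence is a code together
  with a length \<open>n\<close>, an element of the model; its entries have indices \<open>i \<prec> n\<close>.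
\<close>

definition seq_entry :: "('a, 'm) l2_structure_scheme \<Rightarrow> 'a \<Rightarrow> 'a \<Rightarrow> 'a \<Rightarrow> bool" where
  "seq_entry M s i x \<longleftrightarrow>
     (\<exists>c d k. s = pair M c d \<and>
        c = k \<otimes>\<^bsub>M\<^esub> (\<one>\<^bsub>M\<^esub> \<oplus>\<^bsub>M\<^esub> (i \<oplus>\<^bsub>M\<^esub> \<one>\<^bsub>M\<^esub>) \<otimes>\<^bsub>M\<^esub> d) \<oplus>\<^bsub>M\<^esub> x \<and>
        x \<prec>\<^bsub>M\<^esub> \<one>\<^bsub>M\<^esub> \<oplus>\<^bsub>M\<^esub> (i \<oplus>\<^bsub>M\<^esub> \<one>\<^bsub>M\<^esub>) \<otimes>\<^bsub>M\<^esub> d)"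

definition seq_nth :: "('a, 'm) l2_structure_scheme \<Rightarrow> 'a \<Rightarrow> 'a \<Rightarrow> 'a" where
  "seq_nth M s i = (THE x. seq_entry M s i x)"

definition seq_all :: "('a, 'm) l2_structure_scheme \<Rightarrow> ('a \<Rightarrow> bool) \<Rightarrow> 'a \<Rightarrow> 'a \<Rightarrow> bool" where
  "seq_all M P n s \<longleftrightarrow> (\<forall>i. i \<prec>\<^bsub>M\<^esub> n \<longrightarrow> (\<exists>x. seq_entry M s i x \<and> P x))"


section \<open>Countable integral domains inside a model\<close>

text \<open>
  The operations are given by their graphs, which are sets of codes
  \<open>pair M (pair M a b) c\<close>.
\<close>

record 'a coded_ring =
  car :: "'a set"
  add_graph :: "'a set"
  mult_graph :: "'a set"
  rzero :: 'a
  rone :: 'a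

definition binary_op :: "('a, 'm) l2_structure_scheme \<Rightarrow> 'a set \<Rightarrow> 'a set \<Rightarrow> bool" where
  "binary_op M A F \<longleftrightarrow>
     F \<in> Sets M \<and>
     (\<forall>z\<in>F. \<exists>a\<in>A. \<exists>b\<in>A. \<exists>c\<in>A. z = pair M (pair M a b) c) \<and>
     (\<forall>a\<in>A. \<forall>b\<in>A. \<exists>!c. pair M (pair M a b) c \<in> F)"

definition radd :: "('a, 'm) l2_structure_scheme \<Rightarrow> ('a, 'r) coded_ring_scheme \<Rightarrow> 'a \<Rightarrow> 'a \<Rightarrow> 'a" where
  "radd M R a b = (THE c. pair M (pair M a b) c \<in> add_graph R)"

definition rmult :: "('a, 'm) l2_structure_scheme \<Rightarrow> ('a, 'r) coded_ring_scheme \<Rightarrow> 'a \<Rightarrow> 'a \<Rightarrow> 'a" where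
  "rmult M R a b = (THE c. pair M (pair M a b) c \<in> mult_graph R)"

definition countable_comm_ring ::
  "('a, 'm) l2_structure_scheme \<Rightarrow> ('a, 'r) coded_ring_scheme \<Rightarrow> bool" where
  "countable_comm_ring M R \<longleftrightarrow>
     car R \<in> Sets M \<and> binary_op M (car R) (add_graph R) \<and> binary_op M (car R) (mult_graph R) \<and>
     rzero R \<in> car R \<and> rone R \<in> car R \<and>
     (\<forall>a\<in>car R. \<forall>b\<in>car R. \<forall>c\<in>car R.
        radd M R (radd M R a b) c = radd M R a (radd M R b c)) \<and>
     (\<forall>a\<in>car R. \<forall>b\<in>car R. radd M R a b = radd M R b a) \<and>
     (\<forall>a\<in>car R. radd M R a (rzero R) = a) \<and>
     (\<forall>a\<in>car R. \<exists>b\<in>car R. radd M R a b = rzero R) \<and>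
     (\<forall>a\<in>car R. \<forall>b\<in>car R. \<forall>c\<in>car R.
        rmult M R (rmult M R a b) c = rmult M R a (rmult M R b c)) \<and>
     (\<forall>a\<in>car R. \<forall>b\<in>car R. rmult M R a b = rmult M R b a) \<and>
     (\<forall>a\<in>car R. rmult M R a (rone R) = a) \<and>
     (\<forall>a\<in>car R. \<forall>b\<in>car R. \<forall>c\<in>car R.
        rmult M R a (radd M R b c) = radd M R (rmult M R a b) (rmult M R a c))"

definition countable_integral_domain ::
  "('a, 'm) l2_structure_scheme \<Rightarrow> ('a, 'r) coded_ring_scheme \<Rightarrow> bool" where
  "countable_integral_domain M R \<longleftrightarrow>
     countable_comm_ring M R \<and>
     (\<forall>a\<in>car R. \<forall>b\<in>car R. rmult M R a b = rzero R \<longrightarrow> a = rzero R \<or> b = rzero R)"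

definition runit :: "('a, 'm) l2_structure_scheme \<Rightarrow> ('a, 'r) coded_ring_scheme \<Rightarrow> 'a \<Rightarrow> bool" where
  "runit M R u \<longleftrightarrow> u \<in> car R \<and> (\<exists>v\<in>car R. rmult M R u v = rone R)"

definition rdvd :: "('a, 'm) l2_structure_scheme \<Rightarrow> ('a, 'r) coded_ring_scheme \<Rightarrow> 'a \<Rightarrow> 'a \<Rightarrow> bool" where
  "rdvd M R a b \<longleftrightarrow> (\<exists>c\<in>car R. b = rmult M R a c)"

definition rirreducible ::
  "('a, 'm) l2_structure_scheme \<Rightarrow> ('a, 'r) coded_ring_scheme \<Rightarrow> 'a \<Rightarrow> bool" where
  "rirreducible M R r \<longleftrightarrow>
     r \<in> car R \<and> r \<noteq> rzero R \<and> \<not> runit M R r \<and>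
     (\<forall>a\<in>car R. \<forall>b\<in>car R. r = rmult M R a b \<longrightarrow> runit M R a \<or> runit M R b)"

definition rprime ::
  "('a, 'm) l2_structure_scheme \<Rightarrow> ('a, 'r) coded_ring_scheme \<Rightarrow> 'a \<Rightarrow> bool" where
  "rprime M R r \<longleftrightarrow>
     r \<in> car R \<and> r \<noteq> rzero R \<and> \<not> runit M R r \<and>
     (\<forall>a\<in>car R. \<forall>b\<in>car R.
        rdvd M R r (rmult M R a b) \<longrightarrow> rdvd M R r a \<or> rdvd M R r b)"

definition rassociates ::
  "('a, 'm) l2_structure_scheme \<Rightarrow> ('a, 'r) coded_ring_scheme \<Rightarrow> 'a \<Rightarrow> 'a \<Rightarrow> bool" where
  "rassociates M R r s \<longleftrightarrow> (\<exists>u. runit M R u \<and> r = rmult M R s u)"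


section \<open>Factorisations\<close>

text \<open>
  \<open>z\<close> is the product of the first \<open>n\<close> entries of \<open>q\<close>, witnessed by the coded
  sequence \<open>p\<close> of partial products, of length \<open>n + 1\<close>.
\<close>

definition is_product ::
  "('a, 'm) l2_structure_scheme \<Rightarrow> ('a, 'r) coded_ring_scheme \<Rightarrow> 'a \<Rightarrow> 'a \<Rightarrow> 'a \<Rightarrow> bool" where
  "is_product M R n q z \<longleftrightarrow>
     (\<exists>p. seq_all M (\<lambda>x. x \<in> car R) (n \<oplus>\<^bsub>M\<^esub> \<one>\<^bsub>M\<^esub>) p \<and>
        seq_nth M p \<zero>\<^bsub>M\<^esub> = rone R \<and>
        (\<forall>i. i \<prec>\<^bsub>M\<^esub> n \<longrightarrow>
           seq_nth M p (i \<oplus>\<^bsub>M\<^esub> \<one>\<^bsub>M\<^esub>) = rmult M R (seq_nth M p i) (seq_nth M q i)) \<and>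
        seq_nth M p n = z)"

definition factorisation ::
  "('a, 'm) l2_structure_scheme \<Rightarrow> ('a, 'r) coded_ring_scheme \<Rightarrow> ('a \<Rightarrow> bool) \<Rightarrow>
     'a \<Rightarrow> 'a \<Rightarrow> 'a \<Rightarrow> 'a \<Rightarrow> bool" where
  "factorisation M R P r u n q \<longleftrightarrow>
     runit M R u \<and> seq_all M P n q \<and> (\<exists>z. is_product M R n q z \<and> r = rmult M R u z)"

definition is_bijection :: "('a, 'm) l2_structure_scheme \<Rightarrow> 'a \<Rightarrow> 'a \<Rightarrow> bool" where
  "is_bijection M n h \<longleftrightarrow>
     seq_all M (\<lambda>j. j \<prec>\<^bsub>M\<^esub> n) n h \<and> bij_betw (seq_nth M h) {i. i \<prec>\<^bsub>M\<^esub> n} {i. i \<prec>\<^bsub>M\<^esub> n}"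

definition is_UFD :: "('a, 'm) l2_structure_scheme \<Rightarrow> ('a, 'r) coded_ring_scheme \<Rightarrow> bool" where
  "is_UFD M R \<longleftrightarrow>
     (\<forall>r\<in>car R. r \<noteq> rzero R \<longrightarrow>
        (\<exists>u n q. factorisation M R (rirreducible M R) r u n q) \<and>
        (\<forall>u n q u' m q'.
           factorisation M R (rirreducible M R) r u n q \<longrightarrow>
           factorisation M R (rirreducible M R) r u' m q' \<longrightarrow>
           n = m \<and>
           (\<exists>h. is_bijection M n h \<and>
              (\<forall>i. i \<prec>\<^bsub>M\<^esub> n \<longrightarrow>
                 rassociates M R (seq_nth M q i) (seq_nth M q' (seq_nth M h i))))))"

definition has_prime_factorisations ::
  "('a, 'm) l2_structure_scheme \<Rightarrow> ('a, 'r) coded_ring_scheme \<Rightarrow> bool" where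
  "has_prime_factorisations M R \<longleftrightarrow>
     (\<forall>r\<in>car R. r \<noteq> rzero R \<longrightarrow> (\<exists>u n q. factorisation M R (rprime M R) r u n q))"

end

theory Submission
  imports Defs
begin

text \<open>
  For \<open>(1) \<Longrightarrow> (2)\<close> let \<open>q\<close> be irreducible with \<open>a b = q c\<close>. Concatenating factorisations of \<open>a\<close> and \<open>b\<close>,
  and appending \<open>q\<close> to one of \<open>c\<close>, uniqueness makes \<open>q\<close> an associate of a factor of \<open>a\<close> or of \<open>b\<close>;
  so irreducible elements are prime.

  For \<open>(2) \<Longrightarrow> (1)\<close> every irreducible element is associated with the last prime of its factorisation,
  so it is prime. Given two factorisations, \<open>\<Sigma>\<^sup>0\<^sub>1\<close> induction on \<open>i\<close> yields a coded permutation of the second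
  one whose first \<open>i\<close> factors match those of the first one; when the first factorisation is
  exhausted, any factor left over would be a unit. Working with permutations of all indices of the second
  factorisation makes a pigeonhole principle unnecessary.

  Formulas are handled semantically: predicates on environments \<open>nat \<Rightarrow> 'a\<close>, with de Bruijn indices, are
  called \<open>\<Sigma>\<^sup>0\<^sub>0\<close>, \<open>\<Sigma>\<^sup>0\<^sub>1\<close> or \<open>\<Delta>\<^sup>0\<^sub>1\<close> if some formula defines them, and the class of \<open>\<Sigma>\<^sup>0\<^sub>1\<close> predicates is closed under
  bounded quantification by collection. Sequences are coded by the beta function, and \<open>\<Sigma>\<^sup>0\<^sub>1\<close> induction
  alone provides all the codes that are needed.
\<close>

section \<open>Renaming variables and parameters\<close>

text \<open>The obstacle is logical complexity. Only \<open>sigma1\<close> predicates may serve as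
  induction formulas, whereas \<open>rprime\<close> and \<open>rirreducible\<close> negate
  \<open>runit\<close> and quantify over all of \<open>car R\<close>. They therefore occur in no
  induction formula: primality is a fixed hypothesis on the factors that acts inside a single
  induction step, and the formulas inducted on mention only products, units, divisibility and
  associates, all of them existential or decidable. A minimal index is likewise found by a least
  number principle for \<open>sigma1\<close> predicates. The long preparation before the algebra
  certifies, without writing formulas, that a predicate stated in HOL belongs to this class. In the
  uniqueness proof nothing is cancelled from a sequence: the second factorisation keeps its length
  and its product and is merely permuted, so the statement carried through the induction does not
  change shape.\<close>

primrec ren_term :: "(nat \<Rightarrow> nat) \<Rightarrow> l2_term \<Rightarrow> l2_term" where
  "ren_term f (TVar x) = TVar (f x)"
| "ren_term f TZero = TZero"
| "ren_term f TOne = TOne"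
| "ren_term f (TPlus s t) = TPlus (ren_term f s) (ren_term f t)"
| "ren_term f (TTimes s t) = TTimes (ren_term f s) (ren_term f t)"

primrec ren :: "(nat \<Rightarrow> nat) \<Rightarrow> (nat \<Rightarrow> nat) \<Rightarrow> l2_formula \<Rightarrow> l2_formula" where
  "ren f g (FEq s t) = FEq (ren_term f s) (ren_term f t)"
| "ren f g (FLess s t) = FLess (ren_term f s) (ren_term f t)"
| "ren f g (FMem t X) = FMem (ren_term f t) (g X)"
| "ren f g (FNot \<phi>) = FNot (ren f g \<phi>)"
| "ren f g (FAnd \<phi> \<psi>) = FAnd (ren f g \<phi>) (ren f g \<psi>)"
| "ren f g (FImp \<phi> \<psi>) = FImp (ren f g \<phi>) (ren f g \<psi>)"
| "ren f g (FAll x \<phi>) = FAll (f x) (ren f g \<phi>)"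
| "ren f g (FEx x \<phi>) = FEx (f x) (ren f g \<phi>)"

primrec all_vars :: "l2_formula \<Rightarrow> nat set" where
  "all_vars (FEq s t) = term_vars s \<union> term_vars t"
| "all_vars (FLess s t) = term_vars s \<union> term_vars t"
| "all_vars (FMem t X) = term_vars t"
| "all_vars (FNot \<phi>) = all_vars \<phi>"
| "all_vars (FAnd \<phi> \<psi>) = all_vars \<phi> \<union> all_vars \<psi>"
| "all_vars (FImp \<phi> \<psi>) = all_vars \<phi> \<union> all_vars \<psi>"
| "all_vars (FAll x \<phi>) = insert x (all_vars \<phi>)"
| "all_vars (FEx x \<phi>) = insert x (all_vars \<phi>)"

lemma finite_term_vars [simp]: "finite (term_vars t)"
  by (induction t) auto

lemma finite_all_vars [simp]: "finite (all_vars \<phi>)"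
  by (induction \<phi>) auto

lemma term_vars_ren [simp]: "term_vars (ren_term f t) = f ` term_vars t"
  by (induction t) auto

lemma term_val_ren:
  "(\<And>x. x \<in> term_vars t \<Longrightarrow> e (f x) = e' x) \<Longrightarrow> term_val M e (ren_term f t) = term_val M e' t"
  by (induction t) auto

lemma term_val_cong:
  "(\<And>x. x \<in> term_vars t \<Longrightarrow> e x = e' x) \<Longrightarrow> term_val M e t = term_val M e' t"
  by (induction t) auto

text \<open>Bound number variables are renamed too, so \<open>f\<close> has to be injective on all
  variables: otherwise updating at \<open>f x\<close> below a quantifier could capture another
  variable. Set variables are never bound, so \<open>g\<close> is arbitrary.\<close>

lemma sat_ren:
  assumes "inj_on f (all_vars \<phi>)" and "\<And>x. x \<in> all_vars \<phi> \<Longrightarrow> e (f x) = e' x"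
    and "\<And>X. E (g X) = E' X"
  shows "sat M E e (ren f g \<phi>) = sat M E' e' \<phi>"
  using assms
proof (induction \<phi> arbitrary: e e')
  case (FEq s t)
  then show ?case using term_val_ren[of s e f e' M] term_val_ren[of t e f e' M] by auto
next
  case (FLess s t)
  then show ?case using term_val_ren[of s e f e' M] term_val_ren[of t e f e' M] by auto
next
  case (FMem s X)
  then show ?case using term_val_ren[of s e f e' M] by auto
next
  case (FAll x \<phi>)
  have "sat M E (e(f x := a)) (ren f g \<phi>) = sat M E' (e'(x := a)) \<phi>" for a
    using FAll.prems by (intro FAll.IH) (auto simp: inj_on_def)
  then show ?case by simp
next
  case (FEx x \<phi>)
  have "sat M E (e(f x := a)) (ren f g \<phi>) = sat M E' (e'(x := a)) \<phi>" for a
    using FEx.prems by (intro FEx.IH) (auto simp: inj_on_def)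
  then show ?case by simp
qed (simp_all add: inj_on_Un)

text \<open>Injectivity also preserves the side condition that the bound variable does not occur in
  the bounding term.\<close>

lemma Sigma00_ren:
  assumes "Sigma00 \<phi>" and "inj_on f (all_vars \<phi>)"
  shows "Sigma00 (ren f g \<phi>)"
  using assms
proof (induction rule: Sigma00.induct)
  case (7 x t \<phi>)
  then have "f x \<notin> f ` term_vars t" by (auto simp: inj_on_def)
  with 7 show ?case by (auto intro!: Sigma00.intros simp: inj_on_def)
next
  case (8 x t \<phi>)
  then have "f x \<notin> f ` term_vars t" by (auto simp: inj_on_def)
  with 8 show ?case by (auto intro!: Sigma00.intros simp: inj_on_def)
qed (auto intro!: Sigma00.intros simp: inj_on_Un)

text \<open>Interleaving leaves infinitely many slots both for the environment and for parameters.
  The same operation merges two parameter families, or two set environments, into one.\<close>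

definition mix :: "(nat \<Rightarrow> 'b) \<Rightarrow> (nat \<Rightarrow> 'b) \<Rightarrow> nat \<Rightarrow> 'b" where
  "mix e p k = (if even k then e (k div 2) else p (k div 2))"

lemma mix_even [simp]: "mix e p (2 * k) = e k" and mix_odd [simp]: "mix e p (Suc (2 * k)) = p k"
  by (simp_all add: mix_def)

lemma mix_upd: "(mix e p)(0 := a) = mix (e(0 := a)) p"
  by (auto simp: mix_def fun_eq_iff)

lemma range_mix: "range E \<subseteq> S \<Longrightarrow> range E' \<subseteq> S \<Longrightarrow> range (mix E E') \<subseteq> S"
  by (auto simp: mix_def)

text \<open>
  \<open>repr M E p Q\<close>: the predicate \<open>Q\<close> on environments is defined by a \<open>\<Sigma>\<^sup>0\<^sub>0\<close> formula whose even
  variables denote the environment and whose odd variables denote the number parameters \<open>p\<close>.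
\<close>

definition repr :: "('a, 'm) l2_structure_scheme \<Rightarrow> (nat \<Rightarrow> 'a set) \<Rightarrow> (nat \<Rightarrow> 'a) \<Rightarrow>
    ((nat \<Rightarrow> 'a) \<Rightarrow> bool) \<Rightarrow> bool" where
  "repr M E p Q \<longleftrightarrow> (\<exists>\<phi>. Sigma00 \<phi> \<and> (\<forall>e. sat M E (mix e p) \<phi> = Q e))"

definition repr_term :: "('a, 'm) l2_structure_scheme \<Rightarrow> (nat \<Rightarrow> 'a) \<Rightarrow>
    ((nat \<Rightarrow> 'a) \<Rightarrow> 'a) \<Rightarrow> bool" where
  "repr_term M p t \<longleftrightarrow> (\<exists>\<tau>. \<forall>e. term_val M (mix e p) \<tau> = t e)"

text \<open>The second pair of parameter families contains the first up to renaming. Injectivity is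
  asked of \<open>f\<close> only, matching what \<open>sat_ren\<close> requires.\<close>

definition par_le :: "(nat \<Rightarrow> 'a set) \<Rightarrow> (nat \<Rightarrow> 'a) \<Rightarrow> (nat \<Rightarrow> 'a set) \<Rightarrow> (nat \<Rightarrow> 'a) \<Rightarrow> bool" where
  "par_le E p E' p' \<longleftrightarrow> (\<exists>f g. inj f \<and> (\<forall>k. p' (f k) = p k) \<and> (\<forall>k. E' (g k) = E k))"

lemma par_le_mix: "par_le E p (mix E E') (mix p p')" "par_le E' p' (mix E E') (mix p p')"
proof -
  show "par_le E p (mix E E') (mix p p')"
    unfolding par_le_def
    by (rule exI[of _ "\<lambda>k. 2 * k"], rule exI[of _ "\<lambda>k. 2 * k"]) (auto simp: inj_def)
  show "par_le E' p' (mix E E') (mix p p')"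
    unfolding par_le_def
    by (rule exI[of _ "\<lambda>k. Suc (2 * k)"], rule exI[of _ "\<lambda>k. Suc (2 * k)"]) (auto simp: inj_def)
qed

lemma repr_mono:
  assumes "repr M E p Q" and "par_le E p E' p'"
  shows "repr M E' p' Q"
proof -
  obtain \<phi> where \<phi>: "Sigma00 \<phi>" "\<And>e. sat M E (mix e p) \<phi> = Q e"
    using assms(1) by (auto simp: repr_def)
  obtain f g where f: "inj f" "\<And>k. p' (f k) = p k" and g: "\<And>k. E' (g k) = E k"
    using assms(2) by (auto simp: par_le_def)
  \<comment> \<open>Even variables belong to the environment and stay fixed; only the odd ones,
    which name parameters, are moved.\<close>
  define F where "F k = (if even k then k else Suc (2 * f (k div 2)))" for k
  have F: "inj F"
  proof (rule injI)
    fix x y assume *: "F x = F y"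
    then have "even x \<longleftrightarrow> even y" by (auto simp: F_def split: if_splits)
    with * show "x = y" using f(1) by (auto simp: F_def inj_def split: if_splits elim!: oddE)
  qed
  have "sat M E' (mix e p') (ren F g \<phi>) = sat M E (mix e p) \<phi>" for e
  proof (rule sat_ren)
    show "inj_on F (all_vars \<phi>)" using F by (rule inj_on_subset) simp
    show "mix e p' (F x) = mix e p x" for x by (auto simp: F_def f elim!: evenE oddE)
  qed (rule g)
  moreover have "Sigma00 (ren F g \<phi>)"
    using \<phi>(1) inj_on_subset[OF F] by (intro Sigma00_ren) auto
  ultimately show ?thesis using \<phi>(2) by (auto simp: repr_def)
qed

lemma repr_term_mono:
  assumes "repr_term M p t" and "par_le E p E' p'"
  shows "repr_term M p' t"
proof -
  obtain \<tau> where \<tau>: "\<And>e. term_val M (mix e p) \<tau> = t e"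
    using assms(1) by (auto simp: repr_term_def)
  obtain f where f: "\<And>k. p' (f k) = p k"
    using assms(2) by (auto simp: par_le_def)
  have "term_val M (mix e p') (ren_term (\<lambda>k. if even k then k else Suc (2 * f (k div 2))) \<tau>)
      = term_val M (mix e p) \<tau>" for e
    by (rule term_val_ren) (auto simp: f elim!: evenE oddE)
  then show ?thesis using \<tau> by (auto simp: repr_term_def)
qed

text \<open>Bridge between de Bruijn predicates, where a quantifier binds variable 0, and formulas,
  where it binds a named variable \<open>y\<close>. The set \<open>V\<close> is reserved for the
  variables of a bounding term, which \<open>y\<close> must avoid.\<close>

lemma repr_quantifier_aux:
  assumes "repr M E p (\<lambda>e. P (\<lambda>n. e (Suc n)) (e 0))" and V: "finite V"
  shows "\<exists>y \<phi>. Sigma00 \<phi> \<and> y \<notin> V \<and> (\<forall>e a. sat M E ((mix e p)(y := a)) \<phi> = P e a)"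
proof -
  obtain \<phi> where \<phi>: "Sigma00 \<phi>" "\<And>e. sat M E (mix e p) \<phi> = P (\<lambda>n. e (Suc n)) (e 0)"
    using assms(1) by (auto simp: repr_def)
  obtain y where y: "\<And>k. k \<in> V \<union> all_vars \<phi> \<Longrightarrow> k < y"
    using V finite_nat_set_iff_bounded[of "V \<union> all_vars \<phi>"] by auto
  \<comment> \<open>Slot 0 of the environment becomes the fresh \<open>y\<close>; every other
    environment slot moves down by one, which is 2 in the interleaved numbering. Since
    \<open>y\<close> exceeds all variables of the formula, no clash arises.\<close>
  define f where "f k = (if k = 0 then y else if even k then k - 2 else k)" for k
  have inj: "inj_on f (all_vars \<phi>)"
  proof (rule inj_onI)
    fix j k assume "j \<in> all_vars \<phi>" "k \<in> all_vars \<phi>" and eq: "f j = f k"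
    then have "j < y" "k < y" using y by auto
    with eq show "j = k" by (auto simp: f_def elim!: evenE oddE split: if_splits) presburger+
  qed
  have "sat M E ((mix e p)(y := a)) (ren f id \<phi>) = sat M E (mix (case_nat a e) p) \<phi>" for e a
  proof (rule sat_ren[OF inj])
    fix k assume "k \<in> all_vars \<phi>"
    then have "k < y" using y by auto
    then show "((mix e p)(y := a)) (f k) = mix (case_nat a e) p k"
      by (cases "k div 2") (auto simp: f_def mix_def elim!: evenE oddE split: nat.splits)
  qed simp
  then have "sat M E ((mix e p)(y := a)) (ren f id \<phi>) = P e a" for e a
    using \<phi>(2)[of "case_nat a e"] by simp
  moreover have "Sigma00 (ren f id \<phi>)" using \<phi>(1) inj by (rule Sigma00_ren)
  moreover have "y \<notin> V" using y[of y] by auto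
  ultimately show ?thesis by blast
qed

section \<open>Definable predicates and induction\<close>

locale rca0 =
  fixes M :: "('a, 'm) l2_structure_scheme" (structure)
  assumes model: "RCA0_model M"
begin

text \<open>The parameters are quantified away, so the closure lemmas can combine predicates that
  were built with different parameters.\<close>

definition sigma0 :: "((nat \<Rightarrow> 'a) \<Rightarrow> bool) \<Rightarrow> bool" where
  "sigma0 Q \<longleftrightarrow> (\<exists>E p. range E \<subseteq> Sets M \<and> repr M E p Q)"

definition pterm :: "((nat \<Rightarrow> 'a) \<Rightarrow> 'a) \<Rightarrow> bool" where
  "pterm t \<longleftrightarrow> (\<exists>p. repr_term M p t)"

lemma sigma0I: "range E \<subseteq> Sets M \<Longrightarrow> Sigma00 \<phi> \<Longrightarrow> (\<And>e. sat M E (mix e p) \<phi> = Q e) \<Longrightarrow> sigma0 Q"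
  unfolding sigma0_def repr_def by blast

lemma ptermI: "(\<And>e. term_val M (mix e p) \<tau> = t e) \<Longrightarrow> pterm t"
  unfolding pterm_def repr_term_def by blast

lemma sigma0_sigma0_E:
  assumes "sigma0 Q" "sigma0 Q'"
  obtains E p where "range E \<subseteq> Sets M" "repr M E p Q" "repr M E p Q'"
proof -
  obtain E p E' p' where E: "range E \<subseteq> Sets M" "repr M E p Q" "range E' \<subseteq> Sets M" "repr M E' p' Q'"
    using assms unfolding sigma0_def by (elim exE conjE)
  show thesis
  proof (rule that)
    show "range (mix E E') \<subseteq> Sets M" using E(1,3) by (rule range_mix)
    show "repr M (mix E E') (mix p p') Q" using E(2) par_le_mix(1) by (rule repr_mono)
    show "repr M (mix E E') (mix p p') Q'" using E(4) par_le_mix(2) by (rule repr_mono)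
  qed
qed

lemma pterm_sigma0_E:
  assumes "pterm t" "sigma0 Q'"
  obtains E p where "range E \<subseteq> Sets M" "repr_term M p t" "repr M E p Q'"
proof -
  obtain E p p' where E: "repr_term M p t" "range E \<subseteq> Sets M" "repr M E p' Q'"
    using assms unfolding sigma0_def pterm_def by (elim exE conjE)
  show thesis
  proof (rule that)
    show "range (mix E E) \<subseteq> Sets M" using E(2,2) by (rule range_mix)
    show "repr_term M (mix p p') t" using E(1) par_le_mix(1) by (rule repr_term_mono)
    show "repr M (mix E E) (mix p p') Q'" using E(3) par_le_mix(2) by (rule repr_mono)
  qed
qed

lemma pterm_pterm_E:
  assumes "pterm t" "pterm t'"
  obtains p where "repr_term M p t" "repr_term M p t'"
proof -
  obtain p p' where "repr_term M p t" "repr_term M p' t'" using assms by (auto simp: pterm_def)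
  then show thesis
    by (intro that[of "mix p p'"])
      (rule repr_term_mono[OF _ par_le_mix(1)] repr_term_mono[OF _ par_le_mix(2)], assumption)+
qed

lemma pterm_var: "pterm (\<lambda>e. e k)"
  unfolding pterm_def repr_term_def by (rule exI, rule exI[of _ "TVar (2 * k)"]) simp

lemma pterm_const: "pterm (\<lambda>e. c)"
  unfolding pterm_def repr_term_def
  by (rule exI[of _ "\<lambda>_. c"], rule exI[of _ "TVar 1"]) (simp add: mix_def)

lemma pterm_plus:
  assumes "pterm s" "pterm t" shows "pterm (\<lambda>e. s e \<oplus> t e)"
proof -
  obtain p where "repr_term M p s" "repr_term M p t" using assms by (rule pterm_pterm_E)
  then obtain \<sigma> \<tau> where "\<And>e. term_val M (mix e p) \<sigma> = s e" "\<And>e. term_val M (mix e p) \<tau> = t e"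
    by (auto simp: repr_term_def)
  then show ?thesis by (intro ptermI[of p "TPlus \<sigma> \<tau>"]) simp
qed

lemma pterm_times:
  assumes "pterm s" "pterm t" shows "pterm (\<lambda>e. s e \<otimes> t e)"
proof -
  obtain p where "repr_term M p s" "repr_term M p t" using assms by (rule pterm_pterm_E)
  then obtain \<sigma> \<tau> where "\<And>e. term_val M (mix e p) \<sigma> = s e" "\<And>e. term_val M (mix e p) \<tau> = t e"
    by (auto simp: repr_term_def)
  then show ?thesis by (intro ptermI[of p "TTimes \<sigma> \<tau>"]) simp
qed

lemma Sets_nonempty: "\<exists>E :: nat \<Rightarrow> 'a set. range E \<subseteq> Sets M"
proof -
  obtain X where "X \<in> Sets M" using model by (auto simp: RCA0_model_def)
  then show ?thesis by (intro exI[of _ "\<lambda>_. X"]) auto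
qed

lemma sigma0_eq:
  assumes "pterm s" "pterm t" shows "sigma0 (\<lambda>e. s e = t e)"
proof -
  obtain p where "repr_term M p s" "repr_term M p t" using assms by (rule pterm_pterm_E)
  then obtain \<sigma> \<tau> where "\<And>e. term_val M (mix e p) \<sigma> = s e" "\<And>e. term_val M (mix e p) \<tau> = t e"
    by (auto simp: repr_term_def)
  moreover obtain E :: "nat \<Rightarrow> 'a set" where "range E \<subseteq> Sets M" using Sets_nonempty by blast
  ultimately show ?thesis by (intro sigma0I[of E "FEq \<sigma> \<tau>" p]) (simp_all add: Sigma00.intros)
qed

lemma sigma0_less:
  assumes "pterm s" "pterm t" shows "sigma0 (\<lambda>e. s e \<prec> t e)"
proof -
  obtain p where "repr_term M p s" "repr_term M p t" using assms by (rule pterm_pterm_E)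
  then obtain \<sigma> \<tau> where "\<And>e. term_val M (mix e p) \<sigma> = s e" "\<And>e. term_val M (mix e p) \<tau> = t e"
    by (auto simp: repr_term_def)
  moreover obtain E :: "nat \<Rightarrow> 'a set" where "range E \<subseteq> Sets M" using Sets_nonempty by blast
  ultimately show ?thesis by (intro sigma0I[of E "FLess \<sigma> \<tau>" p]) (simp_all add: Sigma00.intros)
qed

lemma sigma0_mem:
  assumes "pterm t" "X \<in> Sets M" shows "sigma0 (\<lambda>e. t e \<in> X)"
proof -
  obtain p \<tau> where "\<And>e. term_val M (mix e p) \<tau> = t e"
    using assms by (auto simp: pterm_def repr_term_def)
  then show ?thesis
    using assms(2) by (intro sigma0I[of "\<lambda>_. X" "FMem \<tau> 0" p]) (auto intro: Sigma00.intros)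
qed

lemma sigma0_not:
  assumes "sigma0 P" shows "sigma0 (\<lambda>e. \<not> P e)"
proof -
  obtain E p \<phi> where "range E \<subseteq> Sets M" "Sigma00 \<phi>" "\<And>e. sat M E (mix e p) \<phi> = P e"
    using assms by (auto simp: sigma0_def repr_def)
  then show ?thesis by (intro sigma0I[of E "FNot \<phi>" p]) (simp_all add: Sigma00.intros)
qed

lemma sigma0_and:
  assumes "sigma0 P" "sigma0 Q" shows "sigma0 (\<lambda>e. P e \<and> Q e)"
proof -
  obtain E p where E: "range E \<subseteq> Sets M" "repr M E p P" "repr M E p Q" using assms by (rule sigma0_sigma0_E)
  then obtain \<phi> \<psi> where "Sigma00 \<phi>" "\<And>e. sat M E (mix e p) \<phi> = P e"
     "Sigma00 \<psi>" "\<And>e. sat M E (mix e p) \<psi> = Q e" by (auto simp: repr_def)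
  with E(1) show ?thesis by (intro sigma0I[of E "FAnd \<phi> \<psi>" p]) (simp_all add: Sigma00.intros)
qed

lemma sigma0_or:
  assumes "sigma0 P" "sigma0 Q" shows "sigma0 (\<lambda>e. P e \<or> Q e)"
proof -
  have "sigma0 (\<lambda>e. \<not> (\<not> P e \<and> \<not> Q e))" using assms by (intro sigma0_not sigma0_and)
  then show ?thesis by simp
qed

lemma sigma0_imp:
  assumes "sigma0 P" "sigma0 Q" shows "sigma0 (\<lambda>e. P e \<longrightarrow> Q e)"
proof -
  have "sigma0 (\<lambda>e. \<not> P e \<or> Q e)" using assms by (intro sigma0_not sigma0_or)
  then show ?thesis unfolding imp_conv_disj .
qed

lemma sigma0_iff:
  assumes "sigma0 P" "sigma0 Q" shows "sigma0 (\<lambda>e. P e = Q e)"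
proof -
  have "sigma0 (\<lambda>e. (P e \<longrightarrow> Q e) \<and> (Q e \<longrightarrow> P e))" using assms by (intro sigma0_imp sigma0_and)
  then show ?thesis unfolding iff_conv_conj_imp .
qed

text \<open>The conclusion contains the pattern \<open>P e a\<close>, from which
  \<open>intro\<close> reads off \<open>P\<close>; the premise then asks for the body with the
  quantified variable in slot 0 and the old environment shifted by one. All quantifier rules below
  have this form.\<close>

lemma sigma0_bex:
  assumes "sigma0 (\<lambda>e. P (\<lambda>n. e (Suc n)) (e 0))" "pterm t"
  shows "sigma0 (\<lambda>e. \<exists>a. a \<prec> t e \<and> P e a)"
proof -
  obtain E p where E: "range E \<subseteq> Sets M" "repr_term M p t"
      and P: "repr M E p (\<lambda>e. P (\<lambda>n. e (Suc n)) (e 0))"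
    by (rule pterm_sigma0_E[OF assms(2,1)])
  then obtain \<tau> where \<tau>: "\<And>e. term_val M (mix e p) \<tau> = t e" by (auto simp: repr_term_def)
  obtain y \<phi> where \<phi>: "Sigma00 \<phi>" "y \<notin> term_vars \<tau>"
    "\<forall>e a. sat M E ((mix e p)(y := a)) \<phi> = P e a"
    using repr_quantifier_aux[OF P finite_term_vars[of \<tau>]] by (elim exE conjE)
  have "term_val M ((mix e p)(y := a)) \<tau> = t e" for e a
    unfolding \<tau>[symmetric] using \<phi>(2) by (intro term_val_cong) auto
  then have "sat M E (mix e p) (FEx y (FAnd (FLess (TVar y) \<tau>) \<phi>)) = (\<exists>a. a \<prec> t e \<and> P e a)" for e
    using \<phi>(3) by simp
  moreover have "Sigma00 (FEx y (FAnd (FLess (TVar y) \<tau>) \<phi>))"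
    using \<phi> by (intro Sigma00.intros)
  ultimately show ?thesis using E(1) by (intro sigma0I)
qed

lemma sigma0_ball:
  assumes "sigma0 (\<lambda>e. P (\<lambda>n. e (Suc n)) (e 0))" "pterm t"
  shows "sigma0 (\<lambda>e. \<forall>a. a \<prec> t e \<longrightarrow> P e a)"
proof -
  have "sigma0 (\<lambda>e. \<not> (\<exists>a. a \<prec> t e \<and> \<not> P e a))" using assms by (intro sigma0_not sigma0_bex)
  then show ?thesis by simp
qed

lemma sigma0_ren:
  assumes "sigma0 Q" "inj f" shows "sigma0 (\<lambda>e. Q (\<lambda>n. e (f n)))"
proof -
  obtain E p \<phi> where \<phi>: "range E \<subseteq> Sets M" "Sigma00 \<phi>" "\<And>e. sat M E (mix e p) \<phi> = Q e"
    using assms by (auto simp: sigma0_def repr_def)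
  define F where "F k = (if odd k then k else 2 * f (k div 2))" for k
  have F: "inj F"
  proof (rule injI)
    fix x y assume *: "F x = F y"
    then have "even x \<longleftrightarrow> even y" by (auto simp: F_def split: if_splits)
    with * show "x = y" using assms(2) by (auto simp: F_def inj_def split: if_splits elim!: evenE)
  qed
  then have inj: "inj_on F (all_vars \<phi>)" by (rule inj_on_subset) simp
  have "sat M E (mix e p) (ren F id \<phi>) = sat M E (mix (\<lambda>n. e (f n)) p) \<phi>" for e
  proof (rule sat_ren[OF inj])
    show "mix e p (F x) = mix (\<lambda>n. e (f n)) p x" for x by (auto simp: F_def elim!: evenE oddE)
  qed simp
  moreover have "Sigma00 (ren F id \<phi>)" using \<phi>(2) inj by (rule Sigma00_ren)
  ultimately show ?thesis using \<phi> by (intro sigma0I[of E "ren F id \<phi>" p]) auto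
qed

definition sigma1 :: "((nat \<Rightarrow> 'a) \<Rightarrow> bool) \<Rightarrow> bool" where
  "sigma1 Q \<longleftrightarrow> (\<exists>P. sigma0 (\<lambda>e. P (\<lambda>n. e (Suc n)) (e 0)) \<and> Q = (\<lambda>e. \<exists>a. P e a))"

text \<open>The rest of the environment stays available as a parameter; collection needs this,
  because there the bound is itself a value of the environment.\<close>

lemma sigma1_induct_env:
  assumes "sigma1 Q" and "Q (case_nat \<zero> e)" and "\<And>n. Q (case_nat n e) \<Longrightarrow> Q (case_nat (n \<oplus> \<one>) e)"
  shows "Q (case_nat n e)"
proof -
  obtain P where P: "sigma0 (\<lambda>e. P (\<lambda>n. e (Suc n)) (e 0))" "\<And>e. Q e \<longleftrightarrow> (\<exists>a. P e a)"
    using assms(1) unfolding sigma1_def by (auto simp: fun_eq_iff)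
  then obtain E p where E: "range E \<subseteq> Sets M" "repr M E p (\<lambda>e. P (\<lambda>n. e (Suc n)) (e 0))"
    by (auto simp: sigma0_def)
  obtain y \<phi> where \<phi>: "Sigma00 \<phi>" "y \<notin> {}"
    "\<forall>e a. sat M E ((mix e p)(y := a)) \<phi> = P e a"
    using repr_quantifier_aux[OF E(2) finite.emptyI] by (elim exE conjE)
  have "(case_nat n e)(0 := k) = case_nat k e" for k by (auto simp: fun_eq_iff split: nat.splits)
  then have *: "sat M E ((mix (case_nat n e) p)(0 := k)) (FEx y \<phi>) \<longleftrightarrow> Q (case_nat k e)" for k
    using P(2)[of "case_nat k e"] \<phi>(3) by (simp add: mix_upd)
  have "Sigma01 (FEx y \<phi>)" using \<phi>(1) by (auto simp: Sigma01_def)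
  have "Sigma01_induction M" using model by (simp add: RCA0_model_def)
  note ind = this[unfolded Sigma01_induction_def, rule_format]
  have "sat M E ((mix (case_nat n e) p)(0 := n)) (FEx y \<phi>)"
    by (rule ind[OF \<open>Sigma01 (FEx y \<phi>)\<close> E(1)]) (unfold *, fact assms(2), erule assms(3))
  then show ?thesis unfolding * .
qed

lemma sigma1_induct:
  assumes "sigma1 (\<lambda>e. Q (e 0))" and "Q \<zero>" and "\<And>n. Q n \<Longrightarrow> Q (n \<oplus> \<one>)"
  shows "Q n"
  using sigma1_induct_env[OF assms(1), of "\<lambda>_. \<zero>" n] assms(2,3) by simp

lemma sigma0_imp_sigma1:
  assumes "sigma0 Q" shows "sigma1 Q"
  unfolding sigma1_def
  by (rule exI[of _ "\<lambda>e a. Q e"]) (use sigma0_ren[OF assms, of Suc] in auto)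

lemmas sigma0_intros = sigma0_eq sigma0_less sigma0_not sigma0_and sigma0_or sigma0_imp sigma0_iff sigma0_bex sigma0_ball
  pterm_var pterm_const pterm_plus pterm_times

text \<open>The definability premise stands last, so that base and step are cases 1 and 2 and the
  remaining case 3 is discharged by \<open>sigma0_intros\<close>.\<close>

lemma sigma0_induct:
  assumes "Q \<zero>" and "\<And>n. Q n \<Longrightarrow> Q (n \<oplus> \<one>)" and "sigma0 (\<lambda>e. Q (e 0))"
  shows "Q n"
  by (rule sigma1_induct[of Q, OF sigma0_imp_sigma1[OF assms(3)]]) (use assms(1,2) in auto)

section \<open>Arithmetic of the number sort\<close>

lemma
  shows succ_neq_zero [simp]: "n \<oplus> \<one> \<noteq> \<zero>"
    and succ_inject [simp]: "m \<oplus> \<one> = n \<oplus> \<one> \<longleftrightarrow> m = n"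
    and plus_zero [simp]: "m \<oplus> \<zero> = m"
    and plus_succ: "m \<oplus> (n \<oplus> \<one>) = (m \<oplus> n) \<oplus> \<one>"
    and times_zero [simp]: "m \<otimes> \<zero> = \<zero>"
    and times_succ: "m \<otimes> (n \<oplus> \<one>) = (m \<otimes> n) \<oplus> m"
    and not_less_zero [simp]: "\<not> m \<prec> \<zero>"
    and less_succ: "m \<prec> n \<oplus> \<one> \<longleftrightarrow> m \<prec> n \<or> m = n"
proof -
  note ax = model[unfolded RCA0_model_def basic_axioms_def]
  show "n \<oplus> \<one> \<noteq> \<zero>" "m \<oplus> \<zero> = m" "m \<oplus> (n \<oplus> \<one>) = (m \<oplus> n) \<oplus> \<one>"
    "m \<otimes> \<zero> = \<zero>" "m \<otimes> (n \<oplus> \<one>) = (m \<otimes> n) \<oplus> m" "\<not> m \<prec> \<zero>"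
    "m \<prec> n \<oplus> \<one> \<longleftrightarrow> m \<prec> n \<or> m = n"
    using ax by blast+
  show "m \<oplus> \<one> = n \<oplus> \<one> \<longleftrightarrow> m = n" using ax by blast
qed

lemma zero_plus [simp]: "\<zero> \<oplus> n = n"
  by (induction n rule: sigma0_induct) (simp_all add: plus_succ, intro sigma0_intros)

lemma plus_assoc: "(a \<oplus> b) \<oplus> c = a \<oplus> (b \<oplus> c)"
  by (induction c rule: sigma0_induct) (simp_all add: plus_succ, intro sigma0_intros)

lemma plus_one_left: "\<one> \<oplus> n = n \<oplus> \<one>"
proof (induction n rule: sigma0_induct)
  case 2 then show ?case by (metis plus_assoc)
qed (simp_all, intro sigma0_intros)

lemma plus_comm: "a \<oplus> b = b \<oplus> a"
proof (induction b rule: sigma0_induct)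
  case (2 n) then show ?case by (metis plus_assoc plus_one_left)
qed (simp_all, intro sigma0_intros)

lemma plus_left_comm: "b \<oplus> (a \<oplus> c) = a \<oplus> (b \<oplus> c)"
  by (metis plus_assoc plus_comm)

lemmas plus_ac = plus_assoc plus_comm plus_left_comm

lemma zero_times [simp]: "\<zero> \<otimes> n = \<zero>"
  by (induction n rule: sigma0_induct) (simp_all add: times_succ, intro sigma0_intros)

lemma times_one: "a \<otimes> \<one> = a"
  using times_succ[of a \<zero>] by simp

lemma succ_times: "(m \<oplus> \<one>) \<otimes> n = m \<otimes> n \<oplus> n"
proof (induction n rule: sigma0_induct)
  case (2 n)
  have "(m \<oplus> \<one>) \<otimes> (n \<oplus> \<one>) = (m \<otimes> n \<oplus> n) \<oplus> (m \<oplus> \<one>)" using 2 by (simp add: times_succ)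
  also have "\<dots> = m \<otimes> (n \<oplus> \<one>) \<oplus> (n \<oplus> \<one>)" by (simp add: times_succ plus_ac)
  finally show ?case .
qed (simp_all, intro sigma0_intros)

lemma times_comm: "a \<otimes> b = b \<otimes> a"
  by (induction b rule: sigma0_induct) (simp_all add: times_succ succ_times, intro sigma0_intros)

lemma times_plus: "a \<otimes> (b \<oplus> c) = a \<otimes> b \<oplus> a \<otimes> c"
proof (induction c rule: sigma0_induct)
  case (2 c)
  then show ?case by (simp add: times_succ plus_assoc[symmetric])
qed (simp_all, intro sigma0_intros)

lemma plus_times: "(b \<oplus> c) \<otimes> a = b \<otimes> a \<oplus> c \<otimes> a"
  by (metis times_plus times_comm)

lemma times_assoc: "(a \<otimes> b) \<otimes> c = a \<otimes> (b \<otimes> c)"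
  by (induction c rule: sigma0_induct) (simp_all add: times_one times_plus, intro sigma0_intros)

lemma plus_right_cancel: "a \<oplus> c = b \<oplus> c \<longleftrightarrow> a = b"
  by (induction c rule: sigma0_induct) (simp_all add: plus_assoc[symmetric], intro sigma0_intros)

text \<open>The bound \<open>m \<prec> n\<close> on the predecessor keeps the statement within
  bounded quantification, hence open to \<open>sigma0_induct\<close>.\<close>

lemma zero_or_succ: "n = \<zero> \<or> (\<exists>m. m \<prec> n \<and> n = m \<oplus> \<one>)"
proof (induction n rule: sigma0_induct)
  case (2 n) then show ?case by (intro disjI2 exI[of _ n]) (simp add: less_succ)
qed (simp_all, intro sigma0_intros)

lemma sigma1_exI: "sigma0 (\<lambda>e. P (\<lambda>n. e (Suc n)) (e 0)) \<Longrightarrow> sigma1 (\<lambda>e. \<exists>a. P e a)"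
  unfolding sigma1_def by blast

lemma less_plus_succ: "a \<prec> a \<oplus> c \<oplus> \<one>"
proof (induction c rule: sigma0_induct)
  case (2 n)
  then show ?case using less_succ[of a "a \<oplus> n \<oplus> \<one>"] by (simp add: plus_succ)
qed (simp_all add: less_succ, intro sigma0_intros)

lemma less_iff: "a \<prec> b \<longleftrightarrow> (\<exists>c. b = a \<oplus> c \<oplus> \<one>)"
proof
  show "\<exists>c. b = a \<oplus> c \<oplus> \<one> \<Longrightarrow> a \<prec> b" by (auto simp: less_plus_succ)
  \<comment> \<open>The witness is quantified outside the implication, which puts the induction
    formula in the form that \<open>sigma1_exI\<close> accepts.\<close>
  have "\<exists>c. a \<prec> b \<longrightarrow> b = a \<oplus> c \<oplus> \<one>"
  proof (rule sigma1_induct[of "\<lambda>b. \<exists>c. a \<prec> b \<longrightarrow> b = a \<oplus> c \<oplus> \<one>"])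
    show "sigma1 (\<lambda>e. \<exists>c. a \<prec> e 0 \<longrightarrow> e 0 = a \<oplus> c \<oplus> \<one>)"
      by (intro sigma1_exI sigma0_intros)
    fix n assume "\<exists>c. a \<prec> n \<longrightarrow> n = a \<oplus> c \<oplus> \<one>"
    then obtain c where c: "a \<prec> n \<Longrightarrow> n = a \<oplus> c \<oplus> \<one>" by blast
    show "\<exists>c. a \<prec> n \<oplus> \<one> \<longrightarrow> n \<oplus> \<one> = a \<oplus> c \<oplus> \<one>"
    proof (cases "a = n")
      case True then show ?thesis by (intro exI[of _ \<zero>]) simp
    next
      case False then show ?thesis using c by (intro exI[of _ "c \<oplus> \<one>"]) (auto simp: less_succ plus_succ)
    qed
  qed simp
  then show "\<exists>c. b = a \<oplus> c \<oplus> \<one>" if "a \<prec> b" using that by auto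
qed

end

section \<open>Order, division and pairing\<close>

context rca0
begin

definition le :: "'a \<Rightarrow> 'a \<Rightarrow> bool" (infix \<open>\<preceq>\<close> 50) where
  "a \<preceq> b \<longleftrightarrow> a \<prec> b \<or> a = b"

lemma le_iff: "a \<preceq> b \<longleftrightarrow> (\<exists>c. b = a \<oplus> c)"
proof
  assume "a \<preceq> b"
  then show "\<exists>c. b = a \<oplus> c" unfolding le_def less_iff
    by (metis plus_assoc plus_zero)
next
  assume "\<exists>c. b = a \<oplus> c"
  then obtain c where "b = a \<oplus> c" by blast
  then show "a \<preceq> b" using zero_or_succ[of c] unfolding le_def less_iff
    by (metis plus_assoc plus_zero)
qed

lemma less_succ_iff_le: "a \<prec> b \<oplus> \<one> \<longleftrightarrow> a \<preceq> b"
  by (simp add: less_succ le_def)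

lemma succ_le_iff_less: "a \<oplus> \<one> \<preceq> b \<longleftrightarrow> a \<prec> b"
  by (simp add: le_iff less_iff plus_ac)

lemma less_irrefl: "\<not> a \<prec> a"
proof
  assume "a \<prec> a"
  then obtain c where "a = a \<oplus> c \<oplus> \<one>" by (auto simp: less_iff)
  then have "(c \<oplus> \<one>) \<oplus> a = \<zero> \<oplus> a" by (simp add: plus_ac)
  then show False unfolding plus_right_cancel by simp
qed

lemma less_trans: "a \<prec> b \<Longrightarrow> b \<prec> c \<Longrightarrow> a \<prec> c"
proof -
  assume "a \<prec> b" "b \<prec> c"
  then obtain d d' where "b = a \<oplus> d \<oplus> \<one>" "c = b \<oplus> d' \<oplus> \<one>" by (auto simp: less_iff)
  then have "c = a \<oplus> (d \<oplus> d' \<oplus> \<one>) \<oplus> \<one>" by (simp add: plus_ac)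
  then show ?thesis by (auto simp: less_iff)
qed

lemma zero_le: "\<zero> \<preceq> a"
  by (simp add: le_iff)

lemma less_linear: "a \<prec> b \<or> a = b \<or> b \<prec> a"
proof (induction b rule: sigma0_induct)
  case 1
  then show ?case using zero_le[of a] by (auto simp: le_def)
next
  case (2 b)
  then show ?case using succ_le_iff_less[of b a] by (auto simp: less_succ le_def)
next
  case 3
  show ?case by (intro sigma0_intros)
qed

text \<open>Through this interpretation \<open>algebra_simps\<close> can verify the polynomial
  identities used for pairing and for the beta function.\<close>

sublocale N: comm_semiring_1 where one = "\<one>" and times = "Times M" and plus = "Plus M"
  and zero = "\<zero>"
proof
  show "\<zero> \<noteq> \<one>" using succ_neq_zero[of \<zero>] by simp
qed (simp_all add: plus_times times_assoc plus_assoc times_one,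
  simp_all only: plus_comm times_comm times_one)

sublocale L: linorder where less_eq = le and less = "Less M"
proof
  fix x y z
  show "x \<prec> y \<longleftrightarrow> x \<preceq> y \<and> \<not> y \<preceq> x"
    using less_trans[of x y x] by (auto simp: le_def less_irrefl)
  show "x \<preceq> y \<Longrightarrow> y \<preceq> z \<Longrightarrow> x \<preceq> z" using less_trans[of x y z] by (auto simp: le_def)
  show "x \<preceq> y \<Longrightarrow> y \<preceq> x \<Longrightarrow> x = y" using less_trans[of x y x] by (auto simp: le_def less_irrefl)
  show "x \<preceq> y \<or> y \<preceq> x" using less_linear[of x y] by (auto simp: le_def)
qed (simp add: le_def)

lemma plus_less_cancel: "a \<oplus> c \<prec> b \<oplus> c \<longleftrightarrow> a \<prec> b"
proof -
  have "a \<oplus> c \<oplus> d \<oplus> \<one> = (a \<oplus> d \<oplus> \<one>) \<oplus> c" for d by (simp add: plus_ac)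
  then show ?thesis unfolding less_iff by (simp only: plus_right_cancel)
qed

lemma plus_le_cancel: "a \<oplus> c \<preceq> b \<oplus> c \<longleftrightarrow> a \<preceq> b"
  by (simp add: le_def plus_less_cancel plus_right_cancel)

lemma le_plus1: "a \<preceq> a \<oplus> c" and le_plus2: "a \<preceq> c \<oplus> a"
  by (auto simp: le_iff plus_comm)

lemma pos_iff: "\<zero> \<prec> a \<longleftrightarrow> a \<noteq> \<zero>"
  using zero_le[of a] by (auto simp: le_def less_irrefl)

lemma times_less: "a \<prec> b \<Longrightarrow> c \<noteq> \<zero> \<Longrightarrow> a \<otimes> c \<prec> b \<otimes> c"
proof -
  assume "a \<prec> b" "c \<noteq> \<zero>"
  then obtain d k where "b = a \<oplus> d \<oplus> \<one>" and k: "c = k \<oplus> \<one>"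
    using zero_or_succ[of c] by (auto simp: less_iff)
  then have "b \<otimes> c = a \<otimes> c \<oplus> (d \<otimes> c \<oplus> k) \<oplus> \<one>" by (simp add: algebra_simps)
  then show ?thesis unfolding less_iff by blast
qed

lemma times_le: "a \<preceq> b \<Longrightarrow> a \<otimes> c \<preceq> b \<otimes> c"
  by (auto simp: le_iff plus_times)

lemma times_right_cancel: "c \<noteq> \<zero> \<Longrightarrow> a \<otimes> c = b \<otimes> c \<longleftrightarrow> a = b"
  using times_less[of a b c] times_less[of b a c] less_linear[of a b] by (auto simp: less_irrefl)

lemma le_self_times: "c \<noteq> \<zero> \<Longrightarrow> a \<preceq> a \<otimes> c"
  using times_le[of \<one> c a] succ_le_iff_less[of \<zero> c] by (simp add: pos_iff times_comm)

lemma division_exists: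
  assumes "m \<noteq> \<zero>" shows "\<exists>q r. a = q \<otimes> m \<oplus> r \<and> r \<prec> m"
proof -
  have "\<exists>q. \<exists>r. r \<prec> m \<and> a = q \<otimes> m \<oplus> r"
  proof (rule sigma1_induct[of "\<lambda>a. \<exists>q. \<exists>r. r \<prec> m \<and> a = q \<otimes> m \<oplus> r"])
    show "sigma1 (\<lambda>e. \<exists>q. \<exists>r. r \<prec> m \<and> e 0 = q \<otimes> m \<oplus> r)" by (intro sigma1_exI sigma0_intros)
    show "\<exists>q. \<exists>r. r \<prec> m \<and> \<zero> = q \<otimes> m \<oplus> r"
      by (rule exI[of _ \<zero>], rule exI[of _ \<zero>]) (simp add: pos_iff assms)
    fix n assume "\<exists>q. \<exists>r. r \<prec> m \<and> n = q \<otimes> m \<oplus> r"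
    then obtain q r where qr: "r \<prec> m" "n = q \<otimes> m \<oplus> r" by blast
    show "\<exists>q. \<exists>r. r \<prec> m \<and> n \<oplus> \<one> = q \<otimes> m \<oplus> r"
    proof (cases "r \<oplus> \<one> = m")
      case True
      then have "n \<oplus> \<one> = (q \<oplus> \<one>) \<otimes> m \<oplus> \<zero>" using qr by (simp add: succ_times plus_assoc)
      then show ?thesis using assms pos_iff by blast
    next
      case False
      then have "r \<oplus> \<one> \<prec> m" using qr(1) succ_le_iff_less[of r m] by (auto simp: le_def)
      moreover have "n \<oplus> \<one> = q \<otimes> m \<oplus> (r \<oplus> \<one>)" using qr by (simp add: plus_assoc)
      ultimately show ?thesis by blast
    qed
  qed
  then show ?thesis by blast
qed

text \<open>If \<open>q \<prec> q'\<close>, then \<open>q m + r < (q + 1) m \<le> q' m\<close>, so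
  the two values cannot agree.\<close>

lemma division_unique_aux:
  assumes "q \<otimes> m \<oplus> r = q' \<otimes> m \<oplus> r'" "r \<prec> m"
  shows "\<not> q \<prec> q'"
proof
  assume "q \<prec> q'"
  then have "(q \<oplus> \<one>) \<otimes> m \<preceq> q' \<otimes> m" by (intro times_le) (simp add: succ_le_iff_less)
  then have "q \<otimes> m \<oplus> m \<preceq> q' \<otimes> m" by (simp add: succ_times)
  moreover have "q \<otimes> m \<oplus> r \<prec> q \<otimes> m \<oplus> m" using assms(2) by (simp add: plus_comm[of "q \<otimes> m"] plus_less_cancel)
  ultimately show False using assms(1) le_plus1[of "q' \<otimes> m" r'] by (metis L.leD L.less_le_trans)
qed

lemma division_unique:
  assumes "q \<otimes> m \<oplus> r = q' \<otimes> m \<oplus> r'" "r \<prec> m" "r' \<prec> m"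
  shows "q = q' \<and> r = r'"
proof -
  have "q = q'" using division_unique_aux[of q m r q' r'] division_unique_aux[of q' m r' q r] assms less_linear[of q q'] by auto
  moreover have "r \<oplus> q \<otimes> m = r' \<oplus> q \<otimes> m" using assms(1) \<open>q = q'\<close> by (simp add: plus_comm)
  ultimately show ?thesis by (simp add: plus_right_cancel)
qed

lemma pair_mono_aux:
  assumes "i \<oplus> j \<prec> i' \<oplus> j'" shows "pair M i j \<prec> pair M i' j'"
proof -
  define s where "s = i \<oplus> j"
  have "s \<oplus> \<one> \<preceq> i' \<oplus> j'" using assms by (simp add: succ_le_iff_less s_def)
  then obtain d where d: "i' \<oplus> j' = s \<oplus> \<one> \<oplus> d" by (auto simp: le_iff)
  have "pair M i' j' = pair M i j \<oplus> (j \<oplus> s \<oplus> (s \<oplus> \<one>) \<otimes> d \<oplus> d \<otimes> (s \<oplus> \<one> \<oplus> d) \<oplus> i') \<oplus> \<one>"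
    unfolding pair_def d s_def[symmetric] by (simp add: algebra_simps s_def)
  then show ?thesis unfolding less_iff by blast
qed

lemma pair_inject [simp]: "pair M i j = pair M i' j' \<longleftrightarrow> i = i' \<and> j = j'"
proof
  assume *: "pair M i j = pair M i' j'"
  then have s: "i \<oplus> j = i' \<oplus> j'"
    using pair_mono_aux[of i j i' j'] pair_mono_aux[of i' j' i j] less_linear less_irrefl by metis
  then have "i \<oplus> (i \<oplus> j) \<otimes> (i \<oplus> j) = i' \<oplus> (i \<oplus> j) \<otimes> (i \<oplus> j)"
    using * by (simp add: pair_def plus_comm)
  then have "i = i'" by (simp only: plus_right_cancel)
  with s show "i = i' \<and> j = j'" by (metis plus_comm plus_right_cancel)
qed simp

lemma le_pair: "i \<preceq> pair M i j" "j \<preceq> pair M i j"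
proof -
  show "i \<preceq> pair M i j" unfolding pair_def by (rule le_plus2)
  have "j \<preceq> i \<oplus> j" by (rule le_plus2)
  also have "i \<oplus> j \<preceq> (i \<oplus> j) \<otimes> (i \<oplus> j)"
    by (cases "i \<oplus> j = \<zero>") (simp_all add: le_self_times zero_le)
  also have "\<dots> \<preceq> pair M i j" unfolding pair_def by (rule le_plus1)
  finally show "j \<preceq> pair M i j" .
qed

end

section \<open>Closure properties of \<open>\<Sigma>\<^sup>0\<^sub>1\<close> predicates\<close>

context rca0
begin

lemma sigma1E:
  assumes "sigma1 Q"
  obtains P where "sigma0 (\<lambda>e. P (\<lambda>n. e (Suc n)) (e 0))" "\<forall>e. Q e \<longleftrightarrow> (\<exists>a. P e a)"
  using assms unfolding sigma1_def by auto

lemma sigma1_cong: "sigma1 P \<Longrightarrow> (\<And>e. P e = Q e) \<Longrightarrow> sigma1 Q"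
  using ext[of P Q] by simp

text \<open>The skipped variable 1 is the common bound introduced in
  \<open>sigma1_and\<close>.\<close>

lemma sigma0_insert_var:
  assumes "sigma0 (\<lambda>e. A (\<lambda>n. e (Suc n)) (e 0))"
  shows "sigma0 (\<lambda>e. A (\<lambda>n. e (Suc (Suc n))) (e 0))"
proof -
  have "inj (case_nat 0 (\<lambda>n. Suc (Suc n)))" by (auto simp: inj_def split: nat.splits)
  from sigma0_ren[OF assms this] show ?thesis by simp
qed

lemma sigma1_and:
  assumes "sigma1 P" "sigma1 Q" shows "sigma1 (\<lambda>e. P e \<and> Q e)"
proof -
  obtain A where A: "sigma0 (\<lambda>e. A (\<lambda>n. e (Suc n)) (e 0))" "\<forall>e. P e \<longleftrightarrow> (\<exists>a. A e a)"
    using assms(1) by (rule sigma1E)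
  obtain B where B: "sigma0 (\<lambda>e. B (\<lambda>n. e (Suc n)) (e 0))" "\<forall>e. Q e \<longleftrightarrow> (\<exists>a. B e a)"
    using assms(2) by (rule sigma1E)
  \<comment> \<open>A single number \<open>c\<close> bounding both witnesses takes the place of a
    pair, so only one unbounded quantifier remains.\<close>
  have "sigma1 (\<lambda>e. \<exists>c. (\<exists>a. a \<prec> c \<and> A e a) \<and> (\<exists>b. b \<prec> c \<and> B e b))"
    by (intro sigma1_exI sigma0_and sigma0_bex pterm_var sigma0_insert_var[OF A(1)] sigma0_insert_var[OF B(1)])
  moreover have "(\<exists>c. (\<exists>a. a \<prec> c \<and> A e a) \<and> (\<exists>b. b \<prec> c \<and> B e b)) \<longleftrightarrow> P e \<and> Q e" for e
  proof
    assume "P e \<and> Q e"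
    then obtain a b where "A e a" "B e b" using A(2) B(2) by auto
    moreover have "a \<prec> a \<oplus> b \<oplus> \<one>" "b \<prec> a \<oplus> b \<oplus> \<one>"
      by (simp_all add: less_succ_iff_le le_plus1 le_plus2)
    ultimately show "\<exists>c. (\<exists>a. a \<prec> c \<and> A e a) \<and> (\<exists>b. b \<prec> c \<and> B e b)" by blast
  qed (auto simp: A(2) B(2))
  ultimately show ?thesis by (rule sigma1_cong)
qed

lemma sigma1_or:
  assumes "sigma1 P" "sigma1 Q" shows "sigma1 (\<lambda>e. P e \<or> Q e)"
proof -
  obtain A where A: "sigma0 (\<lambda>e. A (\<lambda>n. e (Suc n)) (e 0))" "\<forall>e. P e \<longleftrightarrow> (\<exists>a. A e a)"
    using assms(1) by (rule sigma1E)
  obtain B where B: "sigma0 (\<lambda>e. B (\<lambda>n. e (Suc n)) (e 0))" "\<forall>e. Q e \<longleftrightarrow> (\<exists>a. B e a)"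
    using assms(2) by (rule sigma1E)
  have "sigma1 (\<lambda>e. \<exists>c. A e c \<or> B e c)" by (intro sigma1_exI sigma0_or A(1) B(1))
  then show ?thesis by (rule sigma1_cong) (auto simp: A(2) B(2))
qed

text \<open>Below the three quantifiers over \<open>c\<close>, \<open>a\<close> and
  \<open>b\<close>, slots 0, 1 and 2 hold \<open>b\<close>, \<open>a\<close> and \<open>c\<close>.
  The body does not mention \<open>c\<close>, so the environment of \<open>A\<close> is slot 1
  followed by everything from slot 3 on.\<close>

lemma sigma1_ex_aux:
  assumes "sigma0 (\<lambda>e. A (\<lambda>n. e (Suc n)) (e 0))"
  shows "sigma0 (\<lambda>e. A (case_nat (e (Suc 0)) (\<lambda>n. e (Suc (Suc (Suc n))))) (e 0))"
proof -
  have "inj (case_nat 0 (case_nat 1 (\<lambda>n. Suc (Suc (Suc n)))))" by (auto simp: inj_def split: nat.splits)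
  from sigma0_ren[OF assms this] show ?thesis
    by (rule back_subst[of sigma0]) (auto simp: fun_eq_iff intro!: arg_cong2[of _ _ _ _ A] split: nat.splits)
qed

lemma sigma1_ex:
  assumes "sigma1 (\<lambda>e. P (\<lambda>n. e (Suc n)) (e 0))" shows "sigma1 (\<lambda>e. \<exists>a. P e a)"
proof -
  obtain A where A: "sigma0 (\<lambda>e. A (\<lambda>n. e (Suc n)) (e 0))"
    and PA: "\<forall>e. P (\<lambda>n. e (Suc n)) (e 0) \<longleftrightarrow> (\<exists>b. A e b)"
    using assms(1) by (rule sigma1E)
  have P: "P e a \<longleftrightarrow> (\<exists>b. A (case_nat a e) b)" for e a
    using PA[rule_format, of "case_nat a e"] by simp
  have "sigma1 (\<lambda>e. \<exists>c. \<exists>a. a \<prec> c \<and> (\<exists>b. b \<prec> c \<and> A (case_nat a e) b))"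
    by (intro sigma1_exI sigma0_bex pterm_var sigma1_ex_aux[OF A])
  moreover have "(\<exists>c. \<exists>a. a \<prec> c \<and> (\<exists>b. b \<prec> c \<and> A (case_nat a e) b)) \<longleftrightarrow> (\<exists>a. P e a)" for e
  proof
    assume "\<exists>a. P e a"
    then obtain a b where "A (case_nat a e) b" using P by auto
    moreover have "a \<prec> a \<oplus> b \<oplus> \<one>" "b \<prec> a \<oplus> b \<oplus> \<one>"
      by (simp_all add: less_succ_iff_le le_plus1 le_plus2)
    ultimately show "\<exists>c. \<exists>a. a \<prec> c \<and> (\<exists>b. b \<prec> c \<and> A (case_nat a e) b)" by blast
  qed (auto simp: P)
  ultimately show ?thesis by (rule sigma1_cong)
qed

text \<open>The same bookkeeping inside the collection argument: slots 0 to 4 hold \<open>b\<close>,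
  \<open>a\<close>, \<open>c\<close>, the induction variable and the bound.\<close>

lemma sigma0_ball_aux:
  assumes "sigma0 (\<lambda>e. A (\<lambda>n. e (Suc n)) (e 0))"
  shows "sigma0 (\<lambda>e. A (case_nat (e (Suc 0)) (\<lambda>n. e (Suc (Suc (Suc (Suc (Suc n))))))) (e 0))"
proof -
  have "inj (case_nat 0 (case_nat 1 (\<lambda>n. Suc (Suc (Suc (Suc (Suc n)))))))"
    by (auto simp: inj_def split: nat.splits)
  from sigma0_ren[OF assms this] show ?thesis
    by (rule back_subst[of sigma0]) (auto simp: fun_eq_iff intro!: arg_cong2[of _ _ _ _ A] split: nat.splits)
qed

text \<open>This is \<open>\<Sigma>\<^sup>0\<^sub>1\<close> collection, proved by \<open>\<Sigma>\<^sup>0\<^sub>1\<close> induction on the bound.\<close>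

lemma sigma1_ball_var:
  assumes "sigma1 (\<lambda>e. P (\<lambda>n. e (Suc n)) (e 0))" shows "sigma1 (\<lambda>e. \<forall>a. a \<prec> e k \<longrightarrow> P e a)"
proof -
  obtain A where A: "sigma0 (\<lambda>e. A (\<lambda>n. e (Suc n)) (e 0))"
    and PA: "\<forall>e. P (\<lambda>n. e (Suc n)) (e 0) \<longleftrightarrow> (\<exists>b. A e b)"
    using assms(1) by (rule sigma1E)
  have P: "P e a \<longleftrightarrow> (\<exists>b. A (case_nat a e) b)" for e a
    using PA[rule_format, of "case_nat a e"] by simp
  have "sigma1 (\<lambda>e. \<exists>c. \<forall>a. a \<prec> e k \<longrightarrow> (\<exists>b. b \<prec> c \<and> A (case_nat a e) b))"
    by (intro sigma1_exI sigma0_ball sigma0_bex pterm_var sigma1_ex_aux[OF A])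
  moreover have "(\<exists>c. \<forall>a. a \<prec> e k \<longrightarrow> (\<exists>b. b \<prec> c \<and> A (case_nat a e) b)) \<longleftrightarrow>
      (\<forall>a. a \<prec> e k \<longrightarrow> P e a)" for e
  proof
    assume all: "\<forall>a. a \<prec> e k \<longrightarrow> P e a"
    \<comment> \<open>Slot 0 is the induction variable and slot 1 keeps the original bound. The
      guard \<open>a \<prec> e 1\<close> is needed because witnesses are known to exist only below
      that bound, while the induction runs through all numbers.\<close>
    let ?Q = "\<lambda>e. \<exists>c. \<forall>a. a \<prec> e 0 \<longrightarrow> a \<prec> e 1 \<longrightarrow>
      (\<exists>b. b \<prec> c \<and> A (case_nat a (\<lambda>n. e (Suc (Suc n)))) b)"
    have "?Q (case_nat (e k) (case_nat (e k) e))"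
    proof (rule sigma1_induct_env)
      show "sigma1 ?Q"
        by (intro sigma1_exI sigma0_imp sigma0_less sigma0_ball sigma0_bex pterm_var sigma0_ball_aux[OF A])
      show "?Q (case_nat \<zero> (case_nat (e k) e))" by simp
      fix n assume "?Q (case_nat n (case_nat (e k) e))"
      then obtain c where c: "\<And>a. a \<prec> n \<Longrightarrow> a \<prec> e k \<Longrightarrow> \<exists>b. b \<prec> c \<and> A (case_nat a e) b" by auto
      obtain d where d: "n \<prec> e k \<Longrightarrow> A (case_nat n e) d" using all by (auto simp: P)
      have "\<exists>b. b \<prec> c \<oplus> d \<oplus> \<one> \<and> A (case_nat a e) b" if a: "a \<prec> n \<oplus> \<one>" "a \<prec> e k" for a
      proof (cases "a = n")
        case True
        then show ?thesis using d a le_plus2[of d c] by (auto simp: less_succ_iff_le)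
      next
        case False
        then obtain b where "b \<prec> c" "A (case_nat a e) b" using c[of a] a by (auto simp: less_succ)
        moreover have "b \<prec> c \<oplus> d \<oplus> \<one>"
          using \<open>b \<prec> c\<close> le_plus1[of c d] by (simp add: less_succ_iff_le)
        ultimately show ?thesis by blast
      qed
      then show "?Q (case_nat (n \<oplus> \<one>) (case_nat (e k) e))" by auto
    qed
    then show "\<exists>c. \<forall>a. a \<prec> e k \<longrightarrow> (\<exists>b. b \<prec> c \<and> A (case_nat a e) b)" by simp
  qed (auto simp: P)
  ultimately show ?thesis by (rule sigma1_cong)
qed

lemma sigma1_ren:
  assumes "sigma1 Q" "inj f" shows "sigma1 (\<lambda>e. Q (\<lambda>n. e (f n)))"
proof -
  obtain A where A: "sigma0 (\<lambda>e. A (\<lambda>n. e (Suc n)) (e 0))" "\<forall>e. Q e \<longleftrightarrow> (\<exists>a. A e a)"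
    using assms(1) by (rule sigma1E)
  have "inj (case_nat 0 (\<lambda>n. Suc (f n)))"
    by (rule injI) (auto split: nat.splits dest: injD[OF assms(2)])
  from sigma0_ren[OF A(1) this] have "sigma0 (\<lambda>e. A (\<lambda>n. e (Suc (f n))) (e 0))" by simp
  then have "sigma1 (\<lambda>e. \<exists>a. A (\<lambda>n. e (f n)) a)" by (intro sigma1_exI)
  then show ?thesis by (rule sigma1_cong) (simp add: A(2))
qed

section \<open>Functions with definable graph and \<open>delta1\<close> predicates\<close>

definition dfun :: "((nat \<Rightarrow> 'a) \<Rightarrow> 'a) \<Rightarrow> bool" where
  "dfun f \<longleftrightarrow> sigma1 (\<lambda>e. e 0 = f (\<lambda>n. e (Suc n)))"

definition delta1 :: "((nat \<Rightarrow> 'a) \<Rightarrow> bool) \<Rightarrow> bool" where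
  "delta1 P \<longleftrightarrow> sigma1 P \<and> sigma1 (\<lambda>e. \<not> P e)"

lemma dfunD: "dfun f \<Longrightarrow> sigma1 (\<lambda>e. e 0 = f (\<lambda>n. e (Suc n)))"
  by (simp add: dfun_def)

lemma dfun_weaken: "dfun f \<Longrightarrow> dfun (\<lambda>e. f (\<lambda>n. e (Suc n)))"
  unfolding dfun_def
  by (drule sigma1_ren[of _ "case_nat 0 (\<lambda>n. Suc (Suc n))"]) (auto simp: inj_def split: nat.splits)

lemma sigma1_weaken: "sigma1 P \<Longrightarrow> sigma1 (\<lambda>e. P (\<lambda>n. e (Suc n)))"
  by (erule sigma1_ren) simp

text \<open>A function value is named by an existential quantifier over its graph. As the functions
  are total, this also works under a negation, whence \<open>sigma1_neq\<close> and
  \<open>sigma1_not_less\<close>.\<close>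

lemma sigma1_subst:
  assumes "sigma1 (\<lambda>e. P (\<lambda>n. e (Suc n)) (e 0))" "dfun f" shows "sigma1 (\<lambda>e. P e (f e))"
proof -
  have "sigma1 (\<lambda>e. \<exists>a. a = f e \<and> P e a)"
    by (intro sigma1_ex sigma1_and dfunD[OF assms(2)] assms(1))
  then show ?thesis by simp
qed

lemma sigma1_rel2:
  assumes "sigma1 (\<lambda>e. R (e 0) (e 1))" "dfun f" "dfun g" shows "sigma1 (\<lambda>e. R (f e) (g e))"
proof -
  have "inj (\<lambda>n::nat. if n = 0 then 1 else if n = 1 then 0 else n)" by (auto simp: inj_def)
  from sigma1_ren[OF assms(1) this] have "sigma1 (\<lambda>e. R (e (Suc 0)) (e 0))" by simp
  then have "sigma1 (\<lambda>e. \<exists>a. a = f e \<and> (\<exists>b. b = g e \<and> R a b))"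
    by (intro sigma1_ex sigma1_and dfunD[OF assms(2)] dfunD[OF dfun_weaken[OF assms(3)]])
  then show ?thesis by simp
qed

lemma sigma1_eq: "dfun f \<Longrightarrow> dfun g \<Longrightarrow> sigma1 (\<lambda>e. f e = g e)"
  by (rule sigma1_rel2) (intro sigma0_imp_sigma1 sigma0_intros)

lemma sigma1_neq: "dfun f \<Longrightarrow> dfun g \<Longrightarrow> sigma1 (\<lambda>e. f e \<noteq> g e)"
  by (rule sigma1_rel2) (intro sigma0_imp_sigma1 sigma0_intros)

lemma sigma1_less: "dfun f \<Longrightarrow> dfun g \<Longrightarrow> sigma1 (\<lambda>e. f e \<prec> g e)"
  by (rule sigma1_rel2) (intro sigma0_imp_sigma1 sigma0_intros)

lemma sigma1_not_less: "dfun f \<Longrightarrow> dfun g \<Longrightarrow> sigma1 (\<lambda>e. \<not> f e \<prec> g e)"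
  by (rule sigma1_rel2) (intro sigma0_imp_sigma1 sigma0_intros)

lemma sigma1_le: "dfun f \<Longrightarrow> dfun g \<Longrightarrow> sigma1 (\<lambda>e. f e \<preceq> g e)"
  unfolding le_def by (intro sigma1_or sigma1_eq sigma1_less)

lemma sigma1_not_le: "dfun f \<Longrightarrow> dfun g \<Longrightarrow> sigma1 (\<lambda>e. \<not> f e \<preceq> g e)"
  unfolding L.not_le by (rule sigma1_less)

lemma dfun_var: "dfun (\<lambda>e. e k)"
  unfolding dfun_def by (intro sigma0_imp_sigma1 sigma0_intros)

lemma dfun_const: "dfun (\<lambda>e. c)"
  unfolding dfun_def by (intro sigma0_imp_sigma1 sigma0_intros)

lemma dfun2:
  assumes "sigma1 (\<lambda>e. e 2 = h (e 1) (e 0))" "dfun f" "dfun g"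
  shows "dfun (\<lambda>e. h (f e) (g e))"
proof -
  from assms(1) have "sigma1 (\<lambda>e. e (Suc (Suc 0)) = h (e (Suc 0)) (e 0))" by (simp add: numeral_2_eq_2)
  then have "sigma1 (\<lambda>e. \<exists>a. a = f (\<lambda>n. e (Suc n)) \<and> (\<exists>b. b = g (\<lambda>n. e (Suc n)) \<and> e 0 = h a b))"
    by (intro sigma1_ex sigma1_and dfunD[OF dfun_weaken[OF assms(2)]] dfunD[OF dfun_weaken[OF dfun_weaken[OF assms(3)]]])
  then show ?thesis by (simp add: dfun_def)
qed

lemma dfun1:
  assumes "dfun (\<lambda>e. h (e 0))" "dfun f" shows "dfun (\<lambda>e. h (f e))"
proof -
  from dfunD[OF assms(1)] have "sigma1 (\<lambda>e. e 0 = h (e 1))" by simp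
  moreover have "inj (\<lambda>n::nat. if n = 0 then 1 else if n = 1 then 0 else n)" by (auto simp: inj_def)
  ultimately have "sigma1 (\<lambda>e. e (Suc 0) = h (e 0))" using sigma1_ren by fastforce
  then have "sigma1 (\<lambda>e. \<exists>a. a = f (\<lambda>n. e (Suc n)) \<and> e 0 = h a)"
    by (intro sigma1_ex sigma1_and dfunD[OF dfun_weaken[OF assms(2)]])
  then show ?thesis by (simp add: dfun_def)
qed

lemma dfun_plus: "dfun f \<Longrightarrow> dfun g \<Longrightarrow> dfun (\<lambda>e. f e \<oplus> g e)"
  by (rule dfun2) (intro sigma0_imp_sigma1 sigma0_intros)

lemma dfun_times: "dfun f \<Longrightarrow> dfun g \<Longrightarrow> dfun (\<lambda>e. f e \<otimes> g e)"
  by (rule dfun2) (intro sigma0_imp_sigma1 sigma0_intros)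

lemma dfun_pair: "dfun f \<Longrightarrow> dfun g \<Longrightarrow> dfun (\<lambda>e. pair M (f e) (g e))"
  unfolding pair_def by (intro dfun_plus dfun_times)

lemma sigma1_mem: "dfun f \<Longrightarrow> X \<in> Sets M \<Longrightarrow> sigma1 (\<lambda>e. f e \<in> X)"
  by (rule sigma1_subst[of "\<lambda>e a. a \<in> X"]) (intro sigma0_imp_sigma1 sigma0_mem sigma0_intros)

lemma sigma1_not_mem: "dfun f \<Longrightarrow> X \<in> Sets M \<Longrightarrow> sigma1 (\<lambda>e. f e \<notin> X)"
  by (rule sigma1_subst[of "\<lambda>e a. a \<notin> X"]) (intro sigma0_imp_sigma1 sigma0_mem sigma0_intros)

lemma sigma1_ball:
  assumes "sigma1 (\<lambda>e. P (\<lambda>n. e (Suc n)) (e 0))" "dfun t"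
  shows "sigma1 (\<lambda>e. \<forall>a. a \<prec> t e \<longrightarrow> P e a)"
proof -
  have "inj (case_nat 0 (\<lambda>n. Suc (Suc n)))" by (auto simp: inj_def split: nat.splits)
  from sigma1_ren[OF assms(1) this] have "sigma1 (\<lambda>e. P (\<lambda>n. e (Suc (Suc n))) (e 0))" by simp
  then have "sigma1 (\<lambda>e. \<forall>a. a \<prec> e 0 \<longrightarrow> P (\<lambda>n. e (Suc n)) a)" by (intro sigma1_ball_var)
  then show ?thesis
    by (intro sigma1_subst[of "\<lambda>e b. \<forall>a. a \<prec> b \<longrightarrow> P e a", OF _ assms(2)])
qed

lemma delta1_imp_sigma1: "delta1 P \<Longrightarrow> sigma1 P" and sigma1_not: "delta1 P \<Longrightarrow> sigma1 (\<lambda>e. \<not> P e)"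
  by (simp_all add: delta1_def)

lemma sigma1_imp: "delta1 P \<Longrightarrow> sigma1 Q \<Longrightarrow> sigma1 (\<lambda>e. P e \<longrightarrow> Q e)"
  unfolding imp_conv_disj by (intro sigma1_or sigma1_not)

lemma sigma1_bex:
  "sigma1 (\<lambda>e. P (\<lambda>n. e (Suc n)) (e 0)) \<Longrightarrow> X \<in> Sets M \<Longrightarrow> sigma1 (\<lambda>e. \<exists>a\<in>X. P e a)"
  unfolding Bex_def by (intro sigma1_ex sigma1_and sigma1_mem dfun_var)

lemma delta1_eq: "dfun f \<Longrightarrow> dfun g \<Longrightarrow> delta1 (\<lambda>e. f e = g e)"
  by (simp add: delta1_def sigma1_eq sigma1_neq)

lemma delta1_less: "dfun f \<Longrightarrow> dfun g \<Longrightarrow> delta1 (\<lambda>e. f e \<prec> g e)"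
  by (simp add: delta1_def sigma1_less sigma1_not_less)

lemma delta1_le: "dfun f \<Longrightarrow> dfun g \<Longrightarrow> delta1 (\<lambda>e. f e \<preceq> g e)"
  unfolding delta1_def by (intro conjI sigma1_le sigma1_not_le)

lemma delta1_mem: "dfun f \<Longrightarrow> X \<in> Sets M \<Longrightarrow> delta1 (\<lambda>e. f e \<in> X)"
  by (simp add: delta1_def sigma1_mem sigma1_not_mem)

lemma delta1_not: "delta1 P \<Longrightarrow> delta1 (\<lambda>e. \<not> P e)"
  by (simp add: delta1_def)

lemma delta1_and: "delta1 P \<Longrightarrow> delta1 Q \<Longrightarrow> delta1 (\<lambda>e. P e \<and> Q e)"
  unfolding delta1_def de_Morgan_conj by (intro conjI sigma1_and sigma1_or) auto

lemma delta1_ball: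
  assumes "delta1 (\<lambda>e. P (\<lambda>n. e (Suc n)) (e 0))" "dfun t"
  shows "delta1 (\<lambda>e. \<forall>a. a \<prec> t e \<longrightarrow> P e a)"
proof -
  have "sigma1 (\<lambda>e. \<exists>a. a \<prec> t e \<and> \<not> P e a)"
    by (intro sigma1_ex sigma1_and sigma1_less dfun_var dfun_weaken[OF assms(2)] sigma1_not[OF assms(1)])
  then show ?thesis using assms unfolding delta1_def by (intro conjI sigma1_ball) auto
qed

lemma delta1_bex:
  assumes "delta1 (\<lambda>e. P (\<lambda>n. e (Suc n)) (e 0))" "dfun t"
  shows "delta1 (\<lambda>e. \<exists>a. a \<prec> t e \<and> P e a)"
proof -
  have "delta1 (\<lambda>e. \<not> (\<forall>a. a \<prec> t e \<longrightarrow> \<not> P e a))" using assms by (intro delta1_not delta1_ball)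
  then show ?thesis by simp
qed

lemma dfun_if:
  assumes "delta1 P" "dfun f" "dfun g" shows "dfun (\<lambda>e. if P e then f e else g e)"
proof -
  have "sigma1 (\<lambda>e. (P (\<lambda>n. e (Suc n)) \<and> e 0 = f (\<lambda>n. e (Suc n))) \<or>
      (\<not> P (\<lambda>n. e (Suc n)) \<and> e 0 = g (\<lambda>n. e (Suc n))))"
    by (intro sigma1_or sigma1_and sigma1_weaken[OF delta1_imp_sigma1[OF assms(1)]] sigma1_weaken[OF sigma1_not[OF assms(1)]]
        dfunD[OF assms(2)] dfunD[OF assms(3)])
  then show ?thesis unfolding dfun_def by (rule sigma1_cong) auto
qed

lemmas dfun_intros = dfun_var dfun_const dfun_plus dfun_times dfun_pair dfun_if

end

section \<open>Coded sequences\<close>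

context rca0
begin

text \<open>If there were no least element, every element could be replaced by a smaller one; after
  \<open>k\<close> replacements there is some \<open>j\<close> in \<open>Q\<close> with
  \<open>j + k \<le> n\<close>. This is a \<open>sigma1\<close> statement in \<open>k\<close>, and
  \<open>k = n + 1\<close> refutes it.\<close>

lemma sigma1_least:
  assumes "sigma1 (\<lambda>e. Q (e 0))" "Q n"
  shows "\<exists>m. Q m \<and> (\<forall>k. k \<prec> m \<longrightarrow> \<not> Q k)"
proof (rule ccontr)
  assume no: "\<not> ?thesis"
  have "\<exists>j. j \<oplus> k \<preceq> n \<and> Q j" for k
  proof (rule sigma1_induct[of "\<lambda>k. \<exists>j. j \<oplus> k \<preceq> n \<and> Q j"])
    show "sigma1 (\<lambda>e. \<exists>j. j \<oplus> e 0 \<preceq> n \<and> Q j)"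
    proof (intro sigma1_ex sigma1_and sigma1_le dfun_intros)
      show "sigma1 (\<lambda>e. Q (e 0))" by (rule assms(1))
    qed
    show "\<exists>j. j \<oplus> \<zero> \<preceq> n \<and> Q j" using assms(2) by auto
    fix k assume "\<exists>j. j \<oplus> k \<preceq> n \<and> Q j"
    then obtain j where j: "j \<oplus> k \<preceq> n" "Q j" by blast
    with no obtain j' where j': "j' \<prec> j" "Q j'" by blast
    then have "j' \<oplus> \<one> \<preceq> j" by (simp add: succ_le_iff_less)
    then have "(j' \<oplus> \<one>) \<oplus> k \<preceq> j \<oplus> k" by (simp only: plus_le_cancel)
    then have "(j' \<oplus> \<one>) \<oplus> k \<preceq> n" using j(1) by (rule L.order_trans)
    then have "j' \<oplus> (k \<oplus> \<one>) \<preceq> n" by (simp add: plus_ac)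
    then show "\<exists>j. j \<oplus> (k \<oplus> \<one>) \<preceq> n \<and> Q j" using j'(2) by blast
  qed
  from this[of "n \<oplus> \<one>"] obtain j where "j \<oplus> (n \<oplus> \<one>) \<preceq> n" by blast
  moreover have "n \<oplus> \<one> \<preceq> j \<oplus> (n \<oplus> \<one>)" by (rule le_plus2)
  ultimately have "n \<oplus> \<one> \<preceq> n" by (rule L.order_trans[rotated])
  then show False by (simp add: succ_le_iff_less)
qed

section \<open>The beta function\<close>

definition modulus :: "'a \<Rightarrow> 'a \<Rightarrow> 'a" where
  "modulus d i = \<one> \<oplus> (i \<oplus> \<one>) \<otimes> d"

definition is_code :: "'a \<Rightarrow> bool" where
  "is_code s \<longleftrightarrow> (\<exists>c d. s = pair M c d)"

lemma modulus_nonzero: "modulus d i \<noteq> \<zero>"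
  unfolding modulus_def plus_comm[of \<one>] by simp

lemma seq_entry_pair:
  "seq_entry M (pair M c d) i x \<longleftrightarrow> (\<exists>k. c = k \<otimes> modulus d i \<oplus> x) \<and> x \<prec> modulus d i"
  by (auto simp: seq_entry_def modulus_def)

lemma seq_entry_unique: "seq_entry M s i x \<Longrightarrow> seq_entry M s i y \<Longrightarrow> x = y"
proof -
  assume *: "seq_entry M s i x" "seq_entry M s i y"
  then obtain c d where s: "s = pair M c d" by (auto simp: seq_entry_def)
  from * obtain k l where "k \<otimes> modulus d i \<oplus> x = l \<otimes> modulus d i \<oplus> y"
     "x \<prec> modulus d i" "y \<prec> modulus d i" unfolding s seq_entry_pair by auto
  then show ?thesis using division_unique by blast
qed

lemma seq_nth_eq: "seq_entry M s i x \<Longrightarrow> seq_nth M s i = x"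
  unfolding seq_nth_def by (rule the_equality) (auto intro: seq_entry_unique)

lemma is_code_if_seq_entry: "seq_entry M s i x \<Longrightarrow> is_code s"
  unfolding seq_entry_def is_code_def by blast

lemma seq_entry_seq_nth: "is_code s \<Longrightarrow> seq_entry M s i (seq_nth M s i)"
proof -
  assume "is_code s"
  then obtain c d where s: "s = pair M c d" by (auto simp: is_code_def)
  obtain q r where "c = q \<otimes> modulus d i \<oplus> r" "r \<prec> modulus d i"
    using division_exists[OF modulus_nonzero] by blast
  then have "seq_entry M s i r" unfolding s seq_entry_pair by blast
  then show ?thesis using seq_nth_eq by metis
qed

lemma seq_all_iff: "is_code s \<Longrightarrow> seq_all M P n s \<longleftrightarrow> (\<forall>i. i \<prec> n \<longrightarrow> P (seq_nth M s i))"
  unfolding seq_all_def using seq_entry_seq_nth seq_nth_eq by metis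

lemma seq_allD: "seq_all M P n s \<Longrightarrow> i \<prec> n \<Longrightarrow> P (seq_nth M s i)"
  unfolding seq_all_def using seq_nth_eq by metis

lemma is_code_if_seq_all: "seq_all M P n s \<Longrightarrow> i \<prec> n \<Longrightarrow> is_code s"
  unfolding seq_all_def using is_code_if_seq_entry by blast

text \<open>Both components of a pair are at most its code, so the two existential quantifiers can
  be bounded.\<close>

lemma delta1_is_code: "dfun f \<Longrightarrow> delta1 (\<lambda>e. is_code (f e))"
proof -
  have eq: "is_code s \<longleftrightarrow> (\<exists>c. c \<prec> s \<oplus> \<one> \<and> (\<exists>d. d \<prec> s \<oplus> \<one> \<and> s = pair M c d))" for s
    unfolding is_code_def less_succ_iff_le using le_pair by blast
  have "delta1 (\<lambda>e. is_code (e 0))" unfolding eq by (intro delta1_bex delta1_eq dfun_intros)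
  then have "sigma1 (\<lambda>e. is_code (e 0))" "sigma1 (\<lambda>e. \<not> is_code (e 0))" by (simp_all add: delta1_def)
  moreover assume "dfun f"
  ultimately show ?thesis unfolding delta1_def
    by (intro conjI sigma1_subst[of "\<lambda>e a. is_code a" f] sigma1_subst[of "\<lambda>e a. \<not> is_code a" f])
qed

lemma sigma1_is_code: "dfun f \<Longrightarrow> sigma1 (\<lambda>e. is_code (f e))"
  by (intro delta1_imp_sigma1 delta1_is_code)

text \<open>\<open>seq_nth\<close> is a total HOL function, so its graph must also be described
  where \<open>s\<close> codes nothing; there \<open>THE\<close> returns a fixed default. Including
  this disjunct makes the graph \<open>sigma1\<close> for all arguments.\<close>

lemma seq_nth_graph:
  "x = seq_nth M s i \<longleftrightarrow> (\<exists>c d. s = pair M c d \<and> (\<exists>k. c = k \<otimes> modulus d i \<oplus> x) \<and> x \<prec> modulus d i) \<or>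
    (\<not> is_code s \<and> x = (THE x. False))"
proof (cases "is_code s")
  case True
  then obtain c d where s: "s = pair M c d" by (auto simp: is_code_def)
  have "x = seq_nth M s i \<longleftrightarrow> seq_entry M s i x"
    using seq_entry_seq_nth[OF True, of i] seq_nth_eq by blast
  then show ?thesis using True by (auto simp: s seq_entry_pair)
next
  case False
  then have "seq_entry M s i = (\<lambda>x. False)" using is_code_if_seq_entry by blast
  then have "seq_nth M s i = (THE x. False)" by (simp add: seq_nth_def)
  then show ?thesis using False by (auto simp: is_code_def)
qed

lemma dfun_seq_nth: "dfun f \<Longrightarrow> dfun g \<Longrightarrow> dfun (\<lambda>e. seq_nth M (f e) (g e))"
proof (rule dfun2[of "seq_nth M" f g])
  show "sigma1 (\<lambda>e. e 2 = seq_nth M (e 1) (e 0))"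
    unfolding seq_nth_graph modulus_def
    by (intro sigma1_or sigma1_ex sigma1_and sigma1_eq sigma1_less sigma1_not delta1_is_code dfun_intros)
qed

lemma dfun_bounded:
  assumes "dfun (\<lambda>e. f (e 0))" shows "\<exists>b. \<forall>i. i \<prec> n \<longrightarrow> f i \<prec> b"
proof (rule sigma1_induct[of "\<lambda>n. \<exists>b. \<forall>i. i \<prec> n \<longrightarrow> f i \<prec> b"])
  show "sigma1 (\<lambda>e. \<exists>b. \<forall>i. i \<prec> e 0 \<longrightarrow> f i \<prec> b)"
    by (intro sigma1_ex sigma1_ball sigma1_less dfun1[of f, OF assms] dfun_intros)
  fix n assume "\<exists>b. \<forall>i. i \<prec> n \<longrightarrow> f i \<prec> b"
  then obtain b where b: "\<And>i. i \<prec> n \<Longrightarrow> f i \<prec> b" by blast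
  have "f i \<prec> b \<oplus> f n \<oplus> \<one>" if "i \<prec> n \<oplus> \<one>" for i
  proof (cases "i = n")
    case True then show ?thesis by (simp add: less_succ_iff_le le_plus2)
  next
    case False
    then have "f i \<prec> b" using b that by (auto simp: less_succ)
    also have "b \<preceq> b \<oplus> f n" by (rule le_plus1)
    finally show ?thesis by (simp add: less_succ)
  qed
  then show "\<exists>b. \<forall>i. i \<prec> n \<oplus> \<one> \<longrightarrow> f i \<prec> b" by blast
qed simp

text \<open>This stands in for the factorial: only divisibility by \<open>1, ..., n\<close> matters,
  so no product function has to be defined.\<close>

lemma common_multiple: "\<exists>d. d \<noteq> \<zero> \<and> (\<forall>j. j \<prec> n \<longrightarrow> (\<exists>x. d = x \<otimes> (j \<oplus> \<one>)))"
proof (rule sigma1_induct[of "\<lambda>n. \<exists>d. d \<noteq> \<zero> \<and> (\<forall>j. j \<prec> n \<longrightarrow> (\<exists>x. d = x \<otimes> (j \<oplus> \<one>)))"])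
  show "sigma1 (\<lambda>e. \<exists>d. d \<noteq> \<zero> \<and> (\<forall>j. j \<prec> e 0 \<longrightarrow> (\<exists>x. d = x \<otimes> (j \<oplus> \<one>))))"
    by (intro sigma1_ex sigma1_and sigma1_neq sigma1_ball sigma1_eq dfun_intros)
  have "\<one> \<noteq> \<zero>" using N.zero_neq_one by metis
  then show "\<exists>d. d \<noteq> \<zero> \<and> (\<forall>j. j \<prec> \<zero> \<longrightarrow> (\<exists>x. d = x \<otimes> (j \<oplus> \<one>)))"
    by (intro exI[of _ \<one>]) simp
  fix n assume "\<exists>d. d \<noteq> \<zero> \<and> (\<forall>j. j \<prec> n \<longrightarrow> (\<exists>x. d = x \<otimes> (j \<oplus> \<one>)))"
  then obtain d where d: "d \<noteq> \<zero>" "\<And>j. j \<prec> n \<Longrightarrow> \<exists>x. d = x \<otimes> (j \<oplus> \<one>)" by blast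
  have "d \<otimes> (n \<oplus> \<one>) \<noteq> \<zero>"
    using d(1) times_right_cancel[of "n \<oplus> \<one>" d \<zero>] by simp
  moreover have "\<exists>x. d \<otimes> (n \<oplus> \<one>) = x \<otimes> (j \<oplus> \<one>)" if "j \<prec> n \<oplus> \<one>" for j
  proof (cases "j = n")
    case False
    then obtain x where "d = x \<otimes> (j \<oplus> \<one>)" using d(2) \<open>j \<prec> n \<oplus> \<one>\<close> by (auto simp: less_succ)
    then have "d \<otimes> (n \<oplus> \<one>) = (x \<otimes> (n \<oplus> \<one>)) \<otimes> (j \<oplus> \<one>)" by (simp add: N.mult_ac)
    then show ?thesis by blast
  qed blast
  ultimately show "\<exists>d. d \<noteq> \<zero> \<and> (\<forall>j. j \<prec> n \<oplus> \<one> \<longrightarrow> (\<exists>x. d = x \<otimes> (j \<oplus> \<one>)))" by blast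
qed

text \<open>
  Two moduli are coprime because \<open>(j + 1) m\<^sub>k - (k + 1) m\<^sub>j = j - k\<close> divides \<open>d\<close> and
  \<open>(j + 1) d \<equiv> -1\<close> modulo \<open>m\<^sub>j\<close>; multiplying out gives an explicit inverse of \<open>m\<^sub>k\<close>.
\<close>

lemma modulus_invertible:
  assumes "k \<prec> j" "j \<prec> n" "d \<noteq> \<zero>" "\<And>i. i \<prec> n \<Longrightarrow> \<exists>x. d = x \<otimes> (i \<oplus> \<one>)"
  shows "\<exists>y z. modulus d k \<otimes> y = z \<otimes> modulus d j \<oplus> \<one>"
proof -
  obtain g where g: "j = k \<oplus> g \<oplus> \<one>" using assms(1) by (auto simp: less_iff)
  have "g \<preceq> j" unfolding g using le_plus2[of g "k \<oplus> \<one>"] by (simp add: plus_ac)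
  then have "g \<prec> n" using assms(2) by (rule L.le_less_trans)
  then obtain x where x: "d = x \<otimes> (g \<oplus> \<one>)" using assms(4) by blast
  define J K G where "J = j \<oplus> \<one>" and "K = k \<oplus> \<one>" and "G = g \<oplus> \<one>"
  have J: "J = K \<oplus> G" by (simp add: J_def K_def G_def g plus_ac)
  have "J \<otimes> d \<noteq> \<zero>" using times_right_cancel[OF assms(3), of J \<zero>] by (simp add: J_def)
  \<comment> \<open>With \<open>v = J d - 1\<close> and \<open>modulus d j = J d + 1\<close>, the
    identity \<open>(J d)^2 = v (J d + 1) + 1\<close> turns the congruence
    \<open>J d \<equiv> -1\<close> into one with remainder 1.\<close>
  then obtain v where v: "J \<otimes> d = v \<oplus> \<one>" using zero_or_succ by blast
  have mk: "modulus d k = \<one> \<oplus> K \<otimes> d" and mj: "modulus d j = \<one> \<oplus> J \<otimes> d"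
    by (simp_all add: modulus_def J_def K_def)
  have h1: "J \<otimes> modulus d k = G \<oplus> K \<otimes> modulus d j"
    unfolding mk mj J by (simp add: algebra_simps)
  have "J \<otimes> modulus d k \<otimes> x = d \<oplus> K \<otimes> x \<otimes> modulus d j"
    unfolding h1 using x by (simp add: algebra_simps G_def)
  then have "(J \<otimes> d) \<otimes> (J \<otimes> (J \<otimes> modulus d k \<otimes> x)) =
      (J \<otimes> d) \<otimes> (J \<otimes> d) \<oplus> (J \<otimes> d \<otimes> J \<otimes> K \<otimes> x) \<otimes> modulus d j"
    by (simp add: algebra_simps)
  also have "(J \<otimes> d) \<otimes> (J \<otimes> d) = v \<otimes> modulus d j \<oplus> \<one>"
    unfolding mj v by (simp only: times_plus plus_times times_one N.mult_1_left N.add_ac)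
  finally have "modulus d k \<otimes> (J \<otimes> d \<otimes> J \<otimes> J \<otimes> x) =
      (v \<oplus> J \<otimes> d \<otimes> J \<otimes> K \<otimes> x) \<otimes> modulus d j \<oplus> \<one>"
    by (simp add: algebra_simps)
  then show ?thesis by blast
qed

text \<open>Chinese remaindering, one modulus at a time. The induction carries \<open>c\<close> with
  the right remainders for the first \<open>k\<close> moduli and a common multiple \<open>l\<close>
  of them that is invertible modulo every later one; explicit inverses replace coprimality.\<close>

lemma beta_exists:
  assumes f: "dfun (\<lambda>e. f (e 0))"
  shows "\<exists>s. is_code s \<and> (\<forall>i. i \<prec> n \<longrightarrow> seq_nth M s i = f i)"
proof -
  obtain b where b: "\<And>i. i \<prec> n \<Longrightarrow> f i \<prec> b" using dfun_bounded[OF f] by blast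
  obtain d0 where d0: "d0 \<noteq> \<zero>" "\<And>j. j \<prec> n \<Longrightarrow> \<exists>x. d0 = x \<otimes> (j \<oplus> \<one>)" using common_multiple by blast
  \<comment> \<open>The factor \<open>d0\<close> makes the moduli pairwise invertible, and the
    factor \<open>b + 1\<close> makes each of them exceed all the values \<open>f i\<close>.\<close>
  define d where "d = (b \<oplus> \<one>) \<otimes> d0"
  have d: "d \<noteq> \<zero>" using times_right_cancel[OF d0(1), of "b \<oplus> \<one>" \<zero>] by (simp add: d_def)
  have dvd: "\<exists>x. d = x \<otimes> (j \<oplus> \<one>)" if "j \<prec> n" for j
    using d0(2)[OF that] by (auto simp: d_def times_assoc[symmetric])
  have small: "f i \<prec> modulus d i" if "i \<prec> n" for i
  proof -
    have "f i \<prec> b" by (rule b[OF that])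
    also have "b \<preceq> b \<oplus> \<one>" by (rule le_plus1)
    also have "\<dots> \<preceq> d" unfolding d_def by (rule le_self_times[OF d0(1)])
    also have "d \<preceq> d \<otimes> (i \<oplus> \<one>)" by (rule le_self_times) simp
    also have "\<dots> \<preceq> modulus d i" unfolding modulus_def times_comm[of d] by (rule le_plus2)
    finally show ?thesis .
  qed
  let ?S = "\<lambda>k. \<exists>c l. (\<forall>i. i \<prec> k \<longrightarrow> i \<prec> n \<longrightarrow>
      (\<exists>q. c = q \<otimes> modulus d i \<oplus> f i) \<and> (\<exists>w. l = w \<otimes> modulus d i)) \<and>
      (\<forall>j. j \<prec> n \<longrightarrow> k \<preceq> j \<longrightarrow> (\<exists>y z. l \<otimes> y = z \<otimes> modulus d j \<oplus> \<one>))"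
  have "?S n"
  proof (rule sigma1_induct[of ?S])
    show "sigma1 (\<lambda>e. ?S (e 0))" unfolding modulus_def
      by (intro sigma1_ex sigma1_and sigma1_ball sigma1_imp sigma1_eq delta1_less delta1_le dfun1[of f, OF f] dfun_intros)
    show "?S \<zero>"
    proof (intro exI conjI allI impI)
      show "\<one> \<otimes> \<one> = \<zero> \<otimes> modulus d j \<oplus> \<one>" for j by simp
    qed simp_all
    fix k assume "?S k"
    then obtain c l where c: "\<And>i. i \<prec> k \<Longrightarrow> i \<prec> n \<Longrightarrow> \<exists>q. c = q \<otimes> modulus d i \<oplus> f i"
      and l: "\<And>i. i \<prec> k \<Longrightarrow> i \<prec> n \<Longrightarrow> \<exists>w. l = w \<otimes> modulus d i"
      and inv: "\<And>j. j \<prec> n \<Longrightarrow> k \<preceq> j \<Longrightarrow> \<exists>y z. l \<otimes> y = z \<otimes> modulus d j \<oplus> \<one>" by blast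
    show "?S (k \<oplus> \<one>)"
    proof (cases "k \<prec> n")
      case False
      then have ik: "i \<prec> k" if "i \<prec> n" for i using that by (meson L.less_le_trans L.not_less)
      have kj: "k \<preceq> j" if "k \<oplus> \<one> \<preceq> j" for j using that unfolding succ_le_iff_less by (rule L.less_imp_le)
      show ?thesis
        by (rule exI[of _ c], rule exI[of _ l]) (use c[OF ik] l[OF ik] inv kj in blast)
    next
      case True
      obtain y z where yz: "l \<otimes> y = z \<otimes> modulus d k \<oplus> \<one>" using inv[OF True] by auto
      \<comment> \<open>Since \<open>l y \<equiv> 1\<close> modulo the new modulus,
        \<open>c + l y a\<close> has remainder \<open>f k\<close> there once
        \<open>a \<equiv> f k - c\<close>. The factor \<open>(k + 1) d \<equiv> -1\<close> provides
        the negative of \<open>c\<close> without subtraction. The earlier remainders are untouched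
        because \<open>l\<close> is a multiple of their moduli.\<close>
      define a where "a = f k \<oplus> ((k \<oplus> \<one>) \<otimes> d) \<otimes> c"
      define c' where "c' = c \<oplus> l \<otimes> y \<otimes> a"
      have "c' = c \<oplus> a \<oplus> z \<otimes> a \<otimes> modulus d k" unfolding c'_def yz by (simp add: algebra_simps)
      also have "c \<oplus> a = c \<otimes> modulus d k \<oplus> f k" unfolding a_def modulus_def by (simp add: algebra_simps)
      finally have ck: "c' = (c \<oplus> z \<otimes> a) \<otimes> modulus d k \<oplus> f k" by (simp add: algebra_simps)
      have 1: "(\<exists>q. c' = q \<otimes> modulus d i \<oplus> f i) \<and> (\<exists>w. l \<otimes> modulus d k = w \<otimes> modulus d i)"
        if i: "i \<prec> k \<oplus> \<one>" "i \<prec> n" for i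
      proof (cases "i = k")
        case True
        then show ?thesis using ck by blast
      next
        case False
        with i have "i \<prec> k" by (simp add: less_succ)
        then obtain q w where q: "c = q \<otimes> modulus d i \<oplus> f i" and w: "l = w \<otimes> modulus d i"
          using c l i by blast
        have "c' = (q \<oplus> w \<otimes> y \<otimes> a) \<otimes> modulus d i \<oplus> f i" unfolding c'_def q w by (simp add: algebra_simps)
        moreover have "l \<otimes> modulus d k = (w \<otimes> modulus d k) \<otimes> modulus d i" unfolding w by (simp add: N.mult_ac)
        ultimately show ?thesis by blast
      qed
      have 2: "\<exists>y z. (l \<otimes> modulus d k) \<otimes> y = z \<otimes> modulus d j \<oplus> \<one>" if j: "j \<prec> n" "k \<oplus> \<one> \<preceq> j" for j
      proof -
        have "k \<prec> j" using j(2) by (simp add: succ_le_iff_less)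
        obtain y z where 1: "l \<otimes> y = z \<otimes> modulus d j \<oplus> \<one>"
          using inv[OF j(1)] \<open>k \<prec> j\<close> by (auto simp: le_def)
        obtain y' z' where 2: "modulus d k \<otimes> y' = z' \<otimes> modulus d j \<oplus> \<one>"
          using modulus_invertible[OF \<open>k \<prec> j\<close> j(1) d dvd] by blast
        have "(l \<otimes> modulus d k) \<otimes> (y \<otimes> y') = (l \<otimes> y) \<otimes> (modulus d k \<otimes> y')" by (simp add: N.mult_ac)
        also have "\<dots> = (z \<otimes> z' \<otimes> modulus d j \<oplus> z \<oplus> z') \<otimes> modulus d j \<oplus> \<one>"
          unfolding 1 2 by (simp add: algebra_simps)
        finally show ?thesis by blast
      qed
      show ?thesis using 1 2 by (intro exI[of _ c'] exI[of _ "l \<otimes> modulus d k"]) blast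
    qed
  qed
  then obtain c where "\<And>i. i \<prec> n \<Longrightarrow> \<exists>q. c = q \<otimes> modulus d i \<oplus> f i" by blast
  then have "seq_entry M (pair M c d) i (f i)" if "i \<prec> n" for i
    using that small by (simp add: seq_entry_pair)
  then have "\<forall>i. i \<prec> n \<longrightarrow> seq_nth M (pair M c d) i = f i" by (simp add: seq_nth_eq)
  moreover have "is_code (pair M c d)" by (auto simp: is_code_def)
  ultimately show ?thesis by blast
qed

text \<open>Beta codes cannot be prolonged in place, so all \<open>n + 1\<close> values are coded
  afresh. The old \<open>s\<close> may be arbitrary, as \<open>seq_nth\<close> is total.\<close>

lemma seq_extend:
  "\<exists>s'. is_code s' \<and> (\<forall>i. i \<prec> n \<longrightarrow> seq_nth M s' i = seq_nth M s i) \<and> seq_nth M s' n = x"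
proof -
  have "dfun (\<lambda>e. if e 0 \<prec> n then seq_nth M s (e 0) else x)"
    by (intro dfun_if delta1_less dfun_seq_nth dfun_intros)
  then obtain s' where "is_code s'"
    and s': "\<And>i. i \<prec> n \<oplus> \<one> \<Longrightarrow> seq_nth M s' i = (if i \<prec> n then seq_nth M s i else x)"
    using beta_exists[of "\<lambda>i. if i \<prec> n then seq_nth M s i else x" "n \<oplus> \<one>"] by blast
  then show ?thesis using s'[of n] by (intro exI[of _ s']) (simp add: less_succ less_irrefl)
qed

text \<open>Choosing one value per induction step avoids selecting canonical witnesses; it suffices
  that the existence of a code for the first \<open>k\<close> choices is
  \<open>sigma1\<close>.\<close>

lemma seq_choice:
  assumes P: "sigma1 (\<lambda>e. P (e 0) (e 1))" and ex: "\<And>i. i \<prec> n \<Longrightarrow> \<exists>x. P i x"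
  shows "\<exists>s. is_code s \<and> (\<forall>i. i \<prec> n \<longrightarrow> P i (seq_nth M s i))"
proof -
  let ?S = "\<lambda>k. \<exists>s. is_code s \<and> (\<forall>i. i \<prec> k \<longrightarrow> i \<prec> n \<longrightarrow> P i (seq_nth M s i))"
  have "?S n"
  proof (rule sigma1_induct[of ?S])
    show "sigma1 (\<lambda>e. ?S (e 0))"
      by (intro sigma1_ex sigma1_and sigma1_is_code sigma1_ball sigma1_imp delta1_less sigma1_rel2[OF P] dfun_seq_nth dfun_intros)
    show "?S \<zero>" by (auto simp: is_code_def)
    fix k assume "?S k"
    then obtain s where s: "\<And>i. i \<prec> k \<Longrightarrow> i \<prec> n \<Longrightarrow> P i (seq_nth M s i)" by blast
    obtain x where x: "k \<prec> n \<Longrightarrow> P k x" using ex by blast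
    obtain s' where s': "is_code s'" "\<And>i. i \<prec> k \<Longrightarrow> seq_nth M s' i = seq_nth M s i" "seq_nth M s' k = x"
      using seq_extend by blast
    then show "?S (k \<oplus> \<one>)" using s x by (intro exI[of _ s']) (auto simp: less_succ)
  qed
  then show ?thesis by blast
qed

lemma seq_recursion:
  assumes F: "sigma1 (\<lambda>e. e 2 = F (e 1) (e 0))"
  shows "\<exists>s. is_code s \<and> seq_nth M s \<zero> = a \<and> (\<forall>i. i \<prec> n \<longrightarrow> seq_nth M s (i \<oplus> \<one>) = F i (seq_nth M s i))"
proof (rule sigma1_induct[of "\<lambda>n. \<exists>s. is_code s \<and> seq_nth M s \<zero> = a \<and>
    (\<forall>i. i \<prec> n \<longrightarrow> seq_nth M s (i \<oplus> \<one>) = F i (seq_nth M s i))"])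
  show "sigma1 (\<lambda>e. \<exists>s. is_code s \<and> seq_nth M s \<zero> = a \<and>
      (\<forall>i. i \<prec> e 0 \<longrightarrow> seq_nth M s (i \<oplus> \<one>) = F i (seq_nth M s i)))"
    by (intro sigma1_ex sigma1_and sigma1_is_code sigma1_ball sigma1_eq dfun2[OF F] dfun_seq_nth dfun_intros)
  show "\<exists>s. is_code s \<and> seq_nth M s \<zero> = a \<and>
      (\<forall>i. i \<prec> \<zero> \<longrightarrow> seq_nth M s (i \<oplus> \<one>) = F i (seq_nth M s i))"
    using seq_extend[of \<zero> _ a] by auto
  fix k assume "\<exists>s. is_code s \<and> seq_nth M s \<zero> = a \<and>
      (\<forall>i. i \<prec> k \<longrightarrow> seq_nth M s (i \<oplus> \<one>) = F i (seq_nth M s i))"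
  then obtain s where s: "seq_nth M s \<zero> = a" "\<And>i. i \<prec> k \<Longrightarrow> seq_nth M s (i \<oplus> \<one>) = F i (seq_nth M s i)"
    by blast
  obtain s' where s': "is_code s'" "\<And>i. i \<prec> k \<oplus> \<one> \<Longrightarrow> seq_nth M s' i = seq_nth M s i"
    "seq_nth M s' (k \<oplus> \<one>) = F k (seq_nth M s k)"
    using seq_extend[of "k \<oplus> \<one>" s] by blast
  have "seq_nth M s' (i \<oplus> \<one>) = F i (seq_nth M s' i)" if "i \<prec> k \<oplus> \<one>" for i
  proof (cases "i = k")
    case True
    then show ?thesis using s' by (simp add: less_succ)
  next
    case False
    then have "i \<prec> k" using that by (simp add: less_succ)
    then have "i \<oplus> \<one> \<prec> k \<oplus> \<one>" by (simp add: plus_less_cancel)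
    then show ?thesis using s'(2) s(2) that \<open>i \<prec> k\<close> by simp
  qed
  moreover have "seq_nth M s' \<zero> = a" using s'(2)[of \<zero>] s(1) by (simp add: less_succ_iff_le zero_le)
  ultimately show "\<exists>s. is_code s \<and> seq_nth M s \<zero> = a \<and>
      (\<forall>i. i \<prec> k \<oplus> \<one> \<longrightarrow> seq_nth M s (i \<oplus> \<one>) = F i (seq_nth M s i))"
    using s'(1) by blast
qed

end

section \<open>Partial products in a coded domain\<close>

context rca0
begin

lemma sigma1_induct_range:
  assumes "sigma1 (\<lambda>e. Q (e 0))" and "Q i" and "\<And>k. i \<preceq> k \<Longrightarrow> k \<prec> n \<Longrightarrow> Q k \<Longrightarrow> Q (k \<oplus> \<one>)"
    and "i \<preceq> k" "k \<preceq> n"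
  shows "Q k"
proof -
  have "i \<preceq> k \<longrightarrow> k \<preceq> n \<longrightarrow> Q k"
  proof (rule sigma1_induct[of "\<lambda>k. i \<preceq> k \<longrightarrow> k \<preceq> n \<longrightarrow> Q k"])
    show "sigma1 (\<lambda>e. i \<preceq> e 0 \<longrightarrow> e 0 \<preceq> n \<longrightarrow> Q (e 0))"
      by (intro sigma1_imp delta1_le dfun_intros assms(1))
    show "i \<preceq> \<zero> \<longrightarrow> \<zero> \<preceq> n \<longrightarrow> Q \<zero>"
      using assms(2) by (auto simp: le_def)
    fix k assume IH: "i \<preceq> k \<longrightarrow> k \<preceq> n \<longrightarrow> Q k"
    show "i \<preceq> k \<oplus> \<one> \<longrightarrow> k \<oplus> \<one> \<preceq> n \<longrightarrow> Q (k \<oplus> \<one>)"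
    proof (intro impI)
      assume "i \<preceq> k \<oplus> \<one>" "k \<oplus> \<one> \<preceq> n"
      then have "k \<prec> n" by (simp add: succ_le_iff_less)
      show "Q (k \<oplus> \<one>)"
      proof (cases "i = k \<oplus> \<one>")
        case True
        then show ?thesis using assms(2) by simp
      next
        case False
        then have "i \<prec> k \<oplus> \<one>" using \<open>i \<preceq> k \<oplus> \<one>\<close> by (simp add: le_def)
        then have "i \<preceq> k" by (simp add: less_succ_iff_le)
        then show ?thesis using assms(3) IH \<open>k \<prec> n\<close> by (simp add: L.less_imp_le)
      qed
    qed
  qed
  then show ?thesis using assms(4,5) by blast
qed

text \<open>As for \<open>seq_nth\<close>, the default value of \<open>THE\<close> outside
  \<open>A\<close> is spelled out, so that the ring operations become total functions with a
  \<open>sigma1\<close> graph.\<close>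

lemma binary_op_graph:
  assumes "binary_op M A F"
  shows "x = (THE c. pair M (pair M a b) c \<in> F) \<longleftrightarrow>
    pair M (pair M a b) x \<in> F \<or> (\<not> (a \<in> A \<and> b \<in> A) \<and> x = (THE x. False))"
proof (cases "a \<in> A \<and> b \<in> A")
  case True
  then have ex: "\<exists>!c. pair M (pair M a b) c \<in> F" using assms by (auto simp: binary_op_def)
  then have "x = (THE c. pair M (pair M a b) c \<in> F) \<longleftrightarrow> pair M (pair M a b) x \<in> F"
    by (metis (mono_tags, lifting) the1_equality theI')
  then show ?thesis using True by blast
next
  case False
  have none: "pair M (pair M a b) c \<notin> F" for c
  proof
    assume "pair M (pair M a b) c \<in> F"
    then obtain a' b' c' where "a' \<in> A" "b' \<in> A" "pair M (pair M a b) c = pair M (pair M a' b') c'"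
      using assms unfolding binary_op_def by blast
    then show False using False by simp
  qed
  then show ?thesis using False by simp
qed

lemma binary_op_closed:
  assumes "binary_op M A F" "a \<in> A" "b \<in> A"
  shows "(THE c. pair M (pair M a b) c \<in> F) \<in> A"
proof -
  have "pair M (pair M a b) (THE c. pair M (pair M a b) c \<in> F) \<in> F"
    using binary_op_graph[OF assms(1), of _ a b] assms(2,3) by blast
  then obtain a' b' c' where "c' \<in> A" "pair M (pair M a b) (THE c. pair M (pair M a b) c \<in> F) = pair M (pair M a' b') c'"
    using assms(1) unfolding binary_op_def by blast
  then show ?thesis by (metis pair_inject)
qed

end

section \<open>Ring laws in a coded integral domain\<close>

locale rca0_domain = rca0 M for M :: "('a, 'm) l2_structure_scheme" (structure) +
  fixes R :: "('a, 'r) coded_ring_scheme"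
  assumes dom: "countable_integral_domain M R"
begin

abbreviation mul :: "'a \<Rightarrow> 'a \<Rightarrow> 'a" (infixl \<open>\<cdot>\<close> 70) where
  "a \<cdot> b \<equiv> rmult M R a b"

lemma ring: "countable_comm_ring M R"
  using dom by (simp add: countable_integral_domain_def)

lemma car_Sets: "car R \<in> Sets M" and mult_binary_op: "binary_op M (car R) (mult_graph R)"
  and add_binary_op: "binary_op M (car R) (add_graph R)"
  and mult_graph_Sets: "mult_graph R \<in> Sets M"
  and zero_closed [simp]: "rzero R \<in> car R" and one_closed [simp]: "rone R \<in> car R"
  using ring by (simp_all add: countable_comm_ring_def binary_op_def)

lemma mul_closed [simp]: "a \<in> car R \<Longrightarrow> b \<in> car R \<Longrightarrow> a \<cdot> b \<in> car R"
  unfolding rmult_def by (rule binary_op_closed[OF mult_binary_op])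

lemma radd_closed: "a \<in> car R \<Longrightarrow> b \<in> car R \<Longrightarrow> radd M R a b \<in> car R"
  unfolding radd_def by (rule binary_op_closed[OF add_binary_op])

lemma mul_assoc: "a \<in> car R \<Longrightarrow> b \<in> car R \<Longrightarrow> c \<in> car R \<Longrightarrow> (a \<cdot> b) \<cdot> c = a \<cdot> (b \<cdot> c)"
  and mul_comm: "a \<in> car R \<Longrightarrow> b \<in> car R \<Longrightarrow> a \<cdot> b = b \<cdot> a"
  and mul_one [simp]: "a \<in> car R \<Longrightarrow> a \<cdot> rone R = a"
  using ring unfolding countable_comm_ring_def by blast+

lemma mul_left_comm: "a \<in> car R \<Longrightarrow> b \<in> car R \<Longrightarrow> c \<in> car R \<Longrightarrow> b \<cdot> (a \<cdot> c) = a \<cdot> (b \<cdot> c)"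
  by (metis mul_assoc mul_comm)

lemmas mul_ac = mul_assoc mul_comm mul_left_comm

lemma one_mul [simp]: "a \<in> car R \<Longrightarrow> rone R \<cdot> a = a"
  using mul_comm[of "rone R" a] by simp

lemma radd_assoc: "a \<in> car R \<Longrightarrow> b \<in> car R \<Longrightarrow> c \<in> car R \<Longrightarrow>
    radd M R (radd M R a b) c = radd M R a (radd M R b c)"
  and radd_comm: "a \<in> car R \<Longrightarrow> b \<in> car R \<Longrightarrow> radd M R a b = radd M R b a"
  and radd_zero: "a \<in> car R \<Longrightarrow> radd M R a (rzero R) = a"
  and radd_inverse: "a \<in> car R \<Longrightarrow> \<exists>b\<in>car R. radd M R a b = rzero R"
  and mul_radd: "a \<in> car R \<Longrightarrow> b \<in> car R \<Longrightarrow> c \<in> car R \<Longrightarrow>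
    a \<cdot> radd M R b c = radd M R (a \<cdot> b) (a \<cdot> c)"
  using ring unfolding countable_comm_ring_def by blast+

lemma radd_right_cancel:
  assumes "a \<in> car R" "b \<in> car R" "c \<in> car R" "radd M R a c = radd M R b c"
  shows "a = b"
proof -
  obtain d where d: "d \<in> car R" "radd M R c d = rzero R" using radd_inverse[OF assms(3)] by blast
  have *: "radd M R (radd M R x c) d = x" if "x \<in> car R" for x
    using that assms(3) d by (simp add: radd_assoc radd_zero)
  show ?thesis by (rule trans[OF *[OF assms(1), symmetric, unfolded assms(4)] *[OF assms(2)]])
qed

lemma mul_zero [simp]:
  assumes "a \<in> car R" shows "a \<cdot> rzero R = rzero R"
proof (rule radd_right_cancel)
  have "radd M R (a \<cdot> rzero R) (a \<cdot> rzero R) = a \<cdot> radd M R (rzero R) (rzero R)"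
    using assms by (simp add: mul_radd)
  also have "\<dots> = a \<cdot> rzero R" by (simp add: radd_zero)
  also have "\<dots> = radd M R (rzero R) (a \<cdot> rzero R)"
    using assms by (metis mul_closed radd_comm radd_zero zero_closed)
  finally show "radd M R (a \<cdot> rzero R) (a \<cdot> rzero R) = radd M R (rzero R) (a \<cdot> rzero R)" .
qed (use assms in auto)

lemma mul_eq_zero: "a \<in> car R \<Longrightarrow> b \<in> car R \<Longrightarrow> a \<cdot> b = rzero R \<longleftrightarrow> a = rzero R \<or> b = rzero R"
  using dom mul_zero[of a] mul_zero[of b] mul_comm[of a b]
  unfolding countable_integral_domain_def by auto

text \<open>The zero ring counts as an integral domain here, so \<open>1 \<noteq> 0\<close> is drawn
  from a nonzero element whenever it is required.\<close>

lemma one_neq_zero: "a \<in> car R \<Longrightarrow> a \<noteq> rzero R \<Longrightarrow> rone R \<noteq> rzero R"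
  by (metis mul_one mul_zero)

lemma mul_left_cancel:
  assumes "a \<in> car R" "b \<in> car R" "c \<in> car R" "a \<noteq> rzero R" "a \<cdot> b = a \<cdot> c"
  shows "b = c"
proof -
  obtain d where d: "d \<in> car R" "radd M R c d = rzero R" using radd_inverse[OF assms(3)] by blast
  have "a \<cdot> radd M R b d = a \<cdot> radd M R c d"
    using assms d(1) by (simp add: mul_radd)
  also have "\<dots> = rzero R" using assms(1) d(2) by simp
  finally have "radd M R b d = rzero R"
    using mul_eq_zero[of a "radd M R b d"] assms d(1) radd_closed by auto
  then have "radd M R b d = radd M R c d" using d(2) by simp
  then show ?thesis using radd_right_cancel assms d(1) by blast
qed

lemma dfun_mul: "dfun f \<Longrightarrow> dfun g \<Longrightarrow> dfun (\<lambda>e. f e \<cdot> g e)"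
proof (rule dfun2[of "rmult M R" f g])
  show "sigma1 (\<lambda>e. e 2 = e 1 \<cdot> e 0)"
    unfolding rmult_def binary_op_graph[OF mult_binary_op]
    by (intro sigma1_or sigma1_and sigma1_mem sigma1_not delta1_and delta1_mem sigma1_eq dfun_intros mult_graph_Sets car_Sets)
qed

section \<open>Units, divisibility and associates\<close>

lemma runit_closed: "runit M R u \<Longrightarrow> u \<in> car R"
  by (simp add: runit_def)

lemma runitE:
  assumes "runit M R u" obtains v where "runit M R v" "v \<in> car R" "u \<cdot> v = rone R"
proof -
  obtain v where "u \<in> car R" "v \<in> car R" "u \<cdot> v = rone R" using assms by (auto simp: runit_def)
  then show thesis using that[of v] mul_comm[of u v] by (auto simp: runit_def)
qed

lemma runit_mul: "runit M R a \<Longrightarrow> runit M R b \<Longrightarrow> runit M R (a \<cdot> b)"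
proof -
  assume a: "runit M R a" and b: "runit M R b"
  obtain c where c: "c \<in> car R" "a \<cdot> c = rone R" using a by (rule runitE)
  obtain d where d: "d \<in> car R" "b \<cdot> d = rone R" using b by (rule runitE)
  have car: "a \<in> car R" "b \<in> car R" using a b by (simp_all add: runit_closed)
  have "(a \<cdot> b) \<cdot> (c \<cdot> d) = (a \<cdot> c) \<cdot> (b \<cdot> d)"
    using car c(1) d(1) by (simp add: mul_ac)
  then show ?thesis using car c d by (auto simp: runit_def intro!: bexI[of _ "c \<cdot> d"])
qed

lemma runit_factor: "a \<in> car R \<Longrightarrow> b \<in> car R \<Longrightarrow> runit M R (a \<cdot> b) \<Longrightarrow> runit M R a"
  unfolding runit_def using mul_assoc mul_closed by metis

lemma runit_one: "runit M R (rone R)"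
  by (auto simp: runit_def intro!: bexI[of _ "rone R"])

lemma rdvd_trans: "a \<in> car R \<Longrightarrow> rdvd M R a b \<Longrightarrow> rdvd M R b c \<Longrightarrow> rdvd M R a c"
  unfolding rdvd_def using mul_assoc mul_closed by metis

lemma rdvd_refl: "a \<in> car R \<Longrightarrow> rdvd M R a a"
  by (auto simp: rdvd_def intro!: bexI[of _ "rone R"])

lemma rdvd_mul: "a \<in> car R \<Longrightarrow> c \<in> car R \<Longrightarrow> b \<in> car R \<Longrightarrow> rdvd M R a b \<Longrightarrow> rdvd M R a (b \<cdot> c)"
  by (rule rdvd_trans[of a b]) (auto simp: rdvd_def)

lemma sigma1_runit: "dfun f \<Longrightarrow> sigma1 (\<lambda>e. runit M R (f e))"
  by (rule sigma1_subst[of "\<lambda>e a. runit M R a" f], unfold runit_def)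
    (intro sigma1_and sigma1_bex sigma1_mem sigma1_eq dfun_mul dfun_intros car_Sets)

lemma sigma1_rdvd: "dfun f \<Longrightarrow> dfun g \<Longrightarrow> sigma1 (\<lambda>e. rdvd M R (f e) (g e))"
  by (rule sigma1_rel2[of "rdvd M R" f g], unfold rdvd_def)
    (intro sigma1_and sigma1_bex sigma1_mem sigma1_eq dfun_mul dfun_intros car_Sets)

lemma sigma1_rassociates: "dfun f \<Longrightarrow> dfun g \<Longrightarrow> sigma1 (\<lambda>e. rassociates M R (f e) (g e))"
  by (rule sigma1_rel2[of "rassociates M R" f g], unfold rassociates_def)
    (intro sigma1_and sigma1_ex sigma1_runit sigma1_mem sigma1_eq dfun_mul dfun_intros car_Sets)

text \<open>The factors are given by a HOL function \<open>g\<close> rather than by a code, so that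
  a sequence composed with a permutation can be multiplied without being coded first.\<close>

definition partial_products :: "('a \<Rightarrow> 'a) \<Rightarrow> 'a \<Rightarrow> 'a \<Rightarrow> bool" where
  "partial_products g n p \<longleftrightarrow> seq_nth M p \<zero> = rone R \<and>
     (\<forall>i. i \<prec> n \<longrightarrow> seq_nth M p (i \<oplus> \<one>) = seq_nth M p i \<cdot> g i)"

lemma partial_products_Suc:
  "partial_products g n p \<Longrightarrow> i \<prec> n \<Longrightarrow> seq_nth M p (i \<oplus> \<one>) = seq_nth M p i \<cdot> g i"
  by (simp add: partial_products_def)

lemma partial_products_exist:
  assumes "dfun (\<lambda>e. g (e 0))" shows "\<exists>p. is_code p \<and> partial_products g n p"
proof -
  have "sigma1 (\<lambda>e. e 2 = (\<lambda>i x. x \<cdot> g i) (e 1) (e 0))"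
    by (intro sigma1_eq dfun_mul dfun1[of g, OF assms] dfun_intros)
  from seq_recursion[OF this] show ?thesis unfolding partial_products_def by blast
qed

lemma partial_products_closed:
  assumes "partial_products g n p" "\<And>i. i \<prec> n \<Longrightarrow> g i \<in> car R" "k \<preceq> n"
  shows "seq_nth M p k \<in> car R"
proof (rule sigma1_induct_range[of "\<lambda>k. seq_nth M p k \<in> car R" \<zero> n])
  show "sigma1 (\<lambda>e. seq_nth M p (e 0) \<in> car R)" by (intro sigma1_mem dfun_seq_nth dfun_intros car_Sets)
  show "seq_nth M p \<zero> \<in> car R" using assms(1) by (simp add: partial_products_def)
qed (use assms in \<open>auto simp: partial_products_Suc zero_le\<close>)

lemma partial_products_nonzero:
  assumes "partial_products g n p" "\<And>i. i \<prec> n \<Longrightarrow> g i \<in> car R" "\<And>i. i \<prec> n \<Longrightarrow> g i \<noteq> rzero R"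
    "rone R \<noteq> rzero R" "k \<preceq> n"
  shows "seq_nth M p k \<noteq> rzero R"
proof (rule sigma1_induct_range[of "\<lambda>k. seq_nth M p k \<noteq> rzero R" \<zero> n])
  show "sigma1 (\<lambda>e. seq_nth M p (e 0) \<noteq> rzero R)" by (intro sigma1_neq dfun_seq_nth dfun_intros)
  show "seq_nth M p \<zero> \<noteq> rzero R" using assms(1,4) by (simp add: partial_products_def)
  fix k assume "k \<prec> n" "seq_nth M p k \<noteq> rzero R"
  then show "seq_nth M p (k \<oplus> \<one>) \<noteq> rzero R"
    using assms(2,3)[of k] partial_products_closed[OF assms(1,2), of k] partial_products_Suc[OF assms(1)]
    by (simp add: mul_eq_zero L.less_imp_le)
qed (use assms(5) in \<open>auto simp: zero_le\<close>)

lemma partial_products_rdvd: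
  assumes "partial_products g n p" "\<And>i. i \<prec> n \<Longrightarrow> g i \<in> car R" "j \<preceq> k" "k \<preceq> n"
  shows "rdvd M R (seq_nth M p j) (seq_nth M p k)"
proof -
  have pj: "seq_nth M p j \<in> car R"
    using partial_products_closed[OF assms(1,2)] L.order_trans[OF assms(3,4)] by blast
  show ?thesis
  proof (rule sigma1_induct_range[of "\<lambda>k. rdvd M R (seq_nth M p j) (seq_nth M p k)" j n])
    show "sigma1 (\<lambda>e. rdvd M R (seq_nth M p j) (seq_nth M p (e 0)))"
      by (intro sigma1_rdvd dfun_seq_nth dfun_intros)
    show "rdvd M R (seq_nth M p j) (seq_nth M p j)" using pj by (rule rdvd_refl)
    fix k assume "k \<prec> n" "rdvd M R (seq_nth M p j) (seq_nth M p k)"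
    then show "rdvd M R (seq_nth M p j) (seq_nth M p (k \<oplus> \<one>))"
      using assms(2)[of k] partial_products_closed[OF assms(1,2), of k] pj
      by (simp add: partial_products_Suc[OF assms(1)] rdvd_mul L.less_imp_le)
  qed (use assms in auto)
qed

lemma partial_products_factor_rdvd:
  assumes "partial_products g n p" "\<And>i. i \<prec> n \<Longrightarrow> g i \<in> car R" "j \<prec> n"
  shows "rdvd M R (g j) (seq_nth M p n)"
proof (rule rdvd_trans)
  have "seq_nth M p j \<in> car R"
    using partial_products_closed[OF assms(1,2)] assms(3) L.less_imp_le by blast
  then show "rdvd M R (g j) (seq_nth M p (j \<oplus> \<one>))"
    using assms(2)[OF assms(3)] mul_comm
    unfolding rdvd_def partial_products_Suc[OF assms(1,3)] by blast
  show "rdvd M R (seq_nth M p (j \<oplus> \<one>)) (seq_nth M p n)"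
    by (rule partial_products_rdvd[OF assms(1,2)]) (use assms(3) in \<open>auto simp: succ_le_iff_less\<close>)
qed (rule assms(2)[OF assms(3)])

lemma partial_products_cong:
  assumes "partial_products g n p" "partial_products g' n' p'"
    "\<And>i. i \<prec> k \<Longrightarrow> g i = g' i" "k \<preceq> n" "k \<preceq> n'"
  shows "seq_nth M p k = seq_nth M p' k"
proof (rule sigma1_induct_range[of "\<lambda>k. seq_nth M p k = seq_nth M p' k" \<zero> k])
  show "sigma1 (\<lambda>e. seq_nth M p (e 0) = seq_nth M p' (e 0))" by (intro sigma1_eq dfun_seq_nth dfun_intros)
  show "seq_nth M p \<zero> = seq_nth M p' \<zero>" using assms(1,2) by (simp add: partial_products_def)
  fix j assume "j \<prec> k" "seq_nth M p j = seq_nth M p' j"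
  moreover have "j \<prec> n" "j \<prec> n'" using \<open>j \<prec> k\<close> assms(4,5) by (auto intro: L.less_le_trans)
  ultimately show "seq_nth M p (j \<oplus> \<one>) = seq_nth M p' (j \<oplus> \<one>)"
    using assms(1-3) by (simp add: partial_products_Suc)
qed (auto simp: zero_le)

lemma factorisationE:
  assumes "factorisation M R P r u n q" "\<And>x. P x \<Longrightarrow> x \<in> car R"
  obtains p where "runit M R u" "\<And>i. i \<prec> n \<Longrightarrow> P (seq_nth M q i)"
    "partial_products (seq_nth M q) n p" "is_code p" "r = u \<cdot> seq_nth M p n"
proof -
  obtain p where "runit M R u" "seq_all M P n q" and p: "seq_all M (\<lambda>x. x \<in> car R) (n \<oplus> \<one>) p"
     "partial_products (seq_nth M q) n p" "r = u \<cdot> seq_nth M p n"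
    using assms(1) unfolding factorisation_def is_product_def partial_products_def by blast
  \<comment> \<open>The sequence of partial products has length \<open>n + 1\<close>, hence at least
    one entry, which only a code can have. For \<open>q\<close> this conclusion fails at
    \<open>n = 0\<close>, so \<open>factorisationI\<close> asks for \<open>is_code q\<close>
    separately.\<close>
  moreover have "is_code p" using p(1) by (rule is_code_if_seq_all[of _ _ _ n]) (simp add: less_succ)
  ultimately show thesis using that[of p] seq_allD by blast
qed

lemma factorisationI:
  assumes "runit M R u" "is_code q" "\<And>i. i \<prec> n \<Longrightarrow> P (seq_nth M q i)" "\<And>x. P x \<Longrightarrow> x \<in> car R"
    "partial_products (seq_nth M q) n p" "is_code p" "r = u \<cdot> seq_nth M p n"
  shows "factorisation M R P r u n q"
proof -
  have "seq_all M (\<lambda>x. x \<in> car R) (n \<oplus> \<one>) p"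
    unfolding seq_all_iff[OF assms(6)] less_succ_iff_le
    using partial_products_closed[OF assms(5)] assms(3,4) by blast
  moreover have "seq_all M P n q" using assms(2,3) by (simp add: seq_all_iff)
  ultimately show ?thesis
    using assms(1,5,7) unfolding factorisation_def is_product_def partial_products_def by blast
qed

end

section \<open>Irreducible and prime elements\<close>

context rca0_domain
begin

lemma rirreducible_closed: "rirreducible M R x \<Longrightarrow> x \<in> car R"
  by (simp add: rirreducible_def)

lemma rprime_closed: "rprime M R x \<Longrightarrow> x \<in> car R"
  by (simp add: rprime_def)

lemma partial_products_append:
  assumes "partial_products g (k \<oplus> l) p" "partial_products g' l p'"
    "\<And>j. j \<prec> l \<Longrightarrow> g (k \<oplus> j) = g' j"
    "\<And>i. i \<prec> k \<oplus> l \<Longrightarrow> g i \<in> car R" "\<And>j. j \<prec> l \<Longrightarrow> g' j \<in> car R"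
  shows "seq_nth M p (k \<oplus> l) = seq_nth M p k \<cdot> seq_nth M p' l"
proof (rule sigma1_induct_range[of "\<lambda>j. seq_nth M p (k \<oplus> j) = seq_nth M p k \<cdot> seq_nth M p' j" \<zero> l])
  have pk: "seq_nth M p k \<in> car R"
    by (rule partial_products_closed[OF assms(1,4)]) (auto simp: le_plus1)
  show "sigma1 (\<lambda>e. seq_nth M p (k \<oplus> e 0) = seq_nth M p k \<cdot> seq_nth M p' (e 0))"
    by (intro sigma1_eq dfun_mul dfun_seq_nth dfun_intros)
  show "seq_nth M p (k \<oplus> \<zero>) = seq_nth M p k \<cdot> seq_nth M p' \<zero>"
    using assms(2) pk by (simp add: partial_products_def)
  fix j assume j: "j \<prec> l" and IH: "seq_nth M p (k \<oplus> j) = seq_nth M p k \<cdot> seq_nth M p' j"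
  have "k \<oplus> j \<prec> k \<oplus> l" using j by (simp add: plus_comm[of k] plus_less_cancel)
  then have "seq_nth M p (k \<oplus> (j \<oplus> \<one>)) = seq_nth M p (k \<oplus> j) \<cdot> g (k \<oplus> j)"
    unfolding plus_succ by (rule partial_products_Suc[OF assms(1)])
  also have "\<dots> = seq_nth M p k \<cdot> (seq_nth M p' j \<cdot> g' j)"
    unfolding IH assms(3)[OF j] using pk assms(5)[OF j] partial_products_closed[OF assms(2,5), of j] j
    by (simp add: mul_assoc L.less_imp_le)
  also have "\<dots> = seq_nth M p k \<cdot> seq_nth M p' (j \<oplus> \<one>)"
    using partial_products_Suc[OF assms(2) j] by simp
  finally show "seq_nth M p (k \<oplus> (j \<oplus> \<one>)) = seq_nth M p k \<cdot> seq_nth M p' (j \<oplus> \<one>)" .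
qed (auto simp: zero_le)

lemma rassociates_rdvd:
  assumes "rassociates M R r s" "s \<in> car R" shows "rdvd M R r s"
proof -
  obtain u where u: "runit M R u" "r = s \<cdot> u" using assms(1) by (auto simp: rassociates_def)
  obtain v where v: "v \<in> car R" "u \<cdot> v = rone R" using u(1) by (rule runitE)
  have "s = r \<cdot> v" using u v assms(2) by (simp add: mul_assoc runit_closed)
  then show ?thesis using v(1) by (auto simp: rdvd_def)
qed

lemma UFD_irreducible_prime:
  assumes ufd: "is_UFD M R" and q: "rirreducible M R q"
  shows "rprime M R q"
proof -
  have qc: "q \<in> car R" "q \<noteq> rzero R" "\<not> runit M R q" using q by (auto simp: rirreducible_def)
  have fact: "\<exists>u n s. factorisation M R (rirreducible M R) r u n s" if "r \<in> car R" "r \<noteq> rzero R" for r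
    using ufd that unfolding is_UFD_def by blast
  have "rdvd M R q a \<or> rdvd M R q b" if ab: "a \<in> car R" "b \<in> car R" "rdvd M R q (a \<cdot> b)" for a b
  \<comment> \<open>Primality also speaks about vanishing factors, which have no factorisation;
    \<open>q\<close> divides zero trivially.\<close>
  proof (cases "a = rzero R \<or> b = rzero R")
    case True
    have "rdvd M R q (rzero R)" using qc(1) by (auto simp: rdvd_def intro!: bexI[of _ "rzero R"])
    then show ?thesis using True by blast
  next
    case False
    obtain c where c: "c \<in> car R" "a \<cdot> b = q \<cdot> c" using ab(3) by (auto simp: rdvd_def)
    have ab0: "a \<cdot> b \<noteq> rzero R" using False ab by (simp add: mul_eq_zero)
    then have c0: "c \<noteq> rzero R" using c qc by auto
    obtain u k qa where fa: "factorisation M R (rirreducible M R) a u k qa" using fact ab False by blast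
    obtain v l qb where fb: "factorisation M R (rirreducible M R) b v l qb" using fact ab False by blast
    obtain w m qc where fc: "factorisation M R (rirreducible M R) c w m qc" using fact c(1) c0 by blast
    obtain pa where u: "runit M R u" and qa: "\<And>i. i \<prec> k \<Longrightarrow> rirreducible M R (seq_nth M qa i)"
      and pa: "partial_products (seq_nth M qa) k pa" "is_code pa" and a: "a = u \<cdot> seq_nth M pa k"
      using factorisationE[OF fa rirreducible_closed] by blast
    obtain pb where v: "runit M R v" and qb: "\<And>i. i \<prec> l \<Longrightarrow> rirreducible M R (seq_nth M qb i)"
      and pb: "partial_products (seq_nth M qb) l pb" "is_code pb" and b: "b = v \<cdot> seq_nth M pb l"
      using factorisationE[OF fb rirreducible_closed] by blast
    obtain pc where w: "runit M R w" and qc': "\<And>i. i \<prec> m \<Longrightarrow> rirreducible M R (seq_nth M qc i)"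
      and pc: "partial_products (seq_nth M qc) m pc" "is_code pc" and c': "c = w \<cdot> seq_nth M pc m"
      using factorisationE[OF fc rirreducible_closed] by blast
    have pak: "seq_nth M pa k \<in> car R"
      by (rule partial_products_closed[OF pa(1)]) (auto intro: rirreducible_closed qa)
    have pbl: "seq_nth M pb l \<in> car R"
      by (rule partial_products_closed[OF pb(1)]) (auto intro: rirreducible_closed qb)
    have pcm: "seq_nth M pc m \<in> car R"
      by (rule partial_products_closed[OF pc(1)]) (auto intro: rirreducible_closed qc')
    note car = pak pbl pcm runit_closed[OF u] runit_closed[OF v] runit_closed[OF w]

    \<comment> \<open>The concatenation is specified as a relation between index and entry, with the
      shifted index \<open>j\<close> as an existential witness; \<open>seq_choice\<close> then
      yields a code.\<close>
    define P where "P i x \<longleftrightarrow> (i \<prec> k \<and> x = seq_nth M qa i) \<or>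
      (\<exists>j. j \<prec> l \<and> i = k \<oplus> j \<and> x = seq_nth M qb j)" for i x
    have "sigma1 (\<lambda>e. P (e 0) (e 1))" unfolding P_def
      by (intro sigma1_or sigma1_and sigma1_ex sigma1_less sigma1_eq dfun_seq_nth dfun_intros)
    moreover have "\<exists>x. P i x" if "i \<prec> k \<oplus> l" for i
    proof (cases "i \<prec> k")
      case False
      then obtain j where j: "i = k \<oplus> j" by (auto simp: L.not_less le_iff)
      then have "j \<prec> l" using that by (simp add: plus_comm[of k] plus_less_cancel)
      with j show ?thesis unfolding P_def by blast
    qed (auto simp: P_def)
    ultimately obtain s where s: "is_code s" and sP: "\<And>i. i \<prec> k \<oplus> l \<Longrightarrow> P i (seq_nth M s i)"
      using seq_choice[of P "k \<oplus> l"] by blast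
    have ikl: "i \<prec> k \<oplus> l" if "i \<prec> k" for i using that le_plus1[of k l] by (rule L.less_le_trans)
    have kjl: "k \<oplus> j \<prec> k \<oplus> l" if "j \<prec> l" for j using that by (simp add: plus_comm[of k] plus_less_cancel)
    have no: "\<not> k \<oplus> j \<prec> k" for j using le_plus1[of k j] by (simp add: L.not_less)
    have s1: "seq_nth M s i = seq_nth M qa i" if "i \<prec> k" for i
      using sP[OF ikl[OF that]] that no by (auto simp: P_def)
    have s2: "seq_nth M s (k \<oplus> j) = seq_nth M qb j" if "j \<prec> l" for j
      using sP[OF kjl[OF that]] no by (auto simp: P_def plus_comm[of k] plus_right_cancel)
    have sirr: "rirreducible M R (seq_nth M s i)" if "i \<prec> k \<oplus> l" for i
      using sP[OF that] qa qb by (auto simp: P_def)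
    have "dfun (\<lambda>e. seq_nth M s (e 0))" by (intro dfun_seq_nth dfun_intros)
    from partial_products_exist[OF this, of "k \<oplus> l"]
    obtain p where p: "is_code p" "partial_products (seq_nth M s) (k \<oplus> l) p" by blast
    have "seq_nth M p k = seq_nth M pa k"
      by (rule partial_products_cong[OF p(2) pa(1)]) (auto simp: s1 le_plus1)
    then have pkl: "seq_nth M p (k \<oplus> l) = seq_nth M pa k \<cdot> seq_nth M pb l"
      using partial_products_append[OF p(2) pb(1) s2 rirreducible_closed[OF sirr] rirreducible_closed[OF qb]]
      by simp
    have "a \<cdot> b = (u \<cdot> v) \<cdot> seq_nth M p (k \<oplus> l)"
      unfolding pkl a b using car by (simp add: mul_ac)
    then have f1: "factorisation M R (rirreducible M R) (a \<cdot> b) (u \<cdot> v) (k \<oplus> l) s"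
      using runit_mul[OF u v] s sirr rirreducible_closed p by (intro factorisationI[of _ _ _ _ p])

    \<comment> \<open>Placing \<open>q\<close> at the last index \<open>m\<close> makes it easy to
      follow through the bijection.\<close>
    obtain t where t: "is_code t" "\<And>i. i \<prec> m \<Longrightarrow> seq_nth M t i = seq_nth M qc i" "seq_nth M t m = q"
      using seq_extend[of m qc q] by blast
    have tirr: "rirreducible M R (seq_nth M t i)" if "i \<prec> m \<oplus> \<one>" for i
      using that t qc' q by (auto simp: less_succ)
    have "dfun (\<lambda>e. seq_nth M t (e 0))" by (intro dfun_seq_nth dfun_intros)
    from partial_products_exist[OF this, of "m \<oplus> \<one>"]
    obtain p' where p': "is_code p'" "partial_products (seq_nth M t) (m \<oplus> \<one>) p'" by blast
    have "seq_nth M p' m = seq_nth M pc m"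
      by (rule partial_products_cong[OF p'(2) pc(1)]) (auto simp: t le_plus1)
    then have "seq_nth M p' (m \<oplus> \<one>) = seq_nth M pc m \<cdot> q"
      using partial_products_Suc[OF p'(2), of m] t(3) by (simp add: less_succ)
    then have "a \<cdot> b = w \<cdot> seq_nth M p' (m \<oplus> \<one>)"
      unfolding c c' using car \<open>q \<in> car R\<close> by (simp add: mul_ac)
    then have f2: "factorisation M R (rirreducible M R) (a \<cdot> b) w (m \<oplus> \<one>) t"
      using w t(1) tirr rirreducible_closed p' by (intro factorisationI[of _ _ _ _ p'])

    \<comment> \<open>Uniqueness is applied with the factorisation containing \<open>q\<close> in
      first place, so that \<open>h m\<close> is directly the index of its associate among the
      factors of \<open>a\<close> and \<open>b\<close>.\<close>
    note uniq = bspec[OF ufd[unfolded is_UFD_def] mul_closed[OF ab(1,2)], THEN mp, OF ab0, THEN conjunct2]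
    obtain h where mkl: "m \<oplus> \<one> = k \<oplus> l" and h: "is_bijection M (m \<oplus> \<one>) h"
      and as: "\<And>i. i \<prec> m \<oplus> \<one> \<Longrightarrow> rassociates M R (seq_nth M t i) (seq_nth M s (seq_nth M h i))"
      using uniq[rule_format, OF f2 f1] by blast
    have "m \<prec> m \<oplus> \<one>" by (simp add: less_succ)
    have hm: "seq_nth M h m \<prec> k \<oplus> l"
      using h \<open>m \<prec> m \<oplus> \<one>\<close> unfolding is_bijection_def mkl[symmetric] by (auto dest: seq_allD)
    have qs: "rdvd M R q (seq_nth M s (seq_nth M h m))"
      using as[OF \<open>m \<prec> m \<oplus> \<one>\<close>] t(3) rirreducible_closed[OF sirr[OF hm]] rassociates_rdvd by simp
    from sP[OF hm] show ?thesis unfolding P_def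
    proof (elim disjE exE conjE)
      assume i: "seq_nth M h m \<prec> k" and "seq_nth M s (seq_nth M h m) = seq_nth M qa (seq_nth M h m)"
      then have "rdvd M R q (seq_nth M pa k)"
        using partial_products_factor_rdvd[OF pa(1) rirreducible_closed[OF qa] i] qs rdvd_trans[OF \<open>q \<in> car R\<close>] by simp
      then have "rdvd M R q (seq_nth M pa k \<cdot> u)" using car \<open>q \<in> car R\<close> by (intro rdvd_mul)
      then show ?thesis unfolding a using car by (simp add: mul_comm)
    next
      fix j assume j: "j \<prec> l" and "seq_nth M s (seq_nth M h m) = seq_nth M qb j"
      then have "rdvd M R q (seq_nth M pb l)"
        using partial_products_factor_rdvd[OF pb(1) rirreducible_closed[OF qb] j] qs rdvd_trans[OF \<open>q \<in> car R\<close>] by simp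
      then have "rdvd M R q (seq_nth M pb l \<cdot> v)" using car \<open>q \<in> car R\<close> by (intro rdvd_mul)
      then show ?thesis unfolding b using car by (simp add: mul_comm)
    qed
  qed
  then show ?thesis using qc by (auto simp: rprime_def)
qed

lemma factorisation_mono:
  "factorisation M R P r u n q \<Longrightarrow> (\<And>x. P x \<Longrightarrow> Q x) \<Longrightarrow> factorisation M R Q r u n q"
  unfolding factorisation_def seq_all_def by blast

lemma UFD_imp_prime_factorisations:
  assumes "is_UFD M R" shows "has_prime_factorisations M R"
  unfolding has_prime_factorisations_def
proof (intro ballI impI)
  fix r assume "r \<in> car R" "r \<noteq> rzero R"
  then obtain u n q where "factorisation M R (rirreducible M R) r u n q"
    using assms unfolding is_UFD_def by blast
  then have "factorisation M R (rprime M R) r u n q"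
    by (rule factorisation_mono) (rule UFD_irreducible_prime[OF assms])
  then show "\<exists>u n q. factorisation M R (rprime M R) r u n q" by blast
qed

section \<open>Prime against irreducible elements\<close>

lemma rprime_imp_rirreducible:
  assumes "rprime M R r" shows "rirreducible M R r"
proof -
  have r: "r \<in> car R" "r \<noteq> rzero R" "\<not> runit M R r"
    and pr: "\<And>a b. a \<in> car R \<Longrightarrow> b \<in> car R \<Longrightarrow> rdvd M R r (a \<cdot> b) \<Longrightarrow> rdvd M R r a \<or> rdvd M R r b"
    using assms by (auto simp: rprime_def)
  have aux: "runit M R b" if "a \<in> car R" "b \<in> car R" "r = a \<cdot> b" "rdvd M R r a" for a b
  proof -
    obtain c where c: "c \<in> car R" "a = r \<cdot> c" using \<open>rdvd M R r a\<close> by (auto simp: rdvd_def)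
    have "r \<cdot> rone R = r \<cdot> (b \<cdot> c)"
      using that(2,3) c r(1) by (metis mul_assoc mul_comm mul_one mul_closed)
    then have "b \<cdot> c = rone R" using mul_left_cancel[of r "rone R" "b \<cdot> c"] r that(2) c(1) by simp
    then show ?thesis using that(2) c(1) by (auto simp: runit_def)
  qed
  have "runit M R a \<or> runit M R b" if ab: "a \<in> car R" "b \<in> car R" "r = a \<cdot> b" for a b
  proof -
    have "rdvd M R r a \<or> rdvd M R r b" using pr[OF ab(1,2)] ab(3) rdvd_refl[OF r(1)] by simp
    then show ?thesis using aux[OF ab] aux[of b a] ab mul_comm by auto
  qed
  then show ?thesis using r by (auto simp: rirreducible_def)
qed

text \<open>An element and its unit multiples divide the same elements.\<close>

lemma rprime_mul_unit:
  assumes "rprime M R q" "runit M R u" shows "rprime M R (u \<cdot> q)"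
proof -
  have q: "q \<in> car R" "q \<noteq> rzero R" "\<not> runit M R q" using assms(1) by (auto simp: rprime_def)
  obtain v where v: "v \<in> car R" "u \<cdot> v = rone R" using assms(2) by (rule runitE)
  have u: "u \<in> car R" using assms(2) by (rule runit_closed)
  have "rone R \<noteq> rzero R" using q(1,2) by (rule one_neq_zero)
  then have "u \<noteq> rzero R" using v mul_zero[OF v(1)] mul_comm[of "rzero R" v] by auto
  moreover have "\<not> runit M R (u \<cdot> q)" using runit_factor[of q u] u q mul_comm by auto
  moreover have "rdvd M R (u \<cdot> q) x \<longleftrightarrow> rdvd M R q x" if "x \<in> car R" for x
  proof
    assume "rdvd M R q x"
    then obtain c where "c \<in> car R" "x = q \<cdot> c" by (auto simp: rdvd_def)
    moreover have "(u \<cdot> q) \<cdot> (v \<cdot> c) = (u \<cdot> v) \<cdot> (q \<cdot> c)" using u v(1) q(1) \<open>c \<in> car R\<close> by (simp add: mul_ac)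
    ultimately have "x = (u \<cdot> q) \<cdot> (v \<cdot> c)" using v q by simp
    then show "rdvd M R (u \<cdot> q) x" using v \<open>c \<in> car R\<close> by (auto simp: rdvd_def)
  next
    have "rdvd M R q (u \<cdot> q)" using u q mul_comm by (auto simp: rdvd_def)
    then show "rdvd M R (u \<cdot> q) x \<Longrightarrow> rdvd M R q x" using q(1) by (blast intro: rdvd_trans)
  qed
  ultimately show ?thesis using assms(1) u q by (auto simp: rprime_def mul_eq_zero)
qed

text \<open>Only the last factor is split off, which takes one use of the recursion for partial
  products and no induction. As this prime is not a unit, irreducibility makes the remaining
  cofactor a unit.\<close>

lemma rirreducible_imp_rprime:
  assumes "has_prime_factorisations M R" "rirreducible M R r" shows "rprime M R r"
proof -
  have r: "r \<in> car R" "r \<noteq> rzero R" "\<not> runit M R r"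
    and irr: "\<And>a b. a \<in> car R \<Longrightarrow> b \<in> car R \<Longrightarrow> r = a \<cdot> b \<Longrightarrow> runit M R a \<or> runit M R b"
    using assms(2) by (auto simp: rirreducible_def)
  then obtain u n q where "factorisation M R (rprime M R) r u n q"
    using assms(1) by (auto simp: has_prime_factorisations_def)
  then obtain p where u: "runit M R u" and q: "\<And>i. i \<prec> n \<Longrightarrow> rprime M R (seq_nth M q i)"
    and p: "partial_products (seq_nth M q) n p" and rp: "r = u \<cdot> seq_nth M p n"
    using factorisationE[OF _ rprime_closed] by blast
  \<comment> \<open>An empty product would make \<open>r\<close> a unit.\<close>
  have "n \<noteq> \<zero>"
  proof
    assume "n = \<zero>"
    then have "r = u" using rp p runit_closed[OF u] by (simp add: partial_products_def)
    then show False using r(3) u by simp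
  qed
  then obtain m where m: "n = m \<oplus> \<one>" using zero_or_succ by blast
  have mn: "m \<prec> n" by (simp add: m less_succ)
  have pm: "seq_nth M p m \<in> car R"
    using partial_products_closed[OF p rprime_closed[OF q]] mn by (simp add: L.less_imp_le)
  have qm: "seq_nth M q m \<in> car R" "\<not> runit M R (seq_nth M q m)" using q[OF mn] by (auto simp: rprime_def)
  have r': "r = (u \<cdot> seq_nth M p m) \<cdot> seq_nth M q m"
    using rp partial_products_Suc[OF p mn] pm qm(1) runit_closed[OF u] by (simp add: m mul_assoc)
  then have "runit M R (u \<cdot> seq_nth M p m)"
    using irr[of "u \<cdot> seq_nth M p m" "seq_nth M q m"] pm qm runit_closed[OF u] by auto
  then show ?thesis using rprime_mul_unit[OF q[OF mn]] r' by simp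
qed

end

section \<open>Uniqueness of prime factorisations\<close>

context rca0_domain
begin

text \<open>Bijectivity is rewritten with bounded quantifiers so that it may occur in a
  \<open>sigma1\<close> induction formula.\<close>

lemma bij_betw_below_iff:
  "bij_betw f {i. i \<prec> m} {i. i \<prec> m} \<longleftrightarrow> (\<forall>k. k \<prec> m \<longrightarrow> f k \<prec> m) \<and>
    (\<forall>k. k \<prec> m \<longrightarrow> (\<forall>l. l \<prec> m \<longrightarrow> f k = f l \<longrightarrow> k = l)) \<and>
    (\<forall>l. l \<prec> m \<longrightarrow> (\<exists>k. k \<prec> m \<and> f k = l))"
proof -
  have "f ` {i. i \<prec> m} = {i. i \<prec> m} \<longleftrightarrow>
      (\<forall>k. k \<prec> m \<longrightarrow> f k \<prec> m) \<and> (\<forall>l. l \<prec> m \<longrightarrow> (\<exists>k. k \<prec> m \<and> f k = l))"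
    (is "?L \<longleftrightarrow> ?R")
  proof
    assume L: ?L
    have "f k \<prec> m" if "k \<prec> m" for k
    proof -
      have "f k \<in> f ` {i. i \<prec> m}" using that by simp
      then show ?thesis unfolding L by simp
    qed
    moreover have "\<exists>k. k \<prec> m \<and> f k = l" if "l \<prec> m" for l
    proof -
      have "l \<in> f ` {i. i \<prec> m}" unfolding L using that by simp
      then show ?thesis by auto
    qed
    ultimately show ?R by simp
  next
    assume R: ?R
    show ?L
    proof (intro equalityI subsetI)
      fix x assume "x \<in> f ` {i. i \<prec> m}"
      then show "x \<in> {i. i \<prec> m}" using R by auto
    next
      fix x assume "x \<in> {i. i \<prec> m}"
      then obtain k where "k \<prec> m" "f k = x" using R by auto
      then show "x \<in> f ` {i. i \<prec> m}" by auto
    qed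
  qed
  then show ?thesis by (simp add: bij_betw_def inj_on_def conj_ac)
qed

text \<open>Commutativity for a product of possibly nonstandard length, restricted to one
  transposition: the partial products agree up to \<open>i\<close>, differ from there up to
  \<open>k\<close>, and agree again from \<open>k + 1\<close> on.\<close>

lemma partial_products_swap:
  assumes p: "partial_products g m p" and p': "partial_products g' m p'"
    and g: "\<And>x. x \<prec> m \<Longrightarrow> g x \<in> car R"
    and ik: "i \<preceq> k" "k \<prec> m" and "g' i = g k" "g' k = g i"
    and same: "\<And>x. x \<prec> m \<Longrightarrow> x \<noteq> i \<Longrightarrow> x \<noteq> k \<Longrightarrow> g' x = g x"
  shows "seq_nth M p' m = seq_nth M p m"
proof (cases "i = k")
  case True
  then show ?thesis
    using assms by (intro partial_products_cong[OF p' p]) (metis L.order_refl)+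
next
  case False
  with ik have "i \<prec> k" by (simp add: le_def)
  have im: "i \<prec> m" using \<open>i \<prec> k\<close> ik(2) by (rule less_trans)
  have g': "g' x \<in> car R" if "x \<prec> m" for x
    using g that same[of x] \<open>g' i = g k\<close> \<open>g' k = g i\<close> im ik(2) by metis
  note gi = g[OF im] and gk = g[OF ik(2)]
  have pc: "seq_nth M p x \<in> car R" "seq_nth M p' x \<in> car R" if "x \<prec> m" for x
    using partial_products_closed[OF p g] partial_products_closed[OF p' g'] that L.less_imp_le by blast+
  have pi: "seq_nth M p' i = seq_nth M p i"
    by (rule partial_products_cong[OF p' p])
      (use same \<open>i \<prec> k\<close> im in \<open>auto dest: less_trans simp: less_irrefl L.less_imp_le\<close>)
  \<comment> \<open>Between the two positions one product contains \<open>g k\<close> where the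
    other contains \<open>g i\<close>; multiplying crosswise states this without division.\<close>
  have "seq_nth M p' k \<cdot> g i = seq_nth M p k \<cdot> g k"
  proof (rule sigma1_induct_range[of "\<lambda>x. seq_nth M p' x \<cdot> g i = seq_nth M p x \<cdot> g k" "i \<oplus> \<one>" k])
    show "sigma1 (\<lambda>e. seq_nth M p' (e 0) \<cdot> g i = seq_nth M p (e 0) \<cdot> g k)"
      by (intro sigma1_eq dfun_mul dfun_seq_nth dfun_intros)
    show "seq_nth M p' (i \<oplus> \<one>) \<cdot> g i = seq_nth M p (i \<oplus> \<one>) \<cdot> g k"
      unfolding partial_products_Suc[OF p im] partial_products_Suc[OF p' im] \<open>g' i = g k\<close> pi
      using pc[OF im] gi gk by (simp add: mul_ac)
    fix x assume x: "i \<oplus> \<one> \<preceq> x" "x \<prec> k" and IH: "seq_nth M p' x \<cdot> g i = seq_nth M p x \<cdot> g k"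
    have xm: "x \<prec> m" using x(2) ik(2) by (rule less_trans)
    have "g' x = g x" using same[OF xm] x by (auto simp: succ_le_iff_less less_irrefl)
    then have "seq_nth M p' (x \<oplus> \<one>) \<cdot> g i = (seq_nth M p' x \<cdot> g i) \<cdot> g x"
      unfolding partial_products_Suc[OF p' xm] using pc[OF xm] gi g[OF xm] by (simp add: mul_ac)
    also have "\<dots> = seq_nth M p (x \<oplus> \<one>) \<cdot> g k"
      unfolding IH partial_products_Suc[OF p xm] using pc[OF xm] gk g[OF xm] by (simp add: mul_ac)
    finally show "seq_nth M p' (x \<oplus> \<one>) \<cdot> g i = seq_nth M p (x \<oplus> \<one>) \<cdot> g k" .
  qed (use \<open>i \<prec> k\<close> in \<open>auto simp: succ_le_iff_less\<close>)
  then have pk: "seq_nth M p' (k \<oplus> \<one>) = seq_nth M p (k \<oplus> \<one>)"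
    unfolding partial_products_Suc[OF p ik(2)] partial_products_Suc[OF p' ik(2)] \<open>g' k = g i\<close> .
  show ?thesis
  proof (rule sigma1_induct_range[of "\<lambda>x. seq_nth M p' x = seq_nth M p x" "k \<oplus> \<one>" m])
    show "sigma1 (\<lambda>e. seq_nth M p' (e 0) = seq_nth M p (e 0))" by (intro sigma1_eq dfun_seq_nth dfun_intros)
    fix x assume x: "k \<oplus> \<one> \<preceq> x" "x \<prec> m" and IH: "seq_nth M p' x = seq_nth M p x"
    have "k \<prec> x" using x(1) by (simp add: succ_le_iff_less)
    moreover have "i \<prec> x" using \<open>i \<prec> k\<close> \<open>k \<prec> x\<close> by (rule less_trans)
    ultimately have "g' x = g x" using same[OF x(2)] by (auto simp: less_irrefl)
    then show "seq_nth M p' (x \<oplus> \<one>) = seq_nth M p (x \<oplus> \<one>)"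
      using IH by (simp add: partial_products_Suc[OF p x(2)] partial_products_Suc[OF p' x(2)])
  qed (use ik(2) pk in \<open>auto simp: succ_le_iff_less\<close>)
qed

lemma bij_betw_swap:
  assumes "bij_betw f A A" "i \<in> A" "k \<in> A"
  shows "bij_betw (\<lambda>x. if x = i then f k else if x = k then f i else f x) A A"
proof -
  define t where "t x = (if x = i then k else if x = k then i else x)" for x
  have "bij_betw t A A"
    by (rule bij_betw_byWitness[where f' = t]) (use assms in \<open>auto simp: t_def\<close>)
  then have "bij_betw (f \<circ> t) A A" using assms(1) by (rule bij_betw_trans)
  moreover have "f \<circ> t = (\<lambda>x. if x = i then f k else if x = k then f i else f x)"
    by (auto simp: t_def fun_eq_iff)
  ultimately show ?thesis by simp
qed

lemma rprime_rdvd_rirreducible: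
  assumes "rprime M R q" "rirreducible M R s" "rdvd M R q s"
  shows "rassociates M R q s"
proof -
  have q: "q \<in> car R" "\<not> runit M R q" using assms(1) by (auto simp: rprime_def)
  obtain c where c: "c \<in> car R" "s = q \<cdot> c" using assms(3) by (auto simp: rdvd_def)
  then have "runit M R c" using assms(2) q by (auto simp: rirreducible_def)
  then obtain v where v: "runit M R v" "v \<in> car R" "c \<cdot> v = rone R" by (rule runitE)
  have "q = s \<cdot> v" using c v q by (simp add: mul_assoc)
  then show ?thesis using v(1) by (auto simp: rassociates_def)
qed

text \<open>
  The first \<open>i\<close> factors of the two factorisations have been matched: \<open>h\<close> codes a permutation of the
  indices of \<open>q'\<close>, and \<open>p\<close> the partial products of the permuted sequence.
\<close>

definition matching :: "'a \<Rightarrow> 'a \<Rightarrow> 'a \<Rightarrow> 'a \<Rightarrow> 'a \<Rightarrow> 'a \<Rightarrow> 'a \<Rightarrow> bool" where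
  "matching q q' m z i h p \<longleftrightarrow> is_code h \<and> bij_betw (seq_nth M h) {i. i \<prec> m} {i. i \<prec> m} \<and>
     partial_products (\<lambda>k. seq_nth M q' (seq_nth M h k)) m p \<and> seq_nth M p m = z \<and>
     (\<forall>j. j \<prec> i \<longrightarrow> j \<prec> m \<and> rassociates M R (seq_nth M q j) (seq_nth M q' (seq_nth M h j)))"

text \<open>The units witnessing \<open>rassociates\<close> are unbounded existentials below the
  bounded quantifier over \<open>j\<close>, so collection enters here through
  \<open>sigma1_ball\<close>.\<close>

lemma sigma1_matching: "sigma1 (\<lambda>e. \<exists>h p. matching q q' m z (e 0) h p)"
  unfolding matching_def bij_betw_below_iff partial_products_def
  by (intro sigma1_ex sigma1_and sigma1_is_code sigma1_ball sigma1_imp sigma1_eq sigma1_less sigma1_rassociates delta1_eq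
      dfun_mul dfun_seq_nth dfun_intros)

lemma matching_0:
  assumes "partial_products (seq_nth M q') m p"
  shows "\<exists>h. matching q q' m (seq_nth M p m) \<zero> h p"
proof -
  have "dfun (\<lambda>e. e 0)" by (rule dfun_var)
  from beta_exists[of "\<lambda>x. x", OF this, of m]
  obtain h where h: "is_code h" "\<And>i. i \<prec> m \<Longrightarrow> seq_nth M h i = i" by blast
  then have "bij_betw (seq_nth M h) {i. i \<prec> m} {i. i \<prec> m}" unfolding bij_betw_below_iff by auto
  then have "matching q q' m (seq_nth M p m) \<zero> h p"
    using assms h unfolding matching_def partial_products_def by simp
  then show ?thesis by blast
qed

text \<open>The units relating matched factors multiply up. Their product is only asserted to exist
  at each stage, so the units need not be collected in a sequence.\<close>

lemma matching_partial_products: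
  assumes P: "partial_products (seq_nth M q) n P" and q: "\<And>j. j \<prec> n \<Longrightarrow> seq_nth M q j \<in> car R"
    and q': "\<And>k. k \<prec> m \<Longrightarrow> seq_nth M q' k \<in> car R"
    and mt: "matching q q' m z i h p" and "i \<preceq> n" "i \<preceq> m"
  shows "\<exists>w. runit M R w \<and> seq_nth M P i = seq_nth M p i \<cdot> w"
proof (rule sigma1_induct_range[of "\<lambda>i. \<exists>w. runit M R w \<and> seq_nth M P i = seq_nth M p i \<cdot> w" \<zero> i])
  show "sigma1 (\<lambda>e. \<exists>w. runit M R w \<and> seq_nth M P (e 0) = seq_nth M p (e 0) \<cdot> w)"
    by (intro sigma1_ex sigma1_and sigma1_runit sigma1_eq dfun_mul dfun_seq_nth dfun_intros)
  have p: "partial_products (\<lambda>k. seq_nth M q' (seq_nth M h k)) m p"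
    and h: "bij_betw (seq_nth M h) {i. i \<prec> m} {i. i \<prec> m}"
    and as: "\<And>j. j \<prec> i \<Longrightarrow> rassociates M R (seq_nth M q j) (seq_nth M q' (seq_nth M h j))"
    using mt by (auto simp: matching_def)
  have g: "seq_nth M q' (seq_nth M h k) \<in> car R" if "k \<prec> m" for k
    using q' h that by (auto simp: bij_betw_below_iff)
  show "\<exists>w. runit M R w \<and> seq_nth M P \<zero> = seq_nth M p \<zero> \<cdot> w"
    using P p runit_one by (auto simp: partial_products_def)
  fix j assume j: "j \<prec> i" and "\<exists>w. runit M R w \<and> seq_nth M P j = seq_nth M p j \<cdot> w"
  then obtain w where w: "runit M R w" "seq_nth M P j = seq_nth M p j \<cdot> w" by blast
  obtain v where v: "runit M R v" "seq_nth M q j = seq_nth M q' (seq_nth M h j) \<cdot> v"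
    using as[OF j] by (auto simp: rassociates_def)
  have jn: "j \<prec> n" and jm: "j \<prec> m" using j \<open>i \<preceq> n\<close> \<open>i \<preceq> m\<close> by (auto intro: L.less_le_trans)
  have "seq_nth M p j \<in> car R" by (rule partial_products_closed[OF p g]) (use jm in \<open>auto intro: L.less_imp_le\<close>)
  then have "seq_nth M P (j \<oplus> \<one>) = seq_nth M p (j \<oplus> \<one>) \<cdot> (w \<cdot> v)"
    unfolding partial_products_Suc[OF P jn] partial_products_Suc[OF p jm] w v
    using g[OF jm] runit_closed[OF w(1)] runit_closed[OF v(1)] by (simp add: mul_ac)
  then show "\<exists>w. runit M R w \<and> seq_nth M P (j \<oplus> \<one>) = seq_nth M p (j \<oplus> \<one>) \<cdot> w"
    using runit_mul[OF w(1) v(1)] by blast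
qed (auto simp: zero_le)

text \<open>The clause \<open>j \<prec> m\<close> in \<open>matching\<close> is there for this
  purpose: at \<open>i = n\<close> it gives one half of \<open>n = m\<close>.\<close>

lemma matching_le:
  assumes "matching q q' m z i h p" shows "i \<preceq> m"
proof (cases "i = \<zero>")
  case False
  then obtain j where "i = j \<oplus> \<one>" using zero_or_succ by blast
  then have "j \<prec> m" using assms by (auto simp: matching_def less_succ)
  then show ?thesis using \<open>i = j \<oplus> \<one>\<close> by (simp add: succ_le_iff_less)
qed (simp add: zero_le)

lemma rdvd_mul_unit_cancel:
  assumes "a \<in> car R" "b \<in> car R" "runit M R u" "rdvd M R a (u \<cdot> b)"
  shows "rdvd M R a b"
proof -
  obtain v where v: "v \<in> car R" "u \<cdot> v = rone R" using assms(3) by (rule runitE)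
  have u: "u \<in> car R" using assms(3) by (rule runit_closed)
  have "rdvd M R a ((u \<cdot> b) \<cdot> v)" using assms(1,2) v u by (intro rdvd_mul[OF _ _ _ assms(4)]) auto
  also have "(u \<cdot> b) \<cdot> v = (u \<cdot> v) \<cdot> b" using assms(2) v(1) u by (simp add: mul_ac)
  also have "\<dots> = b" using v assms(2) by simp
  finally show ?thesis .
qed

text \<open>
  The least \<open>k\<close> such that \<open>p\<^sub>i q\<^sub>i\<close> divides \<open>p\<^sub>k\<close> is some \<open>l + 1\<close> with \<open>l \<ge> i\<close>; by primality \<open>q\<^sub>i\<close>
  divides the \<open>l\<close>-th permuted factor, which is swapped into position \<open>i\<close>.
\<close>

lemma matching_step:
  assumes P: "partial_products (seq_nth M q) n P" and q: "\<And>j. j \<prec> n \<Longrightarrow> rprime M R (seq_nth M q j)"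
    and q': "\<And>k. k \<prec> m \<Longrightarrow> rirreducible M R (seq_nth M q' k)"
    and u: "runit M R u" and u': "runit M R u'" and eq: "u \<cdot> seq_nth M P n = u' \<cdot> z"
    and mt: "matching q q' m z i h p" and "i \<prec> n"
  shows "\<exists>h p. matching q q' m z (i \<oplus> \<one>) h p"
proof -
  let ?g = "\<lambda>k. seq_nth M q' (seq_nth M h k)"
  have p: "partial_products ?g m p" and pz: "seq_nth M p m = z"
    and h: "bij_betw (seq_nth M h) {i. i \<prec> m} {i. i \<prec> m}"
    and as: "\<And>j. j \<prec> i \<Longrightarrow> j \<prec> m \<and> rassociates M R (seq_nth M q j) (?g j)"
    using mt by (auto simp: matching_def)
  have girr: "rirreducible M R (?g k)" if "k \<prec> m" for k
    using q' h that by (auto simp: bij_betw_below_iff)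
  note g = rirreducible_closed[OF girr]
  have im: "i \<preceq> m" using mt by (rule matching_le)
  have qi: "seq_nth M q i \<in> car R" "\<not> runit M R (seq_nth M q i)" "seq_nth M q i \<noteq> rzero R"
    using q[OF \<open>i \<prec> n\<close>] by (auto simp: rprime_def)
  have one0: "rone R \<noteq> rzero R" using qi(1,3) by (rule one_neq_zero)
  have pc: "seq_nth M p k \<in> car R" if "k \<preceq> m" for k using partial_products_closed[OF p g that] .
  have g0: "?g k \<noteq> rzero R" if "k \<prec> m" for k using girr[OF that] by (simp add: rirreducible_def)
  have pi0: "seq_nth M p i \<noteq> rzero R" using partial_products_nonzero[OF p g g0 one0 im] .
  note pi = pc[OF im]
  let ?a = "seq_nth M p i \<cdot> seq_nth M q i"
  have ac: "?a \<in> car R" using pi qi by simp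

  obtain w where w: "runit M R w" "seq_nth M P i = seq_nth M p i \<cdot> w"
    using matching_partial_products[OF P rprime_closed[OF q] rirreducible_closed[OF q'] mt] \<open>i \<prec> n\<close> im L.less_imp_le
    by blast
  have "rdvd M R ?a (seq_nth M P (i \<oplus> \<one>))"
    unfolding partial_products_Suc[OF P \<open>i \<prec> n\<close>] w rdvd_def
    using pi qi(1) runit_closed[OF w(1)] by (intro bexI[of _ w]) (simp_all add: mul_ac)
  moreover have "rdvd M R (seq_nth M P (i \<oplus> \<one>)) (seq_nth M P n)"
    by (rule partial_products_rdvd[OF P rprime_closed[OF q]]) (use \<open>i \<prec> n\<close> in \<open>auto simp: succ_le_iff_less\<close>)
  ultimately have "rdvd M R ?a (seq_nth M P n)" using ac by (blast intro: rdvd_trans)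
  moreover have Pn: "seq_nth M P n \<in> car R" by (rule partial_products_closed[OF P rprime_closed[OF q]]) auto
  ultimately have "rdvd M R ?a (seq_nth M P n \<cdot> u)" using ac runit_closed[OF u] by (intro rdvd_mul)
  also have "seq_nth M P n \<cdot> u = u' \<cdot> z" using eq mul_comm[OF Pn runit_closed[OF u]] by simp
  finally have "rdvd M R ?a (u' \<cdot> seq_nth M p m)" using pz by simp
  then have dvd: "rdvd M R ?a (seq_nth M p m)"
    by (rule rdvd_mul_unit_cancel[OF ac pc[OF L.order_refl] u'])
  have "sigma1 (\<lambda>e. rdvd M R ?a (seq_nth M p (e 0)))" by (intro sigma1_rdvd dfun_seq_nth dfun_intros)
  from sigma1_least[of "\<lambda>k. rdvd M R ?a (seq_nth M p k)", OF this dvd]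
  obtain k where k: "rdvd M R ?a (seq_nth M p k)"
    and "\<forall>k'. k' \<prec> k \<longrightarrow> \<not> rdvd M R ?a (seq_nth M p k')" by (elim exE conjE)
  then have least: "\<not> rdvd M R ?a (seq_nth M p k')" if "k' \<prec> k" for k' using that by simp
  have km: "k \<preceq> m" using least[of m] dvd by (auto simp: L.not_less[symmetric])
  \<comment> \<open>If \<open>k \<le> i\<close>, then \<open>p_k\<close> divides \<open>p_i\<close>,
    hence so does \<open>p_i q_i\<close>; cancelling \<open>p_i\<close> would make
    \<open>q_i\<close> a unit.\<close>
  have "i \<prec> k"
  proof (rule ccontr)
    assume "\<not> i \<prec> k"
    then have "rdvd M R (seq_nth M p k) (seq_nth M p i)"
      by (intro partial_products_rdvd[OF p g]) (use im in \<open>auto simp: L.not_less\<close>)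
    then have "rdvd M R ?a (seq_nth M p i)" using k ac by (blast intro: rdvd_trans)
    then obtain c where c: "c \<in> car R" "seq_nth M p i = ?a \<cdot> c" by (auto simp: rdvd_def)
    then have "seq_nth M p i \<cdot> rone R = seq_nth M p i \<cdot> (seq_nth M q i \<cdot> c)"
      using pi qi(1) by (simp add: mul_assoc)
    then have "rone R = seq_nth M q i \<cdot> c"
      using mul_left_cancel[of "seq_nth M p i" "rone R" "seq_nth M q i \<cdot> c"] pi pi0 qi(1) c(1) by simp
    then show False using qi(1,2) c(1) by (auto simp: runit_def)
  qed
  then obtain l where l: "k = l \<oplus> \<one>" using zero_or_succ[of k] by auto
  have il: "i \<preceq> l" using \<open>i \<prec> k\<close> by (simp add: l less_succ_iff_le)
  have lm: "l \<prec> m" using km by (simp add: l succ_le_iff_less)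
  have "rdvd M R (seq_nth M p i) (seq_nth M p l)"
    by (rule partial_products_rdvd[OF p g il]) (use lm in \<open>auto intro: L.less_imp_le\<close>)
  then obtain t where t: "t \<in> car R" "seq_nth M p l = seq_nth M p i \<cdot> t" by (auto simp: rdvd_def)
  obtain x where x: "x \<in> car R" "seq_nth M p k = ?a \<cdot> x" using k by (auto simp: rdvd_def)
  have "seq_nth M p i \<cdot> (t \<cdot> ?g l) = seq_nth M p i \<cdot> (seq_nth M q i \<cdot> x)"
    using x t partial_products_Suc[OF p lm] pi qi(1) g[OF lm] by (simp add: l mul_assoc)
  then have "t \<cdot> ?g l = seq_nth M q i \<cdot> x"
    using mul_left_cancel[of "seq_nth M p i" "t \<cdot> ?g l" "seq_nth M q i \<cdot> x"] pi pi0 qi(1) t(1) x(1) g[OF lm] by simp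
  then have "rdvd M R (seq_nth M q i) (t \<cdot> ?g l)" using x(1) by (auto simp: rdvd_def)
  then have "rdvd M R (seq_nth M q i) t \<or> rdvd M R (seq_nth M q i) (?g l)"
    using q[OF \<open>i \<prec> n\<close>] t(1) g[OF lm] by (simp add: rprime_def)
  \<comment> \<open>Here minimality is used: \<open>q_i\<close> dividing \<open>t\<close> would let
    \<open>p_i q_i\<close> divide \<open>p_l\<close> already, with \<open>l\<close> below
    \<open>k\<close>.\<close>
  moreover have "\<not> rdvd M R (seq_nth M q i) t"
  proof
    assume "rdvd M R (seq_nth M q i) t"
    then obtain c where "c \<in> car R" "t = seq_nth M q i \<cdot> c" by (auto simp: rdvd_def)
    then have "seq_nth M p l = ?a \<cdot> c" using t pi qi(1) by (simp add: mul_assoc)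
    then have "rdvd M R ?a (seq_nth M p l)" using \<open>c \<in> car R\<close> by (auto simp: rdvd_def)
    then show False using least[of l] by (simp add: l less_succ)
  qed
  ultimately have assoc: "rassociates M R (seq_nth M q i) (?g l)"
    using rprime_rdvd_rirreducible q[OF \<open>i \<prec> n\<close>] girr[OF lm] by blast

  have im': "i \<prec> m" using il lm by (rule L.le_less_trans)
  \<comment> \<open>The positions \<open>i\<close> and \<open>l\<close> are exchanged. Since
    \<open>i \<le> l\<close>, all positions below \<open>i\<close> keep their partners.\<close>
  let ?f = "\<lambda>x. if x = i then seq_nth M h l else if x = l then seq_nth M h i else seq_nth M h x"
  have "dfun (\<lambda>e. ?f (e 0))" by (intro dfun_if delta1_eq dfun_seq_nth dfun_intros)
  from beta_exists[of ?f, OF this, of m]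
  obtain h' where h': "is_code h'" "\<And>x. x \<prec> m \<Longrightarrow> seq_nth M h' x = ?f x" by blast
  have "bij_betw ?f {i. i \<prec> m} {i. i \<prec> m}" using h by (rule bij_betw_swap) (use im' lm in auto)
  then have bij: "bij_betw (seq_nth M h') {i. i \<prec> m} {i. i \<prec> m}"
    by (rule iffD1[OF bij_betw_cong, rotated]) (simp add: h'(2))
  let ?g' = "\<lambda>k. seq_nth M q' (seq_nth M h' k)"
  have "dfun (\<lambda>e. ?g' (e 0))" by (intro dfun_seq_nth dfun_intros)
  from partial_products_exist[of ?g', OF this, of m]
  obtain p' where p': "partial_products ?g' m p'" by blast
  have "seq_nth M p' m = seq_nth M p m"
    by (rule partial_products_swap[OF p p' g il lm]) (auto simp: h'(2) im' lm)
  moreover have "rassociates M R (seq_nth M q j) (?g' j)" "j \<prec> m" if "j \<prec> i \<oplus> \<one>" for j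
  proof -
    show jm: "j \<prec> m" using that im' by (auto simp: less_succ dest: less_trans)
    show "rassociates M R (seq_nth M q j) (?g' j)"
    proof (cases "j = i")
      case True
      then show ?thesis using assoc im' by (simp add: h'(2))
    next
      case False
      then have "j \<prec> i" using that by (simp add: less_succ)
      then have "j \<noteq> l" using il by auto
      then show ?thesis using as[OF \<open>j \<prec> i\<close>] False jm by (simp add: h'(2))
    qed
  qed
  ultimately have "matching q q' m z (i \<oplus> \<one>) h' p'"
    using h'(1) bij p' pz by (simp add: matching_def)
  then show ?thesis by blast
qed

text \<open>The roles are asymmetric: primality of the first factors lets them divide a single
  factor on the other side, and irreducibility of the second ones turns that divisibility into
  association.\<close>

lemma prime_factorisation_unique:
  assumes P: "partial_products (seq_nth M q) n P" and q: "\<And>j. j \<prec> n \<Longrightarrow> rprime M R (seq_nth M q j)"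
    and P': "partial_products (seq_nth M q') m P'"
    and q': "\<And>k. k \<prec> m \<Longrightarrow> rirreducible M R (seq_nth M q' k)"
    and u: "runit M R u" and u': "runit M R u'" and eq: "u \<cdot> seq_nth M P n = u' \<cdot> seq_nth M P' m"
    and one0: "rone R \<noteq> rzero R"
  shows "n = m \<and> (\<exists>h. is_bijection M n h \<and>
    (\<forall>i. i \<prec> n \<longrightarrow> rassociates M R (seq_nth M q i) (seq_nth M q' (seq_nth M h i))))"
proof -
  let ?z = "seq_nth M P' m"
  have "\<exists>h p. matching q q' m ?z n h p"
  proof (rule sigma1_induct_range[of "\<lambda>i. \<exists>h p. matching q q' m ?z i h p" \<zero> n])
    show "sigma1 (\<lambda>e. \<exists>h p. matching q q' m ?z (e 0) h p)" by (rule sigma1_matching)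
    show "\<exists>h p. matching q q' m ?z \<zero> h p" using matching_0[OF P'] by blast
    show "\<exists>h p. matching q q' m ?z (i \<oplus> \<one>) h p"
      if "i \<prec> n" "\<exists>h p. matching q q' m ?z i h p" for i
      using that matching_step[OF P q q' u u' eq] by blast
  qed (auto simp: zero_le)
  then obtain h p where mt: "matching q q' m ?z n h p" by blast
  let ?g = "\<lambda>k. seq_nth M q' (seq_nth M h k)"
  have p: "partial_products ?g m p" and pz: "seq_nth M p m = ?z" and hc: "is_code h"
    and h: "bij_betw (seq_nth M h) {i. i \<prec> m} {i. i \<prec> m}"
    and as: "\<And>j. j \<prec> n \<Longrightarrow> j \<prec> m \<and> rassociates M R (seq_nth M q j) (?g j)"
    using mt by (auto simp: matching_def)
  have girr: "rirreducible M R (?g k)" if "k \<prec> m" for k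
    using q' h that by (auto simp: bij_betw_below_iff)
  note g = rirreducible_closed[OF girr]
  have nm: "n \<preceq> m" using mt by (rule matching_le)
  have "n = m"
  proof (rule ccontr)
    assume "n \<noteq> m"
    with nm have "n \<prec> m" by (simp add: le_def)
    have pn: "seq_nth M p n \<in> car R" by (rule partial_products_closed[OF p g nm])
    have pn0: "seq_nth M p n \<noteq> rzero R"
      by (rule partial_products_nonzero[OF p g _ one0 nm]) (use girr in \<open>auto simp: rirreducible_def\<close>)
    obtain w where w: "runit M R w" "seq_nth M P n = seq_nth M p n \<cdot> w"
      using matching_partial_products[OF P rprime_closed[OF q] rirreducible_closed[OF q'] mt] nm by blast
    have "rdvd M R (seq_nth M p (n \<oplus> \<one>)) (seq_nth M p m)"
      by (rule partial_products_rdvd[OF p g]) (use \<open>n \<prec> m\<close> in \<open>auto simp: succ_le_iff_less\<close>)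
    then obtain t where t: "t \<in> car R" "seq_nth M p m = (seq_nth M p n \<cdot> ?g n) \<cdot> t"
      unfolding partial_products_Suc[OF p \<open>n \<prec> m\<close>] by (auto simp: rdvd_def)
    note car = pn t(1) g[OF \<open>n \<prec> m\<close>] runit_closed[OF w(1)] runit_closed[OF u] runit_closed[OF u']
    \<comment> \<open>Both sides are arranged to carry the factor \<open>p_n\<close>; cancelling it
      exhibits the unmatched factor at index \<open>n\<close> as a divisor of the unit
      \<open>u w\<close>.\<close>
    have "seq_nth M p n \<cdot> (u \<cdot> w) = u \<cdot> seq_nth M P n" unfolding w using car by (simp add: mul_ac)
    also have "\<dots> = u' \<cdot> ((seq_nth M p n \<cdot> ?g n) \<cdot> t)" using eq pz t by simp
    also have "\<dots> = seq_nth M p n \<cdot> (?g n \<cdot> (t \<cdot> u'))" using car by (simp add: mul_ac)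
    finally have "u \<cdot> w = ?g n \<cdot> (t \<cdot> u')"
      using mul_left_cancel[of "seq_nth M p n" "u \<cdot> w" "?g n \<cdot> (t \<cdot> u')"] pn0 car by simp
    then have "runit M R (?g n \<cdot> (t \<cdot> u'))" using runit_mul[OF u w(1)] by simp
    then have "runit M R (?g n)" using runit_factor[of "?g n" "t \<cdot> u'"] car by simp
    then show False using girr[OF \<open>n \<prec> m\<close>] by (simp add: rirreducible_def)
  qed
  moreover have "is_bijection M m h"
    unfolding is_bijection_def seq_all_iff[OF hc] using h by (auto simp: bij_betw_below_iff)
  ultimately show ?thesis using as by blast
qed

lemma prime_factorisations_imp_UFD:
  assumes hp: "has_prime_factorisations M R" shows "is_UFD M R"
  unfolding is_UFD_def
proof (intro ballI impI conjI allI)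
  fix r assume r: "r \<in> car R" "r \<noteq> rzero R"
  then obtain u n q where "factorisation M R (rprime M R) r u n q"
    using hp unfolding has_prime_factorisations_def by blast
  then have "factorisation M R (rirreducible M R) r u n q"
    by (rule factorisation_mono) (rule rprime_imp_rirreducible)
  then show "\<exists>u n q. factorisation M R (rirreducible M R) r u n q" by blast
  have one0: "rone R \<noteq> rzero R" using r by (rule one_neq_zero)
  fix u n q u' m q'
  assume f: "factorisation M R (rirreducible M R) r u n q" and f': "factorisation M R (rirreducible M R) r u' m q'"
  obtain P where u: "runit M R u" and q: "\<And>i. i \<prec> n \<Longrightarrow> rirreducible M R (seq_nth M q i)"
    and P: "partial_products (seq_nth M q) n P" and rP: "r = u \<cdot> seq_nth M P n"
    using factorisationE[OF f rirreducible_closed] by blast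
  obtain P' where u': "runit M R u'" and q': "\<And>i. i \<prec> m \<Longrightarrow> rirreducible M R (seq_nth M q' i)"
    and P': "partial_products (seq_nth M q') m P'" and rP': "r = u' \<cdot> seq_nth M P' m"
    using factorisationE[OF f' rirreducible_closed] by blast
  have "u \<cdot> seq_nth M P n = u' \<cdot> seq_nth M P' m" using rP rP' by simp
  note un = prime_factorisation_unique[OF P rirreducible_imp_rprime[OF hp q] P' q' u u' this one0]
  show "n = m" "\<exists>h. is_bijection M n h \<and>
    (\<forall>i. i \<prec> n \<longrightarrow> rassociates M R (seq_nth M q i) (seq_nth M q' (seq_nth M h i)))"
    using un by blast+
qed

end

theorem theorem6p20:
  fixes M :: "'a l2_structure" and R :: "'a coded_ring"
  assumes "RCA0_model M" and "countable_integral_domain M R"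
  shows "is_UFD M R \<longleftrightarrow> has_prime_factorisations M R"
proof -
  interpret rca0_domain M R using assms by unfold_locales
  show ?thesis using UFD_imp_prime_factorisations prime_factorisations_imp_UFD by blast
qed

end
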